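(* Fix a weighting $\lambda$ of the variables, and let $f\in\mathbb{Z}[x_1,\ldots,x_n]$ be a degree $n$ polynomial with $\mathrm{init}\,f=\prod_{i=1}^n x_i$. Let $\mathcal{Y}_f$ be a poset of compatibly split subvarieties with respect to the splitting $\mathrm{Tr}(f^{p-1}\bullet)$ (here $p$ varies over some infinite set of primes), ordered by inclusion. (It need not be all of them.) Then over the rationals: (1) Any $Y\in\mathcal{Y}_f$ has a Gröbner basis $(g_i)$ whose initial terms $(\mathrm{init}\,g_i)$ are squarefree monomials. (2) Any $Y\in\mathcal{Y}_f$ is the scheme-theoretic intersection of $\{Z\in\mathcal{Y}_f:Z\ge Y,\ Z\text{ basic in }\mathcal{Y}_f\}$, and it suffices to use only the minimal elements of this set. (3) If we concatenate Gröbner bases of the minimal elements of $\{Z\in\mathcal{Y}_f:Z\ge Y,\ Z\text{ basic in }\mathcal{Y}_f\}$, we get a Gröbner basis of $Y$. Indeed (2) holds for $\mathcal{Y}$ a set of compatibly split subvarieties in any Frobenius split scheme, and (3) holds whenever $\mathrm{Tr}((\mathrm{init}\,f)^{p-1}\bullet)$ is a splitting.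
   Context: A near-splitting of a commutative $\mathbb{F}_p$-algebra $R$ is a map $\varphi:R\to R$ with $\varphi(a+b)=\varphi(a)+\varphi(b)$ and $\varphi(a^pb)=a\,\varphi(b)$. It is a (Frobenius) splitting if moreover $\varphi(1)=1$. A subscheme with ideal $I$ is compatibly split by the splitting $\varphi$ if $\varphi(I)\subseteq I$ (for schemes, the same with sheaves). $\mathrm{Tr}(\bullet)$ is the unique near-splitting of $\mathbb{F}_p[x_1,\ldots,x_n]$ whose value on each monomial $m$ is $\sqrt[p]{m\prod_i x_i}\,\big/\prod_i x_i$ if $m\prod_i x_i$ is a $p$th power, and $0$ otherwise; $\mathrm{Tr}(h\bullet)$ is the map $g\mapsto\mathrm{Tr}(hg)$. Elements of $\mathcal{Y}_f$ are subvarieties of affine $n$-space (over $\mathbb{Q}$) whose reductions mod $p$ are compatibly split for the primes $p$ in the infinite set. For a weighting $\lambda$, $\mathrm{init}(g)$ is the sum of the terms $c\prod_i x_i^{e_i}$ of $g$ with maximum $\sum_i\lambda_ie_i$, and $\mathrm{init}(I)$ is the span of $\{\mathrm{init}(g):g\in I\}$. A Gröbner basis of $I$ is a collection $\{g_1,\ldots,g_m\}\subseteq I$ such that $\{\mathrm{init}(g_i)\}$ generates $\mathrm{init}(I)$; a Gröbner basis of a subscheme is one of its ideal. In a finite poset $P$, an element $q_0$ is called basic if it is not the unique greatest lower bound of $\{q\in P:q>q_0\}$.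
   Formalization: Parts (2), (3) and the closing claims are proved for finite sets of compatibly split subvarieties closed under irreducible components of intersections (ambient space included); for arbitrary sets they fail, e.g. f=xyz with {V(x),V(y),V(x,y,z)}. *)

theory Defs
  imports
    Complex_Main
    "HOL-Library.Cardinality"
    "HOL-Library.Poly_Mapping"
    "HOL-Computational_Algebra.Primes"
    "HOL-Algebra.Order"
    "HOL-Algebra.Ideal"
    "HOL-Algebra.QuotRing"
    "HOL-Analysis.Abstract_Topology"
begin

section \<open>Basic elements of a poset\<close>

text \<open>
  In a partial order a greatest lower bound is automatically unique, so uniqueness need not be
  repeated. A unique maximal element is not basic: it is the greatest lower bound of the empty set.
\<close>

definition basic :: "('a, 'm) gorder_scheme \<Rightarrow> 'a \<Rightarrow> bool" where
  "basic L q \<longleftrightarrow> q \<in> carrier L \<and> \<not> greatest L q (Lower L {r \<in> carrier L. q \<sqsubset>\<^bsub>L\<^esub> r})"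

definition basics_above :: "('a, 'm) gorder_scheme \<Rightarrow> 'a \<Rightarrow> 'a set" where
  "basics_above L y = {z \<in> carrier L. y \<sqsubseteq>\<^bsub>L\<^esub> z \<and> basic L z}"

definition minimal_elements :: "('a, 'm) gorder_scheme \<Rightarrow> 'a set \<Rightarrow> 'a set" where
  "minimal_elements L A = {z \<in> A. \<forall>w\<in>A. w \<sqsubseteq>\<^bsub>L\<^esub> z \<longrightarrow> w = z}"


section \<open>Splittings of commutative algebras over the prime field\<close>

definition fp_algebra :: "nat \<Rightarrow> ('a, 'm) ring_scheme \<Rightarrow> bool" where
  "fp_algebra p R \<longleftrightarrow> cring R \<and> add_pow R p \<one>\<^bsub>R\<^esub> = \<zero>\<^bsub>R\<^esub>"

definition near_splitting :: "nat \<Rightarrow> ('a, 'm) ring_scheme \<Rightarrow> ('a \<Rightarrow> 'a) \<Rightarrow> bool" where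
  "near_splitting p R \<phi> \<longleftrightarrow>
     \<phi> \<in> carrier R \<rightarrow> carrier R \<and>
     (\<forall>a\<in>carrier R. \<forall>b\<in>carrier R. \<phi> (a \<oplus>\<^bsub>R\<^esub> b) = \<phi> a \<oplus>\<^bsub>R\<^esub> \<phi> b) \<and>
     (\<forall>a\<in>carrier R. \<forall>b\<in>carrier R. \<phi> (a [^]\<^bsub>R\<^esub> p \<otimes>\<^bsub>R\<^esub> b) = a \<otimes>\<^bsub>R\<^esub> \<phi> b)"

definition splitting :: "nat \<Rightarrow> ('a, 'm) ring_scheme \<Rightarrow> ('a \<Rightarrow> 'a) \<Rightarrow> bool" where
  "splitting p R \<phi> \<longleftrightarrow> near_splitting p R \<phi> \<and> \<phi> \<one>\<^bsub>R\<^esub> = \<one>\<^bsub>R\<^esub>"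

definition compatibly_split :: "('a \<Rightarrow> 'a) \<Rightarrow> 'a set \<Rightarrow> bool" where
  "compatibly_split \<phi> I \<longleftrightarrow> \<phi> ` I \<subseteq> I"


section \<open>Polynomials\<close>

text \<open>Polynomials with coefficients in \<open>'a\<close> in the variables indexed by the finite type \<open>'n\<close>.\<close>

type_synonym ('n, 'a) mpoly = "('n \<Rightarrow>\<^sub>0 nat) \<Rightarrow>\<^sub>0 'a"

text \<open>The exponent of the product of all the variables.\<close>

definition all_vars :: "'n::finite \<Rightarrow>\<^sub>0 nat" where
  "all_vars = (\<Sum>i\<in>UNIV. Poly_Mapping.single i 1)"

definition total_degree :: "('n::finite, 'a::zero) mpoly \<Rightarrow> nat" where
  "total_degree g =
     Max (insert 0 ((\<lambda>m. \<Sum>i\<in>UNIV. Poly_Mapping.lookup m i) ` Poly_Mapping.keys g))"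

definition poly_ring_rat :: "('n, rat) mpoly ring" where
  "poly_ring_rat = \<lparr>carrier = UNIV, mult = (*), one = 1, zero = 0, add = (+)\<rparr>"


subsection \<open>Reduction modulo a prime\<close>

text \<open>
  The polynomial ring over the field with \<open>p\<close> elements: its elements are the integer polynomials
  all of whose coefficients lie in \<open>{0..<p}\<close>.
\<close>

definition reduce :: "nat \<Rightarrow> ('n, int) mpoly \<Rightarrow> ('n, int) mpoly" where
  "reduce p = Poly_Mapping.map (\<lambda>c. c mod int p)"

definition poly_ring_mod :: "nat \<Rightarrow> ('n, int) mpoly ring" where
  "poly_ring_mod p =
     \<lparr>carrier = {g. \<forall>m. Poly_Mapping.lookup g m \<in> {0..<int p}},
      mult = (\<lambda>g h. reduce p (g * h)), one = 1,
      zero = 0, add = (\<lambda>g h. reduce p (g + h))\<rparr>"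

text \<open>
  The reduction modulo \<open>p\<close> of the subscheme of rational affine space with ideal \<open>I\<close>: the fibre
  over \<open>p\<close> of its closure in affine space over the integers.
\<close>

definition reduction :: "nat \<Rightarrow> ('n, rat) mpoly set \<Rightarrow> ('n, int) mpoly set" where
  "reduction p I = {reduce p g | g. Poly_Mapping.map rat_of_int g \<in> I}"


subsection \<open>The trace\<close>

definition trace_monomial :: "nat \<Rightarrow> ('n::finite \<Rightarrow>\<^sub>0 nat) \<Rightarrow> ('n, int) mpoly" where
  "trace_monomial p m =
     (if \<forall>i. p dvd Poly_Mapping.lookup (m + all_vars) i
      then Poly_Mapping.single (Poly_Mapping.map (\<lambda>k. k div p) (m + all_vars) - all_vars) 1
      else 0)"

text \<open>
  A near-splitting of the polynomial ring is linear over the prime field, hence determined by its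
  values on monomials.
\<close>

definition Tr :: "nat \<Rightarrow> ('n::finite, int) mpoly \<Rightarrow> ('n, int) mpoly" where
  "Tr p g = (\<Sum>m\<in>Poly_Mapping.keys g.
     Poly_Mapping.single 0 (Poly_Mapping.lookup g m) * trace_monomial p m)"

text \<open>The map \<open>Tr (f ^ (p - 1) \<bullet>)\<close> for an integer polynomial \<open>f\<close>.\<close>

definition Tr_pow :: "nat \<Rightarrow> ('n::finite, int) mpoly \<Rightarrow> ('n, int) mpoly \<Rightarrow> ('n, int) mpoly" where
  "Tr_pow p f g =
     Tr p (reduce p f [^]\<^bsub>poly_ring_mod p\<^esub> (p - 1) \<otimes>\<^bsub>poly_ring_mod p\<^esub> g)"


subsection \<open>Initial forms and Groebner bases\<close>

definition weight :: "('n::finite \<Rightarrow> real) \<Rightarrow> ('n \<Rightarrow>\<^sub>0 nat) \<Rightarrow> real" where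
  "weight lam m = (\<Sum>i\<in>UNIV. lam i * real (Poly_Mapping.lookup m i))"

definition init ::
    "('n::finite \<Rightarrow> real) \<Rightarrow> ('n, 'a::comm_monoid_add) mpoly \<Rightarrow> ('n, 'a) mpoly" where
  "init lam g =
     (\<Sum>m | m \<in> Poly_Mapping.keys g \<and>
           (\<forall>m'\<in>Poly_Mapping.keys g. weight lam m' \<le> weight lam m).
        Poly_Mapping.single m (Poly_Mapping.lookup g m))"

definition init_ideal ::
    "('n::finite \<Rightarrow> real) \<Rightarrow> ('n, rat) mpoly set \<Rightarrow> ('n, rat) mpoly set" where
  "init_ideal lam I = module.span (\<lambda>c g. Poly_Mapping.single 0 c * g) (init lam ` I)"

definition groebner_basis ::
    "('n::finite \<Rightarrow> real) \<Rightarrow> ('n, rat) mpoly set \<Rightarrow> ('n, rat) mpoly set \<Rightarrow> bool" where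
  "groebner_basis lam I G \<longleftrightarrow>
     finite G \<and> G \<subseteq> I \<and> Idl\<^bsub>poly_ring_rat\<^esub> (init lam ` G) = init_ideal lam I"

definition squarefree_monomial :: "('n, rat) mpoly \<Rightarrow> bool" where
  "squarefree_monomial g \<longleftrightarrow>
     (\<exists>m. g = Poly_Mapping.single m 1 \<and> (\<forall>i. Poly_Mapping.lookup m i \<le> 1))"


subsection \<open>Subvarieties of rational affine space\<close>

text \<open>
  A subvariety (integral closed subscheme) is given by its ideal, a prime ideal. Inclusion of
  subvarieties is reverse inclusion of ideals, and the ideal of a scheme-theoretic intersection is
  the sum of the ideals (the zero ideal for the empty intersection).
\<close>

abbreviation subvariety_rat :: "('n::finite, rat) mpoly set \<Rightarrow> bool" where
  "subvariety_rat I \<equiv> primeideal I poly_ring_rat"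

definition subvariety_poset :: "('n, rat) mpoly set set \<Rightarrow> ('n, rat) mpoly set gorder" where
  "subvariety_poset \<Y> = \<lparr>carrier = \<Y>, eq = (=), le = (\<lambda>I J. J \<subseteq> I)\<rparr>"

definition intersection_ideal :: "('n, rat) mpoly set set \<Rightarrow> ('n, rat) mpoly set" where
  "intersection_ideal \<Z> = Idl\<^bsub>poly_ring_rat\<^esub> (\<Union>\<Z>)"

definition component_rat :: "('n::finite, rat) mpoly set \<Rightarrow> ('n, rat) mpoly set \<Rightarrow> bool" where
  "component_rat I P \<longleftrightarrow> subvariety_rat P \<and> I \<subseteq> P \<and>
     (\<forall>Q. subvariety_rat Q \<and> I \<subseteq> Q \<and> Q \<subseteq> P \<longrightarrow> Q = P)"

text \<open>
  A stratification is closed under taking the irreducible components of intersections, the empty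
  intersection (the whole space) included. For an arbitrary set of compatibly split subvarieties
  the basic elements need not cut out the others: the only member of
  \<open>{V(x)}\<close> is not basic but is not the empty intersection, and in three-space the origin is the
  greatest lower bound of \<open>V(x)\<close> and \<open>V(y)\<close> within \<open>{V(x), V(y), V(x, y, z)}\<close>.
\<close>

definition stratification_rat :: "('n::finite, rat) mpoly set set \<Rightarrow> bool" where
  "stratification_rat \<Y> \<longleftrightarrow>
     (\<forall>\<Z>\<subseteq>\<Y>. \<forall>P. component_rat (intersection_ideal \<Z>) P \<longrightarrow> P \<in> \<Y>)"


section \<open>Schemes\<close>

text \<open>\<open>restr X U V\<close> is the restriction of sections from \<open>U\<close> to \<open>V\<close>.\<close>

record ('x, 'r) ringed_space =
  space_top :: "'x topology"
  sections :: "'x set \<Rightarrow> 'r ring"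
  restr :: "'x set \<Rightarrow> 'x set \<Rightarrow> 'r \<Rightarrow> 'r"

abbreviation is_open :: "('x, 'r) ringed_space \<Rightarrow> 'x set \<Rightarrow> bool" where
  "is_open X \<equiv> openin (space_top X)"

definition ringed_space :: "('x, 'r) ringed_space \<Rightarrow> bool" where
  "ringed_space X \<longleftrightarrow>
     (\<forall>U. is_open X U \<longrightarrow> cring (sections X U)) \<and>
     (\<forall>U V. is_open X U \<and> is_open X V \<and> V \<subseteq> U \<longrightarrow>
        restr X U V \<in> ring_hom (sections X U) (sections X V)) \<and>
     (\<forall>U. is_open X U \<longrightarrow> (\<forall>s\<in>carrier (sections X U). restr X U U s = s)) \<and>
     (\<forall>U V W. is_open X U \<and> is_open X V \<and> is_open X W \<and> W \<subseteq> V \<and> V \<subseteq> U \<longrightarrow>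
        (\<forall>s\<in>carrier (sections X U). restr X V W (restr X U V s) = restr X U W s)) \<and>
     (\<forall>\<U>. (\<forall>U\<in>\<U>. is_open X U) \<longrightarrow>
        (\<forall>s\<in>carrier (sections X (\<Union>\<U>)). \<forall>t\<in>carrier (sections X (\<Union>\<U>)).
           (\<forall>U\<in>\<U>. restr X (\<Union>\<U>) U s = restr X (\<Union>\<U>) U t) \<longrightarrow> s = t)) \<and>
     (\<forall>\<U> s. (\<forall>U\<in>\<U>. is_open X U \<and> s U \<in> carrier (sections X U)) \<and>
        (\<forall>U\<in>\<U>. \<forall>V\<in>\<U>. restr X U (U \<inter> V) (s U) = restr X V (U \<inter> V) (s V)) \<longrightarrow>
        (\<exists>t\<in>carrier (sections X (\<Union>\<U>)). \<forall>U\<in>\<U>. restr X (\<Union>\<U>) U t = s U))"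

definition open_subspace :: "('x, 'r) ringed_space \<Rightarrow> 'x set \<Rightarrow> ('x, 'r) ringed_space" where
  "open_subspace X U = X\<lparr>space_top := subtopology (space_top X) U\<rparr>"

definition ringed_space_iso :: "('x, 'r) ringed_space \<Rightarrow> ('y, 's) ringed_space \<Rightarrow> bool" where
  "ringed_space_iso X Y \<longleftrightarrow>
     (\<exists>h \<psi>. homeomorphic_map (space_top X) (space_top Y) h \<and>
        (\<forall>U. is_open X U \<longrightarrow> \<psi> U \<in> ring_iso (sections X U) (sections Y (h ` U))) \<and>
        (\<forall>U V. is_open X U \<and> is_open X V \<and> V \<subseteq> U \<longrightarrow>
           (\<forall>s\<in>carrier (sections X U). \<psi> V (restr X U V s) = restr Y (h ` U) (h ` V) (\<psi> U s))))"


subsection \<open>The spectrum of a commutative ring\<close>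

definition zariski_open :: "'r ring \<Rightarrow> 'r set set \<Rightarrow> bool" where
  "zariski_open R U \<longleftrightarrow> (\<exists>E\<subseteq>carrier R. U = {P. primeideal P R \<and> \<not> E \<subseteq> P})"

definition zariski_topology :: "'r ring \<Rightarrow> 'r set topology" where
  "zariski_topology R = topology (zariski_open R)"

lemma openin_zariski_topology: "openin (zariski_topology R) = zariski_open R"
proof -
  have "istopology (zariski_open R)"
    unfolding istopology_def
  proof (intro conjI allI impI)
    fix U V
    assume "zariski_open R U" "zariski_open R V"
    then obtain E F where E: "E \<subseteq> carrier R" "U = {P. primeideal P R \<and> \<not> E \<subseteq> P}"
      and F: "F \<subseteq> carrier R" "V = {P. primeideal P R \<and> \<not> F \<subseteq> P}"
      unfolding zariski_open_def by blast
    let ?G = "{e \<otimes>\<^bsub>R\<^esub> f | e f. e \<in> E \<and> f \<in> F \<and> e \<otimes>\<^bsub>R\<^esub> f \<in> carrier R}"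
    have "(\<not> E \<subseteq> P \<and> \<not> F \<subseteq> P) = (\<not> ?G \<subseteq> P)" if P: "primeideal P R" for P
    proof -
      interpret primeideal P R by (rule P)
      show ?thesis
      proof
        assume "\<not> E \<subseteq> P \<and> \<not> F \<subseteq> P"
        then obtain e f where ef: "e \<in> E" "e \<notin> P" "f \<in> F" "f \<notin> P" by blast
        then have "e \<in> carrier R" "f \<in> carrier R" using E F by auto
        moreover from this have "e \<otimes>\<^bsub>R\<^esub> f \<notin> P" using I_prime ef by blast
        ultimately show "\<not> ?G \<subseteq> P" using ef by blast
      next
        assume "\<not> ?G \<subseteq> P"
        then obtain e f where ef: "e \<in> E" "f \<in> F" "e \<otimes>\<^bsub>R\<^esub> f \<notin> P" by blast
        then have "e \<in> carrier R" "f \<in> carrier R" using E F by auto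
        then have "e \<notin> P" "f \<notin> P" using ef I_l_closed I_r_closed by blast+
        then show "\<not> E \<subseteq> P \<and> \<not> F \<subseteq> P" using ef by blast
      qed
    qed
    then have "U \<inter> V = {P. primeideal P R \<and> \<not> ?G \<subseteq> P}" using E F by blast
    moreover have "?G \<subseteq> carrier R" by blast
    ultimately show "zariski_open R (U \<inter> V)" unfolding zariski_open_def by blast
  next
    fix \<K>
    assume "\<forall>K\<in>\<K>. zariski_open R K"
    then have "\<forall>K\<in>\<K>. \<exists>E. E \<subseteq> carrier R \<and> K = {P. primeideal P R \<and> \<not> E \<subseteq> P}"
      unfolding zariski_open_def by blast
    then obtain E where E: "\<forall>K\<in>\<K>. E K \<subseteq> carrier R \<and> K = {P. primeideal P R \<and> \<not> E K \<subseteq> P}"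
      by metis
    then have "\<Union>\<K> = (\<Union>K\<in>\<K>. {P. primeideal P R \<and> \<not> E K \<subseteq> P})" by auto
    also have "\<dots> = {P. primeideal P R \<and> \<not> \<Union>(E ` \<K>) \<subseteq> P}" by blast
    finally have "\<Union>\<K> = {P. primeideal P R \<and> \<not> \<Union>(E ` \<K>) \<subseteq> P}" .
    moreover have "\<Union>(E ` \<K>) \<subseteq> carrier R" using E by blast
    ultimately show "zariski_open R (\<Union>\<K>)" unfolding zariski_open_def by blast
  qed
  then show ?thesis unfolding zariski_topology_def by (rule topology_inverse')
qed

text \<open>
  The fraction \<open>a / s\<close> in the localisation of \<open>R\<close> at the prime \<open>P\<close>, as an equivalence class of
  pairs.
\<close>

definition local_frac :: "'r ring \<Rightarrow> 'r set \<Rightarrow> 'r \<Rightarrow> 'r \<Rightarrow> ('r \<times> 'r) set" where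
  "local_frac R P a s =
     {(b, t). b \<in> carrier R \<and> t \<in> carrier R - P \<and>
        (\<exists>u\<in>carrier R - P. u \<otimes>\<^bsub>R\<^esub> (t \<otimes>\<^bsub>R\<^esub> a \<ominus>\<^bsub>R\<^esub> s \<otimes>\<^bsub>R\<^esub> b) = \<zero>\<^bsub>R\<^esub>)}"

definition spec_sections :: "'r ring \<Rightarrow> 'r set set \<Rightarrow> ('r set \<Rightarrow> ('r \<times> 'r) set) ring" where
  "spec_sections R U =
     \<lparr>carrier = {\<sigma> \<in> extensional U. \<forall>P\<in>U. \<exists>V a s.
        openin (zariski_topology R) V \<and> P \<in> V \<and> V \<subseteq> U \<and> a \<in> carrier R \<and> s \<in> carrier R \<and>
        (\<forall>Q\<in>V. s \<notin> Q \<and> \<sigma> Q = local_frac R Q a s)},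
      mult = (\<lambda>\<sigma> \<tau>. \<lambda>P\<in>U. \<Union>(a, s)\<in>\<sigma> P. \<Union>(b, t)\<in>\<tau> P.
        local_frac R P (a \<otimes>\<^bsub>R\<^esub> b) (s \<otimes>\<^bsub>R\<^esub> t)),
      one = (\<lambda>P\<in>U. local_frac R P \<one>\<^bsub>R\<^esub> \<one>\<^bsub>R\<^esub>),
      zero = (\<lambda>P\<in>U. local_frac R P \<zero>\<^bsub>R\<^esub> \<one>\<^bsub>R\<^esub>),
      add = (\<lambda>\<sigma> \<tau>. \<lambda>P\<in>U. \<Union>(a, s)\<in>\<sigma> P. \<Union>(b, t)\<in>\<tau> P.
        local_frac R P (a \<otimes>\<^bsub>R\<^esub> t \<oplus>\<^bsub>R\<^esub> b \<otimes>\<^bsub>R\<^esub> s) (s \<otimes>\<^bsub>R\<^esub> t))\<rparr>"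

definition Spec :: "'r ring \<Rightarrow> ('r set, 'r set \<Rightarrow> ('r \<times> 'r) set) ringed_space" where
  "Spec R = \<lparr>space_top = zariski_topology R, sections = spec_sections R,
             restr = (\<lambda>U V \<sigma>. restrict \<sigma> V)\<rparr>"

text \<open>
  The ring of an affine chart may be taken with elements of the type of the sections, being
  isomorphic to the ring of sections over the chart. The stalks are local because those of a
  spectrum are.
\<close>

definition scheme :: "('x, 'r) ringed_space \<Rightarrow> bool" where
  "scheme X \<longleftrightarrow> ringed_space X \<and>
     (\<forall>x\<in>topspace (space_top X). \<exists>U (R :: 'r ring).
        is_open X U \<and> x \<in> U \<and> cring R \<and> ringed_space_iso (open_subspace X U) (Spec R))"


subsection \<open>Subvarieties of a scheme\<close>

text \<open>
  A subvariety (integral closed subscheme) is an irreducible closed subset with its reduced induced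
  structure. Its ideal sheaf consists of the sections that vanish at all its points, where a section
  vanishes at a point if its germ there is not a unit, that is, lies in the maximal ideal of the
  stalk.
\<close>

definition vanishes_at :: "('x, 'r) ringed_space \<Rightarrow> 'x set \<Rightarrow> 'r \<Rightarrow> 'x \<Rightarrow> bool" where
  "vanishes_at X U s x \<longleftrightarrow>
     \<not> (\<exists>V. is_open X V \<and> x \<in> V \<and> V \<subseteq> U \<and> restr X U V s \<in> Units (sections X V))"

definition ideal_sheaf :: "('x, 'r) ringed_space \<Rightarrow> 'x set \<Rightarrow> 'x set \<Rightarrow> 'r set" where
  "ideal_sheaf X Z U = {s \<in> carrier (sections X U). \<forall>x\<in>U \<inter> Z. vanishes_at X U s x}"

definition subvariety :: "('x, 'r) ringed_space \<Rightarrow> 'x set \<Rightarrow> bool" where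
  "subvariety X Z \<longleftrightarrow> closedin (space_top X) Z \<and> Z \<noteq> {} \<and>
     (\<forall>A B. closedin (space_top X) A \<and> closedin (space_top X) B \<and> Z \<subseteq> A \<union> B \<longrightarrow>
        Z \<subseteq> A \<or> Z \<subseteq> B)"

definition closed_set_poset :: "'x set set \<Rightarrow> 'x set gorder" where
  "closed_set_poset \<Y> = \<lparr>carrier = \<Y>, eq = (=), le = (\<subseteq>)\<rparr>"

text \<open>
  The ideal sheaf of the scheme-theoretic intersection of the members of \<open>\<Z>\<close>: the sum of their
  ideal sheaves, sections of which are only locally sums of sections.
\<close>

definition intersection_sheaf :: "('x, 'r) ringed_space \<Rightarrow> 'x set set \<Rightarrow> 'x set \<Rightarrow> 'r set" where
  "intersection_sheaf X \<Z> U = {s \<in> carrier (sections X U). \<forall>x\<in>U. \<exists>V. is_open X V \<and> x \<in> V \<and> V \<subseteq> U \<and>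
     restr X U V s \<in> Idl\<^bsub>sections X V\<^esub> (\<Union>Z\<in>\<Z>. ideal_sheaf X Z V)}"

definition is_scheme_intersection :: "('x, 'r) ringed_space \<Rightarrow> 'x set \<Rightarrow> 'x set set \<Rightarrow> bool" where
  "is_scheme_intersection X Y \<Z> \<longleftrightarrow>
     (\<forall>U. is_open X U \<longrightarrow> ideal_sheaf X Y U = intersection_sheaf X \<Z> U)"

definition component :: "('x, 'r) ringed_space \<Rightarrow> 'x set \<Rightarrow> 'x set \<Rightarrow> bool" where
  "component X A W \<longleftrightarrow> subvariety X W \<and> W \<subseteq> A \<and>
     (\<forall>W'. subvariety X W' \<and> W \<subseteq> W' \<and> W' \<subseteq> A \<longrightarrow> W' = W)"

definition stratification :: "('x, 'r) ringed_space \<Rightarrow> 'x set set \<Rightarrow> bool" where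
  "stratification X \<Y> \<longleftrightarrow>
     (\<forall>\<Z>\<subseteq>\<Y>. \<forall>W. component X (topspace (space_top X) \<inter> \<Inter>\<Z>) W \<longrightarrow> W \<in> \<Y>)"


subsection \<open>Frobenius splittings of schemes\<close>

definition scheme_splitting ::
    "nat \<Rightarrow> ('x, 'r) ringed_space \<Rightarrow> ('x set \<Rightarrow> 'r \<Rightarrow> 'r) \<Rightarrow> bool" where
  "scheme_splitting p X \<phi> \<longleftrightarrow>
     (\<forall>U. is_open X U \<longrightarrow> fp_algebra p (sections X U) \<and> splitting p (sections X U) (\<phi> U)) \<and>
     (\<forall>U V. is_open X U \<and> is_open X V \<and> V \<subseteq> U \<longrightarrow>
        (\<forall>s\<in>carrier (sections X U). restr X U V (\<phi> U s) = \<phi> V (restr X U V s)))"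

definition compatibly_split_subvariety ::
    "('x, 'r) ringed_space \<Rightarrow> ('x set \<Rightarrow> 'r \<Rightarrow> 'r) \<Rightarrow> 'x set \<Rightarrow> bool" where
  "compatibly_split_subvariety X \<phi> Z \<longleftrightarrow> subvariety X Z \<and>
     (\<forall>U. is_open X U \<longrightarrow> compatibly_split (\<phi> U) (ideal_sheaf X Z U))"

end

theory Submission
  imports Defs "HOL-Number_Theory.Residues" "HOL-Library.List_Lexorder"
begin

text \<open>
  Write \<open>\<phi>\<close> for \<open>Tr (f ^ (p - 1) \<bullet>)\<close> on polynomials modulo \<open>p\<close>. It satisfies
  \<open>\<phi> (a ^ p * b) = a * \<phi> b\<close>, and under either set of hypotheses on \<open>f\<close> also \<open>\<phi> 1 = 1\<close>, so that
  \<open>\<phi> (a ^ p) = a\<close>. Moreover \<open>\<phi>\<close> is a contraction: as no monomial of \<open>f\<close> has larger weight than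
  \<open>\<Prod>i. x i\<close>, the weight of \<open>\<phi> g\<close> is at most that of \<open>g\<close> divided by \<open>p\<close>, and its degree is at most
  that of \<open>g\<close> divided by \<open>p\<close> plus a constant.

  Let \<open>I k\<close> be finitely many ideals whose reductions are stable under \<open>\<phi>\<close>, and let
  \<open>a ^ N = (\<Sum>k. i k)\<close> with \<open>i k \<in> I k\<close>. Multiplying by \<open>a ^ (p - N)\<close> and applying \<open>\<phi>\<close> gives
  \<open>a = (\<Sum>k. \<phi> (a ^ (p - N) * i k))\<close> modulo \<open>p\<close>. The summands lie in the reductions of the \<open>I k\<close>, their
  degrees are bounded independently of \<open>p\<close>, and the amount by which their weights exceed the weight
  of \<open>a\<close> tends to \<open>0\<close> as \<open>p\<close> grows; since only finitely many monomials are in question, it is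
  \<open>\<le> 0\<close> for large \<open>p\<close>. A relation of bounded degree that holds modulo infinitely many primes holds over
  the rationals (\<open>lift_relation\<close>). The resulting statement \<open>power_decomposition\<close> has two consequences.
  For arbitrary \<open>N\<close> it says that a sum of compatibly split ideals is radical, which is the geometric
  content of (2). For \<open>N = 1\<close> it says that an element \<open>a\<close> of the sum is a sum of elements of the
  \<open>I k\<close> none of which has larger weight than \<open>a\<close>. No leading terms cancel in such a sum, so the initial
  form of \<open>a\<close> is a sum of initial forms of elements of the \<open>I k\<close>, which is (3). As the excess
  is removed in a single step, this works for arbitrary real weights.

  For (1), let \<open>m\<close> be a monomial of \<open>init g\<close>, with \<open>g \<in> Y\<close>, and let \<open>q\<close> be the product of the variables
  that divide \<open>m\<close>. When \<open>p\<close> exceeds all exponents in \<open>g\<close>, the top weight part of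
  \<open>\<phi> (q ^ p / m * g)\<close> is a nonzero multiple of \<open>q\<close> modulo \<open>p\<close>: no other monomial of \<open>init g\<close> has the
  same exponents modulo \<open>p\<close> as \<open>m\<close>. Again the degree is bounded, so \<open>q\<close> is the initial form of an
  element of \<open>Y\<close> (\<open>squarefree_initial_form\<close>). As \<open>q\<close> divides \<open>m\<close>, finitely many squarefree monomials
  generate the initial ideal.

  In (2), a subvariety \<open>Y\<close> that is not basic is the greatest lower bound of the members \<open>Z\<close>
  strictly above it.
  Every component of the intersection of these \<open>Z\<close> is a member of the stratification and a lower
  bound, hence is contained in \<open>Y\<close>; so \<open>Y\<close> equals the intersection as a set. By
  induction in the finite poset, \<open>Y\<close> is the set-theoretic intersection of the basic elements above it
  (\<open>points_of_basics\<close>), and the intersection is scheme-theoretic because it is reduced. On affine space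
  reducedness is \<open>power_decomposition\<close>. On a split scheme it can be checked near each point:
  if \<open>s\<close> vanishes on \<open>Y\<close>, then in an affine chart some power of \<open>s\<close> lies in
  the sum of the ideals of the \<open>Z\<close> over a smaller neighbourhood \<open>W\<close> (\<open>local_power_in_sum\<close>), and over
  \<open>W\<close> the splitting extracts \<open>p\<close>-th roots inside that sum (\<open>frobenius_stable_radical\<close>).
\<close>

section \<open>Polynomials and reduction modulo a prime\<close>

abbreviation "coef \<equiv> Poly_Mapping.lookup"
abbreviation "supp \<equiv> Poly_Mapping.keys"
abbreviation "monomial \<equiv> Poly_Mapping.single"
abbreviation "rat_poly \<equiv> Poly_Mapping.map rat_of_int"

text \<open>
  Scalars are kept in the form \<open>monomial 0 c\<close>, for which coefficients of products are computed by
  \<open>coef_scale\<close>.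
\<close>

declare single_of_nat [simp del] single_of_int [simp del]

text \<open>
  The degree is the weight for which every variable counts \<open>1\<close> (\<open>mdeg_eq_weight\<close>), so bounds on
  degrees are instances of bounds on weights. Its values are natural numbers to support induction.
\<close>

definition mdeg :: "('n::finite \<Rightarrow>\<^sub>0 nat) \<Rightarrow> nat" where
  "mdeg m = (\<Sum>i\<in>UNIV. coef m i)"

lemma mdeg_add [simp]: "mdeg (a + b) = mdeg a + mdeg b"
  by (simp add: mdeg_def lookup_add sum.distrib)

lemma weight_add [simp]: "weight lam (a + b) = weight lam a + weight lam b"
  by (simp add: weight_def lookup_add sum.distrib algebra_simps)

lemma weight_zero [simp]: "weight lam 0 = 0"
  by (simp add: weight_def)

lemma coef_all_vars [simp]: "coef all_vars i = 1"
  by (simp add: all_vars_def lookup_sum lookup_single when_def)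

lemma finite_mdeg_le: "finite {m :: 'n::finite \<Rightarrow>\<^sub>0 nat. mdeg m \<le> C}"
proof -
  have "coef ` {m :: 'n \<Rightarrow>\<^sub>0 nat. mdeg m \<le> C} \<subseteq> (\<Pi>\<^sub>E i\<in>UNIV. {..C})"
  proof
    fix x assume "x \<in> coef ` {m :: 'n \<Rightarrow>\<^sub>0 nat. mdeg m \<le> C}"
    then obtain m where m: "x = coef m" "mdeg m \<le> C" by blast
    have "coef m i \<le> mdeg m" for i
      unfolding mdeg_def by (rule member_le_sum) auto
    then show "x \<in> (\<Pi>\<^sub>E i\<in>UNIV. {..C})" using m order_trans by (fastforce simp: PiE_def)
  qed
  moreover have "finite (\<Pi>\<^sub>E i\<in>(UNIV::'n set). {..C})" by (rule finite_PiE) auto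
  ultimately have "finite (coef ` {m :: 'n \<Rightarrow>\<^sub>0 nat. mdeg m \<le> C})" by (rule finite_subset)
  moreover have "inj_on coef {m :: 'n \<Rightarrow>\<^sub>0 nat. mdeg m \<le> C}"
    by (rule inj_onI) (metis poly_mapping_eq_iff)
  ultimately show ?thesis by (rule finite_imageD)
qed

lemma coef_monomial_times_add:
  fixes g :: "('n \<Rightarrow>\<^sub>0 nat) \<Rightarrow>\<^sub>0 'a::comm_semiring_1"
  shows "coef (monomial m c * g) (m + l) = c * coef g l"
proof -
  have "coef (monomial m c * g) (m + l) =
      (\<Sum>k. (c * (\<Sum>q. coef g q when m + l = k + q) when k = m))"
    unfolding lookup_mult lookup_single
    by (rule Sum_any.cong) (auto simp: when_def)
  also have "\<dots> = c * (\<Sum>q. coef g q when m + l = m + q)" by simp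
  also have "(\<Sum>q. coef g q when m + l = m + q) = coef g l" by simp
  finally show ?thesis .
qed

lemma coef_monomial_times_notin:
  fixes g :: "('n \<Rightarrow>\<^sub>0 nat) \<Rightarrow>\<^sub>0 'a::comm_semiring_1"
  assumes "\<nexists>l. k = m + l"
  shows "coef (monomial m c * g) k = 0"
proof (rule ccontr)
  assume "coef (monomial m c * g) k \<noteq> 0"
  then have "k \<in> supp (monomial m c * g)" by (simp add: in_keys_iff)
  then obtain a b where "a \<in> supp (monomial m c)" "k = a + b" using keys_mult by blast
  then show False using assms by (auto split: if_splits)
qed

lemma coef_scale [simp]:
  fixes g :: "('n \<Rightarrow>\<^sub>0 nat) \<Rightarrow>\<^sub>0 'a::comm_semiring_1"
  shows "coef (monomial 0 c * g) k = c * coef g k"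
  using coef_monomial_times_add[of 0 c g k] by simp

lemma poly_eq_sum_monomials:
  fixes g :: "'m \<Rightarrow>\<^sub>0 'a::comm_monoid_add"
  shows "g = (\<Sum>m\<in>supp g. monomial m (coef g m))"
proof (rule poly_mapping_eqI)
  fix k
  show "coef g k = coef (\<Sum>m\<in>supp g. monomial m (coef g m)) k"
    by (cases "k \<in> supp g") (auto simp: lookup_sum lookup_single when_def in_keys_iff)
qed

lemma poly_induct [case_names zero add monomial]:
  fixes g :: "'m \<Rightarrow>\<^sub>0 'a::comm_monoid_add"
  assumes "P 0" "\<And>f g. P f \<Longrightarrow> P g \<Longrightarrow> P (f + g)" "\<And>m c. P (monomial m c)"
  shows "P g"
proof -
  have "P (\<Sum>m\<in>A. monomial m (coef g m))" if "finite A" for A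
    using that by (induction A rule: finite_induct) (auto intro: assms)
  then show ?thesis using poly_eq_sum_monomials[of g] by (metis finite_keys)
qed

lemma coef_rat_poly [simp]: "coef (rat_poly g) m = of_int (coef g m)"
  by (simp add: Poly_Mapping.map.rep_eq when_def)

lemma rat_poly_add [simp]: "rat_poly (a + b) = rat_poly a + rat_poly b"
  by (rule poly_mapping_eqI) (simp add: lookup_add)

lemma rat_poly_minus [simp]: "rat_poly (a - b) = rat_poly a - rat_poly b"
  by (rule poly_mapping_eqI) (simp add: lookup_minus)

lemma rat_poly_zero [simp]: "rat_poly 0 = 0"
  by (rule poly_mapping_eqI) simp

lemma rat_poly_single [simp]: "rat_poly (monomial m c) = monomial m (rat_of_int c)"
  by (rule poly_mapping_eqI) (simp add: lookup_single when_def)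

lemma rat_poly_one [simp]: "rat_poly 1 = 1"
  by (rule poly_mapping_eqI) (simp add: lookup_one when_def)

lemma rat_poly_mult [simp]:
  fixes a b :: "('n \<Rightarrow>\<^sub>0 nat) \<Rightarrow>\<^sub>0 int"
  shows "rat_poly (a * b) = rat_poly a * rat_poly b"
proof (induction a rule: poly_induct)
  case (monomial m c)
  show ?case
  proof (induction b rule: poly_induct)
    case (monomial n d)
    then show ?case by (simp add: mult_single)
  qed (auto simp: distrib_left)
qed (auto simp: distrib_right)

lemma rat_poly_power [simp]:
  fixes a :: "('n \<Rightarrow>\<^sub>0 nat) \<Rightarrow>\<^sub>0 int"
  shows "rat_poly (a ^ k) = rat_poly a ^ k"
  by (induction k) auto

lemma rat_poly_sum [simp]: "rat_poly (sum f A) = (\<Sum>x\<in>A. rat_poly (f x))"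
  by (induction A rule: infinite_finite_induct) auto

lemma rat_poly_inj: "rat_poly a = rat_poly b \<longleftrightarrow> a = b"
  by (metis coef_rat_poly of_int_eq_iff poly_mapping_eqI)

lemma supp_rat_poly [simp]: "supp (rat_poly a) = supp a"
  by (auto simp: in_keys_iff)

lemma clear_denominators_finite:
  fixes q :: "'i \<Rightarrow> rat"
  assumes "finite A"
  shows "\<exists>d::int. d > 0 \<and> (\<forall>i\<in>A. \<exists>z. of_int d * q i = of_int z)"
  using assms
proof (induction A rule: finite_induct)
  case empty
  show ?case by (rule exI[of _ 1]) simp
next
  case (insert x A)
  then obtain d where d: "d > 0" "\<forall>i\<in>A. \<exists>z. of_int d * q i = of_int z" by blast
  obtain a b where ab: "b > 0" "q x = of_int a / of_int b"
    by (metis quotient_of_denom_pos quotient_of_div surj_pair)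
  have "\<exists>z. of_int (d * b) * q i = of_int z" if i: "i \<in> insert x A" for i
  proof (cases "i = x")
    case True
    then show ?thesis using ab by (intro exI[of _ "d * a"]) simp
  next
    case False
    then obtain z where z: "of_int d * q i = of_int z" using i d(2) False by auto
    have "of_int (d * b) * q i = of_int b * (of_int d * q i)" by simp
    also have "\<dots> = of_int (b * z)" unfolding z by simp
    finally show ?thesis by blast
  qed
  then show ?case using d ab by (intro exI[of _ "d * b"]) auto
qed

lemma clear_denominators:
  fixes g :: "'i \<Rightarrow> ('n \<Rightarrow>\<^sub>0 nat) \<Rightarrow>\<^sub>0 rat"
  assumes "finite K"
  shows "\<exists>d G. d > 0 \<and> (\<forall>k\<in>K. rat_poly (G k) = monomial 0 (of_int d) * g k)"
proof -
  have "finite (Sigma K (\<lambda>k. supp (g k)))" using assms by auto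
  from clear_denominators_finite[OF this, of "\<lambda>(k, m). coef (g k) m"]
  obtain d where d: "d > 0" "\<And>k m. k \<in> K \<Longrightarrow> m \<in> supp (g k) \<Longrightarrow> \<exists>z. of_int d * coef (g k) m = of_int z"
    by auto
  define G where "G k = Poly_Mapping.map (\<lambda>x. \<lfloor>of_int d * x\<rfloor>) (g k)" for k
  have "rat_poly (G k) = monomial 0 (of_int d) * g k" if k: "k \<in> K" for k
  proof (rule poly_mapping_eqI)
    fix m
    show "coef (rat_poly (G k)) m = coef (monomial 0 (of_int d) * g k) m"
    proof (cases "m \<in> supp (g k)")
      case True
      then obtain z where "of_int d * coef (g k) m = of_int z" using d(2)[OF k] by blast
      then show ?thesis using True by (simp add: G_def Poly_Mapping.map.rep_eq when_def in_keys_iff)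
    next
      case False
      then show ?thesis by (simp add: G_def Poly_Mapping.map.rep_eq when_def in_keys_iff)
    qed
  qed
  then show ?thesis using d by blast
qed

lemma coef_reduce [simp]: "coef (reduce p g) m = coef g m mod int p"
  by (simp add: reduce_def Poly_Mapping.map.rep_eq when_def)

lemma reduce_reduce [simp]: "reduce p (reduce p a) = reduce p a"
  by (rule poly_mapping_eqI) simp

lemma reduce_eq_iff: "reduce p a = reduce p b \<longleftrightarrow> (\<forall>m. int p dvd coef a m - coef b m)"
  unfolding poly_mapping_eq_iff fun_eq_iff coef_reduce mod_eq_dvd_iff ..

text \<open>
  In terms of divisibility in the polynomial ring, congruence is visibly compatible with products.
\<close>

lemma reduce_eq_iff_dvd:
  fixes a b :: "('n \<Rightarrow>\<^sub>0 nat) \<Rightarrow>\<^sub>0 int"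
  shows "reduce p a = reduce p b \<longleftrightarrow> monomial 0 (int p) dvd a - b"
proof
  assume L: "reduce p a = reduce p b"
  have "a - b = monomial 0 (int p) * Poly_Mapping.map (\<lambda>x. x div int p) (a - b)"
    using L unfolding reduce_eq_iff
    by (intro poly_mapping_eqI) (auto simp: Poly_Mapping.map.rep_eq when_def lookup_minus)
  then show "monomial 0 (int p) dvd a - b" by (rule dvdI)
next
  assume "monomial 0 (int p) dvd a - b"
  then obtain q where q: "a - b = monomial 0 (int p) * q" by (rule dvdE)
  have "coef a m - coef b m = int p * coef q m" for m
    unfolding lookup_minus[symmetric] q by simp
  then show "reduce p a = reduce p b" unfolding reduce_eq_iff by simp
qed

lemma reduce_add_cong:
  "reduce p a = reduce p a' \<Longrightarrow> reduce p b = reduce p b' \<Longrightarrow> reduce p (a + b) = reduce p (a' + b')"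
  unfolding poly_mapping_eq_iff fun_eq_iff coef_reduce lookup_add by (metis mod_add_eq)

lemma reduce_mult_cong:
  fixes a b :: "('n \<Rightarrow>\<^sub>0 nat) \<Rightarrow>\<^sub>0 int"
  assumes "reduce p a = reduce p a'" "reduce p b = reduce p b'"
  shows "reduce p (a * b) = reduce p (a' * b')"
proof -
  have "a * b - a' * b' = (a - a') * b + a' * (b - b')" by (simp add: algebra_simps)
  then show ?thesis using assms unfolding reduce_eq_iff_dvd by (metis dvd_add dvd_mult dvd_mult2)
qed

lemma reduce_one: "p > 1 \<Longrightarrow> reduce p 1 = 1"
  by (rule poly_mapping_eqI) (simp add: lookup_one when_def)

lemma poly_ring_mod_power:
  assumes "p > 1"
  shows "reduce p f [^]\<^bsub>poly_ring_mod p\<^esub> (k::nat) = reduce p (f ^ k)"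
proof (induction k)
  case 0
  then show ?case using assms by (simp add: poly_ring_mod_def nat_pow_def reduce_one)
next
  case (Suc k)
  have "reduce p f [^]\<^bsub>poly_ring_mod p\<^esub> Suc k =
      reduce p ((reduce p f [^]\<^bsub>poly_ring_mod p\<^esub> k) * reduce p f)"
    by (simp add: poly_ring_mod_def nat_pow_def)
  also have "\<dots> = reduce p (f ^ Suc k)"
    unfolding Suc power_Suc2 by (rule reduce_mult_cong) auto
  finally show ?case .
qed

section \<open>The trace as a Frobenius-linear map\<close>

definition dilate :: "nat \<Rightarrow> ('n \<Rightarrow>\<^sub>0 nat) \<Rightarrow> 'n \<Rightarrow>\<^sub>0 nat" where
  "dilate p m = Poly_Mapping.map ((*) p) m"

lemma coef_dilate [simp]: "coef (dilate p m) i = p * coef m i"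
  by (simp add: dilate_def Poly_Mapping.map.rep_eq when_def)

text \<open>
  The only monomial whose trace is the monomial with exponent \<open>m\<close>. Hence the trace merely selects
  coefficients (\<open>coef_Tr\<close>), and all its properties follow from this formula.
\<close>

definition trace_preimage :: "nat \<Rightarrow> ('n::finite \<Rightarrow>\<^sub>0 nat) \<Rightarrow> 'n \<Rightarrow>\<^sub>0 nat" where
  "trace_preimage p m = dilate p (m + all_vars) - all_vars"

lemma trace_preimage_plus: "p > 0 \<Longrightarrow> trace_preimage p m + all_vars = dilate p (m + all_vars)"
  by (rule poly_mapping_eqI) (simp add: trace_preimage_def lookup_add lookup_minus)

lemma coef_trace_preimage: "coef (trace_preimage p m) i = p * (coef m i + 1) - 1"
  by (simp add: trace_preimage_def lookup_add lookup_minus)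

lemma trace_preimage_add: "p > 0 \<Longrightarrow> trace_preimage p (m + l) = dilate p m + trace_preimage p l"
  by (rule poly_mapping_eqI) (simp add: coef_trace_preimage lookup_add algebra_simps)

lemma weight_dilate: "weight lam (dilate p m) = real p * weight lam m"
  by (simp add: weight_def sum_distrib_left mult.left_commute)

lemma weight_trace_preimage:
  assumes "p > 0"
  shows "weight lam (trace_preimage p m) =
    real p * (weight lam m + weight lam all_vars) - weight lam all_vars"
  using arg_cong[OF trace_preimage_plus[OF assms, of m], of "weight lam"]
  by (simp add: weight_dilate)

lemma coef_trace_monomial:
  assumes "p > 0"
  shows "coef (trace_monomial p m) k = (if m = trace_preimage p k then 1 else 0)"
proof (cases "\<forall>i. p dvd coef (m + all_vars) i")
  case True
  let ?k = "Poly_Mapping.map (\<lambda>k. k div p) (m + all_vars) - all_vars"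
  have "(?k = k) = (m = trace_preimage p k)"
  proof -
    have c: "coef ?k i = coef k i \<longleftrightarrow> coef m i = coef (trace_preimage p k) i" for i
    proof -
      obtain c where c: "coef m i + 1 = p * c" using True by (auto simp: lookup_add elim: dvdE)
      then have "c > 0" using assms by (cases c) auto
      have "coef ?k i = c - 1"
        using c assms by (simp add: lookup_minus Poly_Mapping.map.rep_eq when_def lookup_add)
      moreover have "coef m i = p * c - 1" using c by simp
      moreover have "p * c - 1 = p * (coef k i + 1) - 1 \<longleftrightarrow> c = coef k i + 1"
      proof -
        have "p * c > 0" "p * (coef k i + 1) > 0" using \<open>c > 0\<close> assms by auto
        then have "p * c - 1 = p * (coef k i + 1) - 1 \<longleftrightarrow> p * c = p * (coef k i + 1)" by linarith
        then show ?thesis using assms by (metis mult_cancel1 neq0_conv)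
      qed
      ultimately show ?thesis using \<open>c > 0\<close> by (auto simp: coef_trace_preimage)
    qed
    then show ?thesis unfolding poly_mapping_eq_iff fun_eq_iff by blast
  qed
  moreover have "trace_monomial p m = monomial ?k 1" using True by (simp add: trace_monomial_def)
  ultimately show ?thesis by (simp only: lookup_single when_def)
next
  case False
  have "m \<noteq> trace_preimage p k"
  proof
    assume "m = trace_preimage p k"
    then have "m + all_vars = dilate p (k + all_vars)" using trace_preimage_plus[OF assms] by simp
    then show False using False by simp
  qed
  then show ?thesis using False unfolding trace_monomial_def by simp
qed

lemma coef_Tr:
  assumes "p > 0"
  shows "coef (Tr p h) k = coef h (trace_preimage p k)"
proof -
  have "coef (Tr p h) k = (\<Sum>m\<in>supp h. if m = trace_preimage p k then coef h m else 0)"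
    unfolding Tr_def lookup_sum
    by (rule sum.cong) (auto simp: coef_trace_monomial[OF assms])
  also have "\<dots> = coef h (trace_preimage p k)" by (simp add: in_keys_iff)
  finally show ?thesis .
qed

text \<open>
  The near-splitting \<open>Tr_pow\<close> on arbitrary integer polynomials, so that neither its arguments nor the
  power of \<open>f\<close> have to be reduced (\<open>Tr_pow_reduce\<close>).
\<close>

definition frob_trace ::
    "nat \<Rightarrow> ('n::finite, int) mpoly \<Rightarrow> ('n, int) mpoly \<Rightarrow> ('n, int) mpoly" where
  "frob_trace p f g = Tr p (reduce p (f ^ (p - 1) * g))"

lemma coef_frob_trace:
  "p > 0 \<Longrightarrow> coef (frob_trace p f g) k = coef (f ^ (p - 1) * g) (trace_preimage p k) mod int p"
  by (simp add: frob_trace_def coef_Tr)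

lemma Tr_pow_reduce:
  assumes "p > 1"
  shows "Tr_pow p f (reduce p g) = frob_trace p f g"
proof -
  have "reduce p (reduce p (f ^ (p - 1)) * reduce p g) = reduce p (f ^ (p - 1) * g)"
    by (rule reduce_mult_cong) auto
  then show ?thesis
    unfolding Tr_pow_def poly_ring_mod_power[OF assms] frob_trace_def
    by (simp add: poly_ring_mod_def)
qed

lemma frob_trace_add:
  assumes "p > 0"
  shows "frob_trace p f (g + h) = reduce p (frob_trace p f g + frob_trace p f h)"
  by (rule poly_mapping_eqI)
    (simp add: assms coef_frob_trace lookup_add distrib_left mod_add_eq)

lemma frob_trace_sum:
  assumes "p > 0"
  shows "frob_trace p f (\<Sum>x\<in>A. g x) = reduce p (\<Sum>x\<in>A. frob_trace p f (g x))"
proof (induction A rule: infinite_finite_induct)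
  case (insert x A)
  have "frob_trace p f (\<Sum>x\<in>insert x A. g x) =
      reduce p (frob_trace p f (g x) + reduce p (\<Sum>x\<in>A. frob_trace p f (g x)))"
    using insert by (simp add: frob_trace_add[OF assms])
  also have "\<dots> = reduce p (frob_trace p f (g x) + (\<Sum>x\<in>A. frob_trace p f (g x)))"
    by (rule reduce_add_cong) auto
  finally show ?case using insert by simp
qed (auto intro!: poly_mapping_eqI simp: assms coef_frob_trace)

text \<open>
  The binomial coefficients strictly between the ends of a row of prime index are divisible by the
  prime.
\<close>

lemma freshman:
  fixes a b :: "('n, int) mpoly"
  assumes "prime p"
  shows "reduce p ((a + b) ^ p) = reduce p (a ^ p + b ^ p)"
proof -
  let ?P = "monomial 0 (int p) :: ('n, int) mpoly"
  let ?t = "\<lambda>k. of_nat (p choose k) * a ^ k * b ^ (p - k)"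
  have "p > 0" using assms prime_gt_0_nat by blast
  have "(a + b) ^ p = (\<Sum>k\<in>{0..p}. ?t k)" by (simp add: binomial_ring atLeast0AtMost)
  also have "{0..p} = insert 0 (insert p {0<..<p})" using \<open>p > 0\<close> by auto
  also have "(\<Sum>k\<in>insert 0 (insert p {0<..<p}). ?t k) = a ^ p + b ^ p + (\<Sum>k\<in>{0<..<p}. ?t k)"
    using \<open>p > 0\<close> by (simp add: algebra_simps)
  finally have "(a + b) ^ p - (a ^ p + b ^ p) = (\<Sum>k\<in>{0<..<p}. ?t k)" by simp
  moreover have "?P dvd (\<Sum>k\<in>{0<..<p}. ?t k)"
  proof (rule dvd_sum)
    fix k assume "k \<in> {0<..<p}"
    then have "p dvd p choose k" using assms by (intro dvd_choose_prime) auto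
    then obtain q where "p choose k = p * q" by (rule dvdE)
    then have "of_nat (p choose k) = ?P * of_nat q" by (simp add: single_of_nat)
    then show "?P dvd ?t k" by (metis dvd_triv_left dvd_mult2)
  qed
  ultimately show ?thesis unfolding reduce_eq_iff_dvd by simp
qed

lemma fermat_int:
  assumes "prime p"
  shows "c ^ p mod int p = c mod int p"
proof -
  define n where "n = nat (c mod int p)"
  have "p > 0" using assms prime_gt_0_nat by blast
  then have n: "int n = c mod int p" by (simp add: n_def)
  have "[n ^ p = n] (mod p)"
  proof (cases "p dvd n")
    case True
    then show ?thesis using \<open>p > 0\<close>
      by (metis cong_0_iff cong_sym cong_trans dvd_power_same dvd_trans dvd_power)
  next
    case False
    then have "[n ^ (p - 1) = 1] (mod p)" using assms fermat_theorem by blast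
    then have "[n ^ (p - 1) * n = 1 * n] (mod p)" by (rule cong_scalar_right)
    then show ?thesis using \<open>p > 0\<close> by (metis mult_1 power_minus_mult)
  qed
  then have "int (n ^ p) mod int p = int n mod int p" by (metis cong_def zmod_int)
  then show ?thesis by (simp add: n power_mod)
qed

lemma monomial_power: "monomial m (c::int) ^ k = monomial (dilate k m) (c ^ k)"
proof (induction k)
  case 0
  have "dilate 0 m = 0" by (rule poly_mapping_eqI) simp
  then show ?case by simp
next
  case (Suc k)
  have "dilate (Suc k) m = m + dilate k m" by (rule poly_mapping_eqI) (simp add: lookup_add)
  then show ?case using Suc by (simp add: mult_single)
qed

text \<open>
  Both sides are additive in \<open>a\<close> modulo \<open>p\<close>, which reduces the claim to a monomial \<open>a\<close>. There
  it is the shift \<open>trace_preimage_add\<close>, together with Fermat's little theorem for the coefficient.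
\<close>

lemma trace_near_splitting:
  fixes a h :: "('n::finite, int) mpoly"
  assumes "prime p"
  shows "Tr p (reduce p (a ^ p * h)) = reduce p (a * Tr p (reduce p h))"
proof -
  have p: "p > 0" using assms prime_gt_0_nat by blast
  show ?thesis
  proof (induction a rule: poly_induct)
    case zero
    then show ?case using p
      by (intro poly_mapping_eqI) (simp add: coef_Tr power_0_left)
  next
    case (add a b)
    have "reduce p ((a + b) ^ p * h) = reduce p ((a ^ p + b ^ p) * h)"
      by (rule reduce_mult_cong[OF freshman[OF assms]]) simp
    then have "Tr p (reduce p ((a + b) ^ p * h)) = Tr p (reduce p (a ^ p * h + b ^ p * h))"
      by (simp add: distrib_right)
    also have "\<dots> = reduce p (Tr p (reduce p (a ^ p * h)) + Tr p (reduce p (b ^ p * h)))"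
      by (rule poly_mapping_eqI) (simp add: coef_Tr p lookup_add mod_add_eq)
    also have "\<dots> = reduce p (a * Tr p (reduce p h) + b * Tr p (reduce p h))"
      unfolding add by (rule reduce_add_cong) auto
    finally show ?case by (simp add: distrib_right)
  next
    case (monomial m c)
    show ?case
    proof (rule poly_mapping_eqI)
      fix k
      show "coef (Tr p (reduce p (monomial m c ^ p * h))) k =
        coef (reduce p (monomial m c * Tr p (reduce p h))) k"
      proof (cases "\<exists>l. k = m + l")
        case True
        then obtain l where k: "k = m + l" by blast
        have "c ^ p * x mod int p = c * (x mod int p) mod int p" for x
          using fermat_int[OF assms, of c] by (metis mod_mult_cong mod_mult_right_eq)
        then show ?thesis
          by (simp add: coef_Tr p monomial_power k trace_preimage_add coef_monomial_times_add)
      next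
        case False
        (* The exponents of the preimage are p * (k + 1) - 1, so the multiples p * m below them are
           those with m <= k. *)
        have "\<nexists>l. trace_preimage p k = dilate p m + l"
        proof
          assume "\<exists>l. trace_preimage p k = dilate p m + l"
          then obtain l where l: "trace_preimage p k = dilate p m + l" by blast
          have "coef m i \<le> coef k i" for i
          proof -
            have "p * coef m i \<le> p * (coef k i + 1) - 1"
              using arg_cong[OF l, of "\<lambda>x. coef x i"] by (simp add: coef_trace_preimage lookup_add)
            then have "p * coef m i < p * (coef k i + 1)" using p by (simp add: algebra_simps)
            then show ?thesis by (metis Suc_eq_plus1 less_Suc_eq_le mult_less_cancel1)
          qed
          then have "k = m + (k - m)"
            by (intro poly_mapping_eqI) (simp add: lookup_add lookup_minus)
          then show False using False by blast
        qed
        then show ?thesis using False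
          by (simp add: coef_Tr p monomial_power coef_monomial_times_notin)
      qed
    qed
  qed
qed

lemma frob_trace_near_splitting:
  assumes "prime p"
  shows "frob_trace p f (a ^ p * h) = reduce p (a * frob_trace p f h)"
  unfolding frob_trace_def
  using trace_near_splitting[OF assms, of a "f ^ (p - 1) * h"] by (simp add: mult.left_commute)

definition weight_le :: "('n::finite \<Rightarrow> real) \<Rightarrow> ('n, 'a::zero) mpoly \<Rightarrow> real \<Rightarrow> bool" where
  "weight_le lam g r \<longleftrightarrow> (\<forall>m\<in>supp g. weight lam m \<le> r)"

lemma weight_le_times:
  fixes g h :: "('n::finite, 'a::comm_semiring_1) mpoly"
  assumes "weight_le lam g r" "weight_le lam h s"
  shows "weight_le lam (g * h) (r + s)"
  unfolding weight_le_def
proof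
  fix m assume "m \<in> supp (g * h)"
  then obtain a b where "a \<in> supp g" "b \<in> supp h" "m = a + b" using keys_mult by blast
  then show "weight lam m \<le> r + s" using assms by (auto simp: weight_le_def intro: add_mono)
qed

lemma weight_le_power:
  fixes g :: "('n::finite, 'a::comm_semiring_1) mpoly"
  assumes "weight_le lam g r"
  shows "weight_le lam (g ^ k) (real k * r)"
proof (induction k)
  case (Suc k)
  then show ?case using weight_le_times[OF assms Suc] by (simp add: algebra_simps)
qed (auto simp: weight_le_def)

text \<open>
  The contraction property: solved for \<open>weight lam m\<close>, and with \<open>r \<le> weight lam all_vars\<close>, the inequality
  bounds the weight of the trace by \<open>s / p\<close>.
\<close>

lemma weight_le_frob_trace:
  assumes "p > 0" "weight_le lam f r" "weight_le lam g s" "m \<in> supp (frob_trace p f g)"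
  shows "real p * (weight lam m + weight lam all_vars) \<le>
    real (p - 1) * r + s + weight lam all_vars"
proof -
  have "trace_preimage p m \<in> supp (f ^ (p - 1) * g)"
    using assms(1,4) by (auto simp: in_keys_iff coef_frob_trace)
  then have "weight lam (trace_preimage p m) \<le> real (p - 1) * r + s"
    using weight_le_times[OF weight_le_power[OF assms(2)] assms(3), of "p - 1"]
    by (auto simp: weight_le_def)
  then show ?thesis using assms(1) by (simp add: weight_trace_preimage)
qed

lemma mdeg_eq_weight: "real (mdeg m) = weight (\<lambda>_. 1) m"
  by (simp add: mdeg_def weight_def)

lemma mdeg_frob_trace_le:
  assumes "p > 0" "\<And>k. k \<in> supp f \<Longrightarrow> mdeg k \<le> d" "\<And>k. k \<in> supp g \<Longrightarrow> mdeg k \<le> e"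
    "m \<in> supp (frob_trace p f g)"
  shows "p * mdeg m \<le> (p - 1) * d + e"
proof -
  have "weight_le (\<lambda>_. 1) f (real d)" "weight_le (\<lambda>_. 1) g (real e)"
    using assms(2,3) by (auto simp: weight_le_def mdeg_eq_weight[symmetric])
  from weight_le_frob_trace[OF assms(1) this assms(4)]
  have "real p * real (mdeg m) + real p * real (mdeg (all_vars :: 'a \<Rightarrow>\<^sub>0 nat)) \<le>
      real ((p - 1) * d + e) + real (mdeg (all_vars :: 'a \<Rightarrow>\<^sub>0 nat))"
    by (simp add: mdeg_eq_weight[symmetric] distrib_left)
  moreover have "real (mdeg (all_vars :: 'a \<Rightarrow>\<^sub>0 nat)) \<le> real p * real (mdeg (all_vars :: 'a \<Rightarrow>\<^sub>0 nat))"
    using assms(1) by (simp add: mult_le_cancel_right1)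
  ultimately have "real (p * mdeg m) \<le> real ((p - 1) * d + e)" by simp
  then show ?thesis using of_nat_le_iff by blast
qed

section \<open>Linear relations and separating functionals\<close>

text \<open>
  Ideals of a ring that is a type; for rational polynomials this agrees with the carrier-based notion
  (\<open>ideal_poly_ring_rat_iff\<close>).
\<close>

definition poly_ideal :: "'a::comm_ring_1 set \<Rightarrow> bool" where
  "poly_ideal I \<longleftrightarrow> 0 \<in> I \<and> (\<forall>a\<in>I. \<forall>b\<in>I. a + b \<in> I) \<and> (\<forall>r. \<forall>a\<in>I. r * a \<in> I)"

lemma poly_ideal_diff: "poly_ideal I \<Longrightarrow> a \<in> I \<Longrightarrow> b \<in> I \<Longrightarrow> a - b \<in> I"
  unfolding poly_ideal_def by (metis add_uminus_conv_diff mult_minus1)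

text \<open>
  Linear duality: if a linear functional vanishes on the common kernel of finitely many others, it is
  a linear combination of them. A space with its functionals is encoded by the graph \<open>W\<close>, which
  pairs the values \<open>v j\<close> of the given functionals with the value \<open>c\<close> of the functional to be
  expressed. This makes the statement independent of any dimension theory.
\<close>

lemma separating_functional:
  fixes W :: "(('j \<Rightarrow> 'a::field) \<times> 'a) set"
  assumes "finite A"
    and "\<And>v c w d t. (v, c) \<in> W \<Longrightarrow> (w, d) \<in> W \<Longrightarrow> (\<lambda>j. v j - t * w j, c - t * d) \<in> W"
    and "\<And>v c. (v, c) \<in> W \<Longrightarrow> (\<forall>j\<in>A. v j = 0) \<Longrightarrow> c = 0"
  shows "\<exists>\<alpha>. \<forall>(v, c)\<in>W. c = (\<Sum>j\<in>A. \<alpha> j * v j)"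
  using assms
proof (induction A arbitrary: W rule: finite_induct)
  case empty
  then show ?case by fastforce
next
  case (insert j0 A)
  note sub = insert.prems(1) and ker = insert.prems(2)
  show ?case
  proof (cases "\<exists>(u, e)\<in>W. (\<forall>j\<in>A. u j = 0) \<and> u j0 \<noteq> 0")
    case True
    (* A vector on which only the functional j0 is nonzero splits the space into a line and the
       kernel of j0, to which the induction hypothesis applies. *)
    then obtain u e where u: "(u, e) \<in> W" "\<forall>j\<in>A. u j = 0" "u j0 \<noteq> 0" by blast
    define W' where "W' = {(v, c) \<in> W. v j0 = 0}"
    have "\<exists>\<alpha>. \<forall>(v, c)\<in>W'. c = (\<Sum>j\<in>A. \<alpha> j * v j)"
    proof (rule insert.IH)
      fix v c w d t assume "(v, c) \<in> W'" "(w, d) \<in> W'"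
      then show "(\<lambda>j. v j - t * w j, c - t * d) \<in> W'" using sub by (auto simp: W'_def)
    next
      fix v c assume "(v, c) \<in> W'" "\<forall>j\<in>A. v j = 0"
      then show "c = 0" using ker by (auto simp: W'_def)
    qed
    then obtain \<alpha> where \<alpha>: "\<And>v c. (v, c) \<in> W' \<Longrightarrow> c = (\<Sum>j\<in>A. \<alpha> j * v j)" by blast
    define \<beta> where "\<beta> = \<alpha>(j0 := e / u j0)"
    have "c = (\<Sum>j\<in>insert j0 A. \<beta> j * v j)" if v: "(v, c) \<in> W" for v c
    proof -
      define t where "t = v j0 / u j0"
      have "(\<lambda>j. v j - t * u j, c - t * e) \<in> W'"
        using sub[OF v u(1), of t] u(3) by (simp add: W'_def t_def)
      then have "c - t * e = (\<Sum>j\<in>A. \<alpha> j * (v j - t * u j))" by (rule \<alpha>)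
      also have "\<dots> = (\<Sum>j\<in>A. \<beta> j * v j)"
        using u(2) insert.hyps by (intro sum.cong) (auto simp: \<beta>_def)
      finally show ?thesis using insert.hyps by (simp add: \<beta>_def t_def algebra_simps)
    qed
    then show ?thesis by blast
  next
    case False
    have "\<exists>\<alpha>. \<forall>(v, c)\<in>W. c = (\<Sum>j\<in>A. \<alpha> j * v j)"
    proof (rule insert.IH)
      fix v c assume vc: "(v, c) \<in> W" "\<forall>j\<in>A. v j = 0"
      then have "v j0 = 0" using False by blast
      then show "c = 0" using vc ker by auto
    qed (use sub in blast)
    then obtain \<alpha> where \<alpha>: "\<And>v c. (v, c) \<in> W \<Longrightarrow> c = (\<Sum>j\<in>A. \<alpha> j * v j)" by blast
    have "c = (\<Sum>j\<in>insert j0 A. (\<alpha>(j0 := 0)) j * v j)" if v: "(v, c) \<in> W" for v c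
    proof -
      have "(\<Sum>j\<in>A. (\<alpha>(j0 := 0)) j * v j) = (\<Sum>j\<in>A. \<alpha> j * v j)"
        using insert.hyps by (intro sum.cong) auto
      then show ?thesis using \<alpha>[OF v] insert.hyps by simp
    qed
    then show ?thesis by blast
  qed
qed

section \<open>A graded monomial order\<close>

text \<open>
  An arbitrary enumeration of the variables, which makes the graded lexicographic order total.
\<close>

definition var_list :: "'n::finite list" where
  "var_list = (SOME xs. set xs = UNIV)"

lemma set_var_list: "set (var_list :: 'n::finite list) = UNIV"
  unfolding var_list_def by (rule someI_ex) (use finite_list[of "UNIV :: 'n set"] in auto)

text \<open>
  Comparing these lists lexicographically is the graded lexicographic order. As the degree comes first,
  only finitely many monomials lie below a given one, which is what makes induction along leading
  monomials possible.
\<close>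

definition order_key :: "('n::finite \<Rightarrow>\<^sub>0 nat) \<Rightarrow> nat list" where
  "order_key m = mdeg m # map (coef m) var_list"

lemma order_key_inject: "order_key a = order_key b \<longleftrightarrow> a = b"
proof
  assume "order_key a = order_key b"
  then have "\<forall>i\<in>set var_list. coef a i = coef b i" by (simp add: order_key_def)
  then show "a = b" by (intro poly_mapping_eqI) (simp add: set_var_list)
qed simp

lemma map_add_less:
  fixes f g :: "'i \<Rightarrow> nat"
  shows "map f xs < map g xs \<Longrightarrow> map (\<lambda>i. f i + h i) xs < map (\<lambda>i. g i + h i) xs"
  by (induction xs) auto

lemma order_key_add_less: "order_key a < order_key b \<Longrightarrow> order_key (a + c) < order_key (b + c)"
  using map_add_less[of "coef a" var_list "coef b" "coef c"]
  by (auto simp: order_key_def lookup_add[abs_def])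

lemma order_key_add_le: "order_key a \<le> order_key b \<Longrightarrow> order_key (a + c) \<le> order_key (b + c)"
  using order_key_add_less[of a b c] order_key_inject[of a b] by (auto simp: le_less)

lemma order_key_mdeg: "order_key a \<le> order_key b \<Longrightarrow> mdeg a \<le> mdeg b"
  by (auto simp: order_key_def)

lemma leading_monomial_exists:
  assumes "g \<noteq> 0"
  shows "\<exists>m\<in>supp g. \<forall>k\<in>supp g. order_key k \<le> order_key m"
proof -
  have "supp g \<noteq> {}" using assms by (metis empty_iff in_keys_iff lookup_zero poly_mapping_eqI)
  then have ne: "order_key ` supp g \<noteq> {}" by simp
  have fin: "finite (order_key ` supp g)" by simp
  obtain m where m: "m \<in> supp g" "order_key m = Max (order_key ` supp g)"
    using Max_in[OF fin ne] by auto
  have "order_key k \<le> order_key m" if "k \<in> supp g" for k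
    using Max_ge[OF fin] that m(2) by simp
  then show ?thesis using m(1) by blast
qed

text \<open>
  Coordinates are treated one after another; each passes to a monotone subsequence, and a decreasing
  sequence of natural numbers is eventually constant.
\<close>

lemma subseq_mono_coordinates:
  fixes s :: "nat \<Rightarrow> 'n \<Rightarrow> nat"
  assumes "finite A"
  shows "\<exists>r. strict_mono r \<and> (\<forall>i\<in>A. incseq (\<lambda>k. s (r k) i))"
  using assms
proof (induction A rule: finite_induct)
  case empty
  show ?case using strict_mono_id by blast
next
  case (insert i A)
  then obtain r where r: "strict_mono r" "\<forall>j\<in>A. incseq (\<lambda>k. s (r k) j)" by blast
  obtain f where f: "strict_mono f" "monoseq (\<lambda>k. s (r (f k)) i)"
    using seq_monosub[of "\<lambda>k. s (r k) i"] by blast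
  define x where "x k = s (r (f k)) i" for k
  have "\<exists>n. incseq (\<lambda>k. x (k + n))"
  proof (cases "incseq x")
    case True
    then show ?thesis by (intro exI[of _ 0]) simp
  next
    case False
    then have dec: "decseq x" using f(2) by (auto simp: monoseq_iff x_def[abs_def])
    obtain n where n: "\<And>k. x n \<le> x k" using ex_has_least_nat[of "\<lambda>_. True" 0 x] by auto
    have "x (k + n) = x n" for k
      using n[of "k + n"] decseqD[OF dec, of n "k + n"] by simp
    then show ?thesis by (intro exI[of _ n]) (simp add: incseq_def)
  qed
  then obtain n where n: "incseq (\<lambda>k. x (k + n))" by blast
  define r' where "r' k = r (f (k + n))" for k
  have "strict_mono r'"
    using r(1) f(1) by (simp add: r'_def strict_mono_def)
  moreover have "incseq (\<lambda>k. s (r' k) j)" if "j \<in> insert i A" for j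
  proof (cases "j = i")
    case True
    then show ?thesis using n by (simp add: r'_def x_def)
  next
    case False
    then have "incseq (\<lambda>k. s (r k) j)" using that r(2) by blast
    then show ?thesis using f(1)
      by (auto simp: r'_def incseq_def strict_mono_less_eq)
  qed
  ultimately show ?case by blast
qed

text \<open>
  The minimal elements of \<open>L\<close> suffice. If there were infinitely many, two of them would be comparable by
  \<open>subseq_mono_coordinates\<close>, contradicting minimality.
\<close>

lemma dickson:
  fixes L :: "('n::finite \<Rightarrow>\<^sub>0 nat) set"
  shows "\<exists>F\<subseteq>L. finite F \<and> (\<forall>m\<in>L. \<exists>a\<in>F. \<exists>b. m = a + b)"
proof -
  define F where "F = {m \<in> L. \<forall>a\<in>L. (\<forall>i. coef a i \<le> coef m i) \<longrightarrow> a = m}"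
  have "finite F"
  proof (rule ccontr)
    assume "infinite F"
    then obtain s :: "nat \<Rightarrow> 'n \<Rightarrow>\<^sub>0 nat" where s: "inj s" "range s \<subseteq> F"
      using infinite_countable_subset by blast
    obtain r where r: "strict_mono r" "\<And>i. incseq (\<lambda>k. coef (s (r k)) i)"
      using subseq_mono_coordinates[of UNIV "\<lambda>k. coef (s k)"] by auto
    have "\<forall>i. coef (s (r 0)) i \<le> coef (s (r 1)) i" using r(2) by (simp add: incseq_def)
    moreover have "s (r 0) \<in> F" "s (r 1) \<in> F" using s(2) by blast+
    ultimately have "s (r 0) = s (r 1)" by (simp add: F_def)
    then have "r 0 = r 1" using s(1) by (simp add: inj_eq)
    then show False using strict_mono_eq[OF r(1), of 0 1] by simp
  qed
  moreover have "\<exists>a\<in>F. \<exists>b. m = a + b" if "m \<in> L" for m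
    using that
  proof (induction "mdeg m" arbitrary: m rule: less_induct)
    case less
    show ?case
    proof (cases "m \<in> F")
      case True
      then show ?thesis by (metis add_0_right)
    next
      case False
      then obtain a where a: "a \<in> L" "\<forall>i. coef a i \<le> coef m i" "a \<noteq> m"
        using less.prems by (auto simp: F_def)
      then have m: "m = a + (m - a)"
        by (intro poly_mapping_eqI) (simp add: lookup_add lookup_minus)
      have "mdeg (m - a) \<noteq> 0"
      proof
        assume "mdeg (m - a) = 0"
        then have "m - a = 0" by (intro poly_mapping_eqI) (simp add: mdeg_def)
        then show False using m a(3) by simp
      qed
      then have "mdeg a < mdeg m" using arg_cong[OF m, of mdeg] by simp
      then obtain c b where "c \<in> F" "a = c + b" using less.hyps a(1) by blast
      then show ?thesis using m by (metis add.assoc)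
    qed
  qed
  ultimately show ?thesis by (intro exI[of _ F]) (auto simp: F_def)
qed

section \<open>Lifting relations from infinitely many primes\<close>

text \<open>
  An element of small degree in the reduction might come only from elements of large degree, whose
  high terms happen to be divisible by \<open>p\<close>. For all primes outside a finite set this does not occur.
  Choose finitely many \<open>g m\<close> in the ideal whose leading monomials generate all leading monomials,
  and let \<open>N\<close> be the product of their leading coefficients. If \<open>p\<close> does not divide \<open>N\<close>, a leading term of too
  large degree can be removed by subtracting a multiple of some \<open>g m\<close>: its coefficient is divisible by
  \<open>p\<close>, so modulo \<open>p\<close> the subtraction changes the element only by the unit \<open>c\<close>.
\<close>

lemma reduction_degree_lift:
  fixes I :: "('n::finite, rat) mpoly set"
  assumes I: "poly_ideal I"
  shows "\<exists>N::int. N \<noteq> 0 \<and> (\<forall>p C h. prime p \<and> \<not> int p dvd N \<and> h \<in> reduction p I \<and>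
    (\<forall>m\<in>supp h. mdeg m \<le> C) \<longrightarrow>
    (\<exists>i. rat_poly i \<in> I \<and> (\<forall>m\<in>supp i. mdeg m \<le> C) \<and> reduce p i = h))"
proof -
  define lead where "lead g m \<longleftrightarrow> m \<in> supp g \<and> (\<forall>k\<in>supp g. order_key k \<le> order_key m)"
    for g :: "('n, int) mpoly" and m
  define L where "L = {m. \<exists>g. rat_poly g \<in> I \<and> lead g m}"
  obtain F where F: "F \<subseteq> L" "finite F" "\<And>m. m \<in> L \<Longrightarrow> \<exists>a\<in>F. \<exists>b. m = a + b"
    using dickson[of L] by blast
  have "\<forall>m\<in>F. \<exists>g. rat_poly g \<in> I \<and> lead g m" using F(1) by (auto simp: L_def)
  then obtain g where g: "\<And>m. m \<in> F \<Longrightarrow> rat_poly (g m) \<in> I \<and> lead (g m) m" by metis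
  define N where "N = (\<Prod>m\<in>F. coef (g m) m)"
  have "coef (g m) m \<noteq> 0" if "m \<in> F" for m using g[OF that] by (auto simp: lead_def in_keys_iff)
  then have "N \<noteq> 0" using F(2) by (simp add: N_def)
  moreover have "\<exists>i. rat_poly i \<in> I \<and> (\<forall>m\<in>supp i. mdeg m \<le> C) \<and> reduce p i = reduce p h"
    if p: "prime p" "\<not> int p dvd N" and h: "rat_poly h \<in> I" "\<forall>m\<in>supp (reduce p h). mdeg m \<le> C"
    for p C h
  proof -
    define lower where "lower h = {k :: 'n \<Rightarrow>\<^sub>0 nat. \<exists>m\<in>supp h. order_key k \<le> order_key m}"
      for h :: "('n, int) mpoly"
    have fin: "finite (lower h)" for h :: "('n, int) mpoly"
    proof -
      have "lower h \<subseteq> (\<Union>m\<in>supp h. {k. mdeg k \<le> mdeg m})"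
        using order_key_mdeg unfolding lower_def by blast
      then show ?thesis by (rule finite_subset) (auto simp: finite_mdeg_le)
    qed
    show ?thesis
      using h
    proof (induction "card (lower h)" arbitrary: h
        rule: less_induct)
      case less
      note IH = less.hyps and hI = less.prems(1) and hC = less.prems(2)
      show ?case
      proof (cases "\<forall>m\<in>supp h. mdeg m \<le> C")
        case True
        then show ?thesis using hI by blast
      next
        case False
        then have "h \<noteq> 0" by auto
        then obtain M where M: "lead h M" using leading_monomial_exists by (auto simp: lead_def)
        then have "mdeg M > C" using False order_key_mdeg unfolding lead_def
          by (meson le_trans not_le)
        then have "M \<notin> supp (reduce p h)" using hC by auto
        then have pM: "int p dvd coef h M" by (simp add: in_keys_iff mod_eq_0_iff_dvd)
        have "M \<in> L" using M hI by (auto simp: L_def)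
        then obtain a b where ab: "a \<in> F" "M = a + b" using F(3) by blast
        define c where "c = coef (g a) a"
        have "c dvd N" unfolding N_def c_def using ab(1) F(2) by (rule dvd_prodI[rotated])
        then have pc: "\<not> int p dvd c" using p(2) dvd_trans by blast
        then have "c \<noteq> 0" by auto
        define h' where "h' = monomial 0 c * h - monomial b (coef h M) * g a"
        have h'I: "rat_poly h' \<in> I"
          using I hI g[OF ab(1)] unfolding h'_def rat_poly_minus rat_poly_mult
          by (intro poly_ideal_diff) (auto simp: poly_ideal_def)
        have red: "reduce p h' = reduce p (monomial 0 c * h)"
        proof -
          obtain q where q: "coef h M = int p * q" using pM by (rule dvdE)
          have "monomial b (coef h M) = monomial 0 (int p) * monomial b q"
            by (simp add: mult_single q)
          then have "monomial 0 (int p) dvd h' - monomial 0 c * h" by (simp add: h'_def mult.assoc)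
          then show ?thesis by (simp add: reduce_eq_iff_dvd)
        qed
        have low: "order_key k < order_key M" if k: "k \<in> supp h'" for k
        proof -
          have "k \<in> supp (monomial 0 c * h) \<or> k \<in> supp (monomial b (coef h M) * g a)"
            using k by (auto simp: h'_def in_keys_iff lookup_minus)
          then have "order_key k \<le> order_key M"
          proof
            assume "k \<in> supp (monomial 0 c * h)"
            then have "k \<in> supp h" by (simp add: in_keys_iff)
            then show ?thesis using M by (simp add: lead_def)
          next
            assume "k \<in> supp (monomial b (coef h M) * g a)"
            then obtain l where l: "l \<in> supp (g a)" "k = b + l"
              using keys_mult[of "monomial b (coef h M)" "g a"] by (auto split: if_splits)
            then have "order_key l \<le> order_key a" using g[OF ab(1)] by (simp add: lead_def)
            then have "order_key (l + b) \<le> order_key (a + b)" by (rule order_key_add_le)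
            then show ?thesis using l ab by (simp add: add.commute)
          qed
          moreover have "k \<noteq> M"
          proof
            assume "k = M"
            have "coef (monomial b (coef h M) * g a) M = coef h M * c"
              unfolding c_def ab(2) add.commute[of a b] by (rule coef_monomial_times_add)
            then have "coef h' M = 0" by (simp add: h'_def lookup_minus)
            then show False using k \<open>k = M\<close> by (simp add: in_keys_iff)
          qed
          ultimately show ?thesis using order_key_inject by (metis le_less)
        qed
        have "lower h' \<subset> lower h"
        proof
          show "lower h' \<subseteq> lower h"
          proof
            fix k assume "k \<in> lower h'"
            then obtain m where "m \<in> supp h'" "order_key k \<le> order_key m"
              unfolding lower_def by blast
            then have "order_key k \<le> order_key M" using low[of m] by (meson le_less order_trans)
            then show "k \<in> lower h" using M unfolding lead_def lower_def by blast
          qed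
          have "M \<in> lower h" using M by (auto simp: lead_def lower_def)
          moreover have "M \<notin> lower h'" using low by (auto simp: not_le lower_def)
          ultimately show "lower h' \<noteq> lower h" by metis
        qed
        then have "card (lower h') < card (lower h)"
          using fin by (simp add: psubset_card_mono)
        moreover have "\<forall>m\<in>supp (reduce p h'). mdeg m \<le> C"
        proof
          fix m assume "m \<in> supp (reduce p h')"
          then have "(c * coef h m) mod int p \<noteq> 0" by (simp add: red in_keys_iff)
          then have "coef h m mod int p \<noteq> 0" by (metis mod_mult_right_eq mult_zero_right mod_0)
          then show "mdeg m \<le> C" using hC by (simp add: in_keys_iff)
        qed
        ultimately obtain i where i: "rat_poly i \<in> I" "\<forall>m\<in>supp i. mdeg m \<le> C"
          "reduce p i = reduce p h'"
          using IH[of h'] h'I by blast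
        (* Undo the factor c that was introduced to avoid denominators. *)
        have "coprime c (int p)"
          using prime_imp_coprime[of "int p" c] p(1) pc by (simp add: coprime_commute)
        then obtain d where d: "[c * d = 1] (mod int p)" using cong_solve_coprime_int by blast
        have "reduce p (monomial 0 d * i) = reduce p (monomial 0 d * (monomial 0 c * h))"
          by (rule reduce_mult_cong) (auto simp: i(3) red)
        also have "\<dots> = reduce p h"
        proof (rule poly_mapping_eqI)
          fix k
          have "d * (c * coef h k) mod int p = (c * d) * coef h k mod int p" by (simp add: ac_simps)
          also have "\<dots> = 1 * coef h k mod int p" using d by (metis cong_def mod_mult_left_eq)
          finally show "coef (reduce p (monomial 0 d * (monomial 0 c * h))) k = coef (reduce p h) k"
            by simp
        qed
        finally have "reduce p (monomial 0 d * i) = reduce p h" .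
        moreover have "rat_poly (monomial 0 d * i) \<in> I" using I i(1) by (simp add: poly_ideal_def)
        moreover have "\<forall>m\<in>supp (monomial 0 d * i). mdeg m \<le> C" using i(2) by (simp add: in_keys_iff)
        ultimately show ?thesis by blast
      qed
    qed
  qed
  ultimately show ?thesis unfolding reduction_def by blast
qed

lemma finite_nat_divisors: "(z::int) \<noteq> 0 \<Longrightarrow> finite {p::nat. int p dvd z}"
proof (rule finite_subset)
  assume z: "z \<noteq> 0"
  show "{p::nat. int p dvd z} \<subseteq> {..nat \<bar>z\<bar>}" using dvd_imp_le_int[OF z] by fastforce
qed simp

text \<open>
  The unknowns \<open>i k\<close> of degree at most \<open>C\<close> and a scalar \<open>c\<close> form a vector space with finitely many linear
  conditions: on \<open>E\<close> the coefficients of \<open>c * u\<close> and of \<open>\<Sum>k. i k\<close> agree, and the coefficients of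
  \<open>i k\<close> on \<open>A k\<close> vanish. If no solution has \<open>c \<noteq> 0\<close>, then by duality \<open>c\<close> is a rational linear
  combination of the conditions. Let \<open>d\<close> be a common denominator. A solution modulo \<open>p\<close> with \<open>c = 1\<close>
  lifts by \<open>reduction_degree_lift\<close> to integer polynomials that satisfy the conditions modulo \<open>p\<close>, which
  forces \<open>p\<close> to divide \<open>d\<close>. This is impossible for infinitely many \<open>p\<close>.
\<close>

lemma lift_relation:
  fixes I :: "'k \<Rightarrow> ('n::finite, rat) mpoly set" and u :: "('n, int) mpoly"
  assumes K: "finite K" and I: "\<And>k. k \<in> K \<Longrightarrow> poly_ideal (I k)"
    and T: "infinite T" "\<And>p. p \<in> T \<Longrightarrow> prime p"
    and rel: "\<And>p. p \<in> T \<Longrightarrow> \<exists>h. (\<forall>k\<in>K. h k \<in> reduction p (I k) \<and>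
          (\<forall>m\<in>supp (h k). mdeg m \<le> C \<and> m \<notin> A k)) \<and>
        (\<forall>m\<in>E. int p dvd coef u m - (\<Sum>k\<in>K. coef (h k) m))"
  shows "\<exists>i. (\<forall>k\<in>K. i k \<in> I k \<and> (\<forall>m\<in>supp (i k). mdeg m \<le> C \<and> m \<notin> A k)) \<and>
    (\<forall>m\<in>E. mdeg m \<le> C \<longrightarrow> of_int (coef u m) = (\<Sum>k\<in>K. coef (i k) m))"
proof (rule ccontr)
  assume not: "\<not> ?thesis"
  define B where "B = {m :: 'n \<Rightarrow>\<^sub>0 nat. mdeg m \<le> C}"
  have "finite B" by (simp add: B_def finite_mdeg_le)
  define J :: "(('n \<Rightarrow>\<^sub>0 nat) + 'k \<times> ('n \<Rightarrow>\<^sub>0 nat)) set"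
    where "J = Inl ` (B \<inter> E) \<union> Inr ` (SIGMA k:K. B \<inter> A k)"
  have "finite J" using K \<open>finite B\<close> by (auto simp: J_def)
  (* The values of the conditions: Inl m compares coefficients at m, Inr (k, m) asks that the
     coefficient of i k at m vanish. *)
  define vec :: "('k \<Rightarrow> ('n, rat) mpoly) \<Rightarrow> rat \<Rightarrow> (('n \<Rightarrow>\<^sub>0 nat) + 'k \<times> ('n \<Rightarrow>\<^sub>0 nat)) \<Rightarrow> rat"
    where "vec i c j = (case j of Inl m \<Rightarrow> (\<Sum>k\<in>K. coef (i k) m) - c * of_int (coef u m)
      | Inr (k, m) \<Rightarrow> coef (i k) m)" for i c j
  define U where "U k = {i \<in> I k. supp i \<subseteq> B}" for k
  define W where "W = {(vec i c, c) | i c. \<forall>k\<in>K. i k \<in> U k}"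
  have U_diff: "i - monomial 0 t * j \<in> U k" if "k \<in> K" "i \<in> U k" "j \<in> U k" for i j t k
  proof -
    have "i - monomial 0 t * j \<in> I k"
      using I[OF that(1)] that(2,3) by (intro poly_ideal_diff) (auto simp: U_def poly_ideal_def)
    moreover have "supp (i - monomial 0 t * j) \<subseteq> B"
    proof
      fix m assume "m \<in> supp (i - monomial 0 t * j)"
      then have "m \<in> supp i \<or> m \<in> supp j" by (auto simp: in_keys_iff lookup_minus)
      then show "m \<in> B" using that(2,3) by (auto simp: U_def)
    qed
    ultimately show ?thesis by (simp add: U_def)
  qed
  have "\<exists>\<alpha>. \<forall>(v, c)\<in>W. c = (\<Sum>j\<in>J. \<alpha> j * v j)"
  proof (rule separating_functional[OF \<open>finite J\<close>])
    fix v c w d t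
    assume "(v, c) \<in> W" "(w, d) \<in> W"
    then obtain i i' where i: "\<forall>k\<in>K. i k \<in> U k" "v = vec i c" "\<forall>k\<in>K. i' k \<in> U k" "w = vec i' d"
      by (auto simp: W_def)
    define i'' where "i'' k = i k - monomial 0 t * i' k" for k
    have "(\<lambda>j. v j - t * w j) = vec i'' (c - t * d)"
      unfolding i vec_def
      by (simp add: fun_eq_iff i''_def lookup_minus sum_subtractf sum_distrib_left
          left_diff_distrib right_diff_distrib split: sum.split)
    moreover have "\<forall>k\<in>K. i'' k \<in> U k" using i U_diff by (simp add: i''_def)
    ultimately show "(\<lambda>j. v j - t * w j, c - t * d) \<in> W" by (auto simp: W_def)
  next
    fix v c
    assume "(v, c) \<in> W" and zero: "\<forall>j\<in>J. v j = 0"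
    then obtain i where i: "\<forall>k\<in>K. i k \<in> U k" "v = vec i c" by (auto simp: W_def)
    show "c = 0"
    proof (rule ccontr)
      assume "c \<noteq> 0"
      define i' where "i' k = monomial 0 (1 / c) * i k" for k
      have "i' k \<in> I k \<and> (\<forall>m\<in>supp (i' k). mdeg m \<le> C \<and> m \<notin> A k)" if k: "k \<in> K" for k
      proof -
        have "i k \<in> I k" "supp (i k) \<subseteq> B" using i(1) k by (auto simp: U_def)
        then have "i' k \<in> I k" using I[OF k] by (simp add: i'_def poly_ideal_def)
        moreover have "mdeg m \<le> C \<and> m \<notin> A k" if "m \<in> supp (i' k)" for m
        proof -
          have m: "m \<in> supp (i k)" using that by (simp add: i'_def in_keys_iff)
          then have "m \<in> B" using \<open>supp (i k) \<subseteq> B\<close> by blast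
          moreover have "m \<notin> A k"
          proof
            assume "m \<in> A k"
            then have "Inr (k, m) \<in> J" using k \<open>m \<in> B\<close> by (auto simp: J_def)
            then have "coef (i k) m = 0" using zero[rule_format, of "Inr (k, m)"] by (simp add: i(2) vec_def)
            then show False using m by (simp add: in_keys_iff)
          qed
          ultimately show ?thesis by (simp add: B_def)
        qed
        ultimately show ?thesis by blast
      qed
      moreover have "of_int (coef u m) = (\<Sum>k\<in>K. coef (i' k) m)" if "m \<in> E" "mdeg m \<le> C" for m
      proof -
        have "Inl m \<in> J" using that by (auto simp: J_def B_def)
        then have "(\<Sum>k\<in>K. coef (i k) m) = c * of_int (coef u m)"
          using zero[rule_format, of "Inl m"] by (simp add: i(2) vec_def)
        then show ?thesis using \<open>c \<noteq> 0\<close>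
          by (simp add: i'_def sum_divide_distrib[symmetric])
      qed
      ultimately show False using not by blast
    qed
  qed
  then obtain \<alpha> where \<alpha>: "\<And>v c. (v, c) \<in> W \<Longrightarrow> c = (\<Sum>j\<in>J. \<alpha> j * v j)" by blast
  obtain d :: int where d: "d > 0" "\<forall>j\<in>J. \<exists>z. of_int d * \<alpha> j = of_int z"
    using clear_denominators_finite[OF \<open>finite J\<close>, of \<alpha>] by blast
  then obtain z where z: "\<And>j. j \<in> J \<Longrightarrow> of_int d * \<alpha> j = of_int (z j)" by metis
  obtain N where N: "\<And>k. k \<in> K \<Longrightarrow> N k \<noteq> 0 \<and> (\<forall>p C h. prime p \<and> \<not> int p dvd N k \<and>
      h \<in> reduction p (I k) \<and> (\<forall>m\<in>supp h. mdeg m \<le> C) \<longrightarrow>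
      (\<exists>i. rat_poly i \<in> I k \<and> (\<forall>m\<in>supp i. mdeg m \<le> C) \<and> reduce p i = h))"
    using reduction_degree_lift[OF I] by metis
  have "int p dvd d * (\<Prod>k\<in>K. N k)" if p: "p \<in> T" for p
  proof (rule ccontr)
    assume ndvd: "\<not> int p dvd d * (\<Prod>k\<in>K. N k)"
    obtain h where h: "\<And>k. k \<in> K \<Longrightarrow> h k \<in> reduction p (I k) \<and> (\<forall>m\<in>supp (h k). mdeg m \<le> C \<and> m \<notin> A k)"
      "\<And>m. m \<in> E \<Longrightarrow> int p dvd coef u m - (\<Sum>k\<in>K. coef (h k) m)"
      using rel[OF p] by blast
    have "\<exists>i. rat_poly i \<in> I k \<and> (\<forall>m\<in>supp i. mdeg m \<le> C) \<and> reduce p i = h k" if k: "k \<in> K" for k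
    proof -
      have "N k dvd (\<Prod>k\<in>K. N k)" using K k by (rule dvd_prodI)
      then have "\<not> int p dvd N k" using ndvd dvd_trans dvd_mult by blast
      then show ?thesis using N[OF k] T(2)[OF p] h(1)[OF k] by blast
    qed
    then obtain i where i: "\<And>k. k \<in> K \<Longrightarrow> rat_poly (i k) \<in> I k \<and> (\<forall>m\<in>supp (i k). mdeg m \<le> C) \<and>
        reduce p (i k) = h k" by metis
    define v :: "('n \<Rightarrow>\<^sub>0 nat) + 'k \<times> ('n \<Rightarrow>\<^sub>0 nat) \<Rightarrow> int" where
      "v j = (case j of Inl m \<Rightarrow> (\<Sum>k\<in>K. coef (i k) m) - coef u m | Inr (k, m) \<Rightarrow> coef (i k) m)" for j
    have "vec (\<lambda>k. rat_poly (i k)) 1 j = of_int (v j)" for j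
      by (auto simp: vec_def v_def split: sum.split)
    moreover have "(vec (\<lambda>k. rat_poly (i k)) 1, 1) \<in> W"
      using i by (auto simp: W_def U_def B_def)
    ultimately have "1 = (\<Sum>j\<in>J. \<alpha> j * of_int (v j))"
      using \<alpha>[of "vec (\<lambda>k. rat_poly (i k)) 1" 1] by simp
    then have "of_int d = of_int d * (\<Sum>j\<in>J. \<alpha> j * of_int (v j))" by simp
    also have "\<dots> = (\<Sum>j\<in>J. of_int (z j * v j))"
      unfolding sum_distrib_left by (rule sum.cong) (auto simp: z[symmetric])
    finally have "rat_of_int d = of_int (\<Sum>j\<in>J. z j * v j)" by simp
    then have "d = (\<Sum>j\<in>J. z j * v j)" unfolding of_int_eq_iff .
    moreover have "int p dvd v j" if "j \<in> J" for j
    proof -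
      have ih: "int p dvd coef (i k) m - coef (h k) m" if "k \<in> K" for k m
        using i[OF that] coef_reduce[of p "i k" m] by (metis mod_eq_dvd_iff mod_mod_trivial)
      from that consider m where "j = Inl m" "m \<in> E" | k m where "j = Inr (k, m)" "k \<in> K" "m \<in> A k"
        by (auto simp: J_def)
      then show ?thesis
      proof cases
        case 1
        have "v j = (\<Sum>k\<in>K. coef (i k) m - coef (h k) m) - (coef u m - (\<Sum>k\<in>K. coef (h k) m))"
          by (simp add: v_def 1 sum_subtractf)
        moreover have "int p dvd (\<Sum>k\<in>K. coef (i k) m - coef (h k) m)"
          by (rule dvd_sum) (rule ih)
        ultimately show ?thesis using h(2)[OF 1(2)] by simp
      next
        case 2
        have "m \<notin> supp (h k)" using h(1)[OF 2(2)] 2(3) by blast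
        then have "coef (h k) m = 0" by (simp add: in_keys_iff)
        then show ?thesis using ih[OF 2(2), of m] by (simp add: v_def 2)
      qed
    qed
    ultimately have "int p dvd d" by (auto intro: dvd_sum)
    then show False using ndvd by simp
  qed
  (* A nonzero integer has only finitely many prime divisors. *)
  then have "T \<subseteq> {p. int p dvd d * (\<Prod>k\<in>K. N k)}" by blast
  moreover have "d * (\<Prod>k\<in>K. N k) \<noteq> 0" using d(1) N K by auto
  ultimately show False using T(1) finite_nat_divisors finite_subset by blast
qed

section \<open>Powers in sums of compatibly split ideals\<close>

lemma mdeg_bound:
  fixes g :: "'k \<Rightarrow> ('n::finite, 'a::zero) mpoly"
  assumes "finite K"
  shows "\<exists>d. \<forall>k\<in>K. \<forall>m\<in>supp (g k). mdeg m \<le> d"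
proof -
  have "finite (\<Union>k\<in>K. mdeg ` supp (g k))" using assms by auto
  then obtain d where "\<forall>x\<in>(\<Union>k\<in>K. mdeg ` supp (g k)). x \<le> d"
    using finite_nat_set_iff_bounded_le by blast
  then show ?thesis by auto
qed

lemma weight_bound:
  fixes g :: "'k \<Rightarrow> ('n::finite, 'a::zero) mpoly"
  assumes "finite K"
  shows "\<exists>s. \<forall>k\<in>K. weight_le lam (g k) s"
proof -
  have "finite (\<Union>k\<in>K. weight lam ` supp (g k))" using assms by auto
  then have "bdd_above (\<Union>k\<in>K. weight lam ` supp (g k))" by (rule bdd_above_finite)
  then obtain s where "\<forall>x\<in>(\<Union>k\<in>K. weight lam ` supp (g k)). x \<le> s"
    unfolding bdd_above_def by blast
  then show ?thesis by (auto simp: weight_le_def)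
qed

lemma supp_scale:
  fixes g :: "('n::finite, 'a::idom) mpoly"
  shows "c \<noteq> 0 \<Longrightarrow> supp (monomial 0 c * g) = supp g"
  unfolding set_eq_iff in_keys_iff coef_scale by simp

lemma supp_monomial_times:
  fixes g :: "('n, 'a::comm_semiring_1) mpoly"
  assumes "k \<in> supp (monomial a c * g)"
  shows "\<exists>z\<in>supp g. k = a + z"
  using assms keys_mult[of "monomial a c" g] by (auto split: if_splits)

lemma weight_le_mdeg: "weight_le (\<lambda>_. 1) g (real d) \<longleftrightarrow> (\<forall>m\<in>supp g. mdeg m \<le> d)"
  by (simp add: weight_le_def mdeg_eq_weight[symmetric])

lemma weight_le_mono: "weight_le lam g r \<Longrightarrow> r \<le> s \<Longrightarrow> weight_le lam g s"
  by (auto simp: weight_le_def)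

lemma frob_trace_in_reduction:
  assumes "p > 1" "compatibly_split (Tr_pow p f) (reduction p I)" "poly_ideal I" "rat_poly i \<in> I"
  shows "frob_trace p f (a * i) \<in> reduction p I"
proof -
  have "rat_poly (a * i) \<in> I" using assms(3,4) by (simp add: poly_ideal_def)
  then have "reduce p (a * i) \<in> reduction p I" unfolding reduction_def by blast
  then have "Tr_pow p f (reduce p (a * i)) \<in> reduction p I"
    using assms(2) unfolding compatibly_split_def by blast
  then show ?thesis unfolding Tr_pow_reduce[OF assms(1)] .
qed

text \<open>
  Write \<open>u = \<phi> (u ^ p)\<close> and substitute the decomposition of \<open>u ^ N\<close> into
  \<open>u ^ p = u ^ (p - N) * u ^ N\<close>.
\<close>

lemma trace_decompose:
  assumes p: "prime p" "frob_trace p f 1 = 1" and "N \<le> p" "u ^ N = (\<Sum>k\<in>K. i k)"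
  shows "reduce p u = reduce p (\<Sum>k\<in>K. frob_trace p f (u ^ (p - N) * i k))"
proof -
  have p0: "p > 0" using p(1) prime_gt_0_nat by blast
  have "reduce p u = reduce p (u * frob_trace p f 1)" using p(2) by simp
  also have "\<dots> = frob_trace p f (u ^ p * 1)" by (rule frob_trace_near_splitting[OF p(1), symmetric])
  also have "u ^ p * 1 = u ^ (p - N) * u ^ N" using assms(3) by (simp flip: power_add)
  also have "\<dots> = (\<Sum>k\<in>K. u ^ (p - N) * i k)" by (simp add: assms(4) sum_distrib_left)
  also have "frob_trace p f \<dots> = reduce p (\<Sum>k\<in>K. frob_trace p f (u ^ (p - N) * i k))"
    by (rule frob_trace_sum[OF p0])
  finally show ?thesis .
qed

lemma infinite_primes_above:
  fixes S :: "nat set" and r :: real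
  assumes "infinite S"
  shows "infinite {p\<in>S. r < real p \<and> N \<le> p}"
proof
  assume fin: "finite {p\<in>S. r < real p \<and> N \<le> p}"
  have "S \<subseteq> {p\<in>S. r < real p \<and> N \<le> p} \<union> {..max N (nat \<lceil>r\<rceil>)}"
  proof
    fix p assume "p \<in> S"
    moreover have "r \<le> real (nat \<lceil>r\<rceil>)" by (rule real_nat_ceiling_ge)
    ultimately show "p \<in> {p\<in>S. r < real p \<and> N \<le> p} \<union> {..max N (nat \<lceil>r\<rceil>)}"
      by (cases "p \<le> max N (nat \<lceil>r\<rceil>)") (auto simp: not_le)
  qed
  then show False using assms fin finite_subset by blast
qed

text \<open>
  The central statement: a power \<open>a ^ N\<close> in a sum of compatibly split ideals can be replaced by \<open>a\<close>
  itself, with a decomposition that respects the weight of \<open>a\<close>. After clearing denominators the decomposition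
  modulo \<open>p\<close> is \<open>trace_decompose\<close>; the contraction property bounds degrees uniformly in \<open>p\<close> and
  forces the excess weight below any given positive number, and \<open>lift_relation\<close> descends to the
  rationals.
\<close>

theorem power_decomposition:
  fixes f :: "('n::finite, int) mpoly" and I :: "'k \<Rightarrow> ('n, rat) mpoly set"
  assumes S: "infinite S" "\<And>p. p \<in> S \<Longrightarrow> prime p" "\<And>p. p \<in> S \<Longrightarrow> frob_trace p f 1 = 1"
    and f: "weight_le lam f (weight lam all_vars)"
    and K: "finite K" "\<And>k. k \<in> K \<Longrightarrow> poly_ideal (I k)"
    and compat: "\<And>k p. k \<in> K \<Longrightarrow> p \<in> S \<Longrightarrow> compatibly_split (Tr_pow p f) (reduction p (I k))"
    and a: "weight_le lam a r" "N > 0" "a ^ N = (\<Sum>k\<in>K. i k)" "\<And>k. k \<in> K \<Longrightarrow> i k \<in> I k"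
  shows "\<exists>j. (\<forall>k\<in>K. j k \<in> I k \<and> weight_le lam (j k) r) \<and> a = (\<Sum>k\<in>K. j k)"
proof -
  obtain d G where d: "d > 0" "\<And>x. x \<in> insert None (Some ` K) \<Longrightarrow>
      rat_poly (G x) = monomial 0 (of_int d) * (case x of None \<Rightarrow> a | Some k \<Rightarrow> i k)"
    using clear_denominators[of "insert None (Some ` K)" "\<lambda>x. case x of None \<Rightarrow> a | Some k \<Rightarrow> i k"]
      K(1) by (metis finite_imageI finite_insert)
  define u where "u = G None"
  (* With u = d * a one has u ^ N = d ^ (N - 1) * (d * a ^ N), and d clears the denominators of
     the i k. *)
  define i' where "i' k = monomial 0 (d ^ (N - 1)) * G (Some k)" for k
  have u: "rat_poly u = monomial 0 (of_int d) * a" using d(2)[of None] by (simp add: u_def)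
  have monomial0: "(monomial 0 c :: ('n, rat) mpoly) ^ n = monomial 0 (c ^ n)" for c n
    by (induction n) (auto simp: mult_single)
  have i': "rat_poly (i' k) = monomial 0 (of_int d ^ N) * i k" if "k \<in> K" for k
  proof -
    have "rat_poly (i' k) = monomial 0 (of_int d ^ (N - 1)) * (monomial 0 (of_int d) * i k)"
      using d(2)[of "Some k"] that by (simp add: i'_def)
    also have "\<dots> = monomial 0 (of_int d ^ N) * i k"
      using power_minus_mult[OF a(2), of "rat_of_int d"]
      by (simp only: mult.assoc[symmetric] mult_single add_0_right)
    finally show ?thesis .
  qed
  have i'I: "rat_poly (i' k) \<in> I k" if "k \<in> K" for k
    using K(2)[OF that] a(4)[OF that] i'[OF that] by (simp add: poly_ideal_def)
  have uN: "u ^ N = (\<Sum>k\<in>K. i' k)"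
  proof -
    have "rat_poly (u ^ N) = monomial 0 (of_int d ^ N) * a ^ N"
      by (simp add: u power_mult_distrib monomial0)
    also have "\<dots> = rat_poly (\<Sum>k\<in>K. i' k)" by (simp add: a(3) sum_distrib_left i')
    finally show ?thesis by (simp only: rat_poly_inj)
  qed
  have wu: "weight_le lam u r"
  proof -
    have "supp u = supp a"
      using d(1) supp_scale[of "rat_of_int d" a] by (simp flip: u)
    then show ?thesis using a(1) by (simp add: weight_le_def)
  qed
  obtain df where df: "\<And>m. m \<in> supp f \<Longrightarrow> mdeg m \<le> df"
    using mdeg_bound[of "{()}" "\<lambda>_. f"] by auto
  obtain du where du: "\<And>m. m \<in> supp u \<Longrightarrow> mdeg m \<le> du"
    using mdeg_bound[of "{()}" "\<lambda>_. u"] by auto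
  obtain di where di: "\<And>k m. k \<in> K \<Longrightarrow> m \<in> supp (i' k) \<Longrightarrow> mdeg m \<le> di"
    using mdeg_bound[OF K(1), of i'] by blast
  obtain s where s: "\<And>k. k \<in> K \<Longrightarrow> weight_le lam (i' k) s"
    using weight_bound[OF K(1), of lam i'] by blast
  define C where "C = df + du + di"
  define B where "B = {m :: 'n \<Rightarrow>\<^sub>0 nat. mdeg m \<le> C \<and> weight lam m > r}"
  have finB: "finite B" by (rule finite_subset[OF _ finite_mdeg_le[of C]]) (auto simp: B_def)
  (* Among the finitely many monomials of degree at most C that are heavier than r, the least
     excess e is positive. *)
  obtain e where e: "e > 0" "\<And>m. m \<in> B \<Longrightarrow> e \<le> weight lam m - r"
  proof -
    let ?V = "insert 1 ((\<lambda>m. weight lam m - r) ` B)"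
    have "Min ?V > 0" using finB by (auto simp: B_def)
    moreover have "\<And>m. m \<in> B \<Longrightarrow> Min ?V \<le> weight lam m - r" using finB by (intro Min_le) auto
    ultimately show thesis by (rule that)
  qed
  define T where "T = {p\<in>S. (s - real N * r) / e < real p \<and> N \<le> p}"
  have T: "infinite T" unfolding T_def by (rule infinite_primes_above[OF S(1)])
  have "\<exists>h. (\<forall>k\<in>K. h k \<in> reduction p (I k) \<and>
        (\<forall>m\<in>supp (h k). mdeg m \<le> C \<and> m \<notin> {m. weight lam m > r})) \<and>
      (\<forall>m\<in>UNIV. int p dvd coef u m - (\<Sum>k\<in>K. coef (h k) m))" if "p \<in> T" for p
  proof -
    have p: "p \<in> S" "(s - real N * r) / e < real p" "N \<le> p" using that by (auto simp: T_def)
    have "prime p" using S(2) p(1) by blast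
    then have p1: "p > 1" "p > 0" using prime_gt_1_nat prime_gt_0_nat by blast+
    define h where "h k = frob_trace p f (u ^ (p - N) * i' k)" for k
    have "h k \<in> reduction p (I k)" if "k \<in> K" for k
      unfolding h_def
      by (rule frob_trace_in_reduction[OF p1(1) compat[OF that p(1)] K(2)[OF that] i'I[OF that]])
    moreover have "mdeg m \<le> C \<and> weight lam m \<le> r" if k: "k \<in> K" and m: "m \<in> supp (h k)" for k m
    proof -
      have "weight_le (\<lambda>_. 1) u (real du)" "weight_le (\<lambda>_. 1) (i' k) (real di)"
        unfolding weight_le_mdeg using du di[OF k] by blast+
      from weight_le_times[OF weight_le_power[OF this(1), of "p - N"] this(2)]
      have "weight_le (\<lambda>_. 1) (u ^ (p - N) * i' k) (real ((p - N) * du + di))" by simp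
      then have "p * mdeg m \<le> (p - 1) * df + ((p - N) * du + di)"
        using m p1 unfolding h_def weight_le_mdeg
        by (intro mdeg_frob_trace_le[of p f df "u ^ (p - N) * i' k"]) (auto simp: df)
      also have "\<dots> \<le> p * df + (p * du + p * di)"
        using p1 by (intro add_mono mult_right_mono) auto
      finally have "p * mdeg m \<le> p * C" by (simp add: C_def algebra_simps)
      then have mC: "mdeg m \<le> C" using p1 by simp
      have "weight_le lam (u ^ (p - N) * i' k) (real (p - N) * r + s)"
        by (rule weight_le_times[OF weight_le_power[OF wu] s[OF k]])
      from weight_le_frob_trace[OF p1(2) f this m[unfolded h_def]]
      have "real p * weight lam m \<le> real (p - N) * r + s"
        using p1 by (simp add: of_nat_diff algebra_simps)
      then have le: "real p * (weight lam m - r) \<le> s - real N * r"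
        using p(3) by (simp add: of_nat_diff algebra_simps)
      have "weight lam m \<le> r"
      proof (rule ccontr)
        assume "\<not> weight lam m \<le> r"
        then have "m \<in> B" using mC by (simp add: B_def)
        then have "real p * e \<le> s - real N * r"
          using e(2) le by (meson mult_left_mono of_nat_0_le_iff order_trans)
        then show False using p(2) e(1) by (simp add: divide_less_eq)
      qed
      then show ?thesis using mC by blast
    qed
    moreover have "int p dvd coef u m - (\<Sum>k\<in>K. coef (h k) m)" for m
      using trace_decompose[OF \<open>prime p\<close> S(3)[OF p(1)] p(3) uN]
      unfolding reduce_eq_iff h_def lookup_sum by blast
    ultimately show ?thesis by (intro exI[of _ h]) (auto simp: not_less)
  qed
  moreover have "prime p" if "p \<in> T" for p using that S(2) by (auto simp: T_def)
  ultimately have "\<exists>j. (\<forall>k\<in>K. j k \<in> I k \<and> (\<forall>m\<in>supp (j k). mdeg m \<le> C \<and> m \<notin> {m. weight lam m > r})) \<and>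
      (\<forall>m\<in>UNIV. mdeg m \<le> C \<longrightarrow> of_int (coef u m) = (\<Sum>k\<in>K. coef (j k) m))"
    using T K by (intro lift_relation)
  then
  obtain j where j: "\<And>k m. k \<in> K \<Longrightarrow> j k \<in> I k"
      "\<And>k m. k \<in> K \<Longrightarrow> m \<in> supp (j k) \<Longrightarrow> mdeg m \<le> C \<and> m \<notin> {m. weight lam m > r}"
      "\<And>m. mdeg m \<le> C \<Longrightarrow> of_int (coef u m) = (\<Sum>k\<in>K. coef (j k) m)"
    by auto
  have uj: "rat_poly u = (\<Sum>k\<in>K. j k)"
  proof (rule poly_mapping_eqI)
    fix m
    show "coef (rat_poly u) m = coef (\<Sum>k\<in>K. j k) m"
    proof (cases "mdeg m \<le> C")
      case True
      then show ?thesis using j(3) by (simp add: lookup_sum)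
    next
      case False
      then have "m \<notin> supp u" using du[of m] by (auto simp: C_def)
      moreover have "(\<Sum>k\<in>K. coef (j k) m) = 0"
        using False j(2) by (intro sum.neutral) (meson in_keys_iff)
      ultimately show ?thesis by (simp add: lookup_sum in_keys_iff)
    qed
  qed
  define j' where "j' k = monomial 0 (1 / of_int d) * j k" for k
  have "a = (\<Sum>k\<in>K. j' k)"
  proof -
    have "(\<Sum>k\<in>K. j' k) = monomial 0 (1 / of_int d) * rat_poly u"
      by (simp add: j'_def uj sum_distrib_left)
    also have "\<dots> = a" using d(1) by (simp add: u mult.assoc[symmetric] mult_single)
    finally show ?thesis by simp
  qed
  moreover have "j' k \<in> I k" if "k \<in> K" for k
    using K(2)[OF that] j(1)[OF that] by (simp add: j'_def poly_ideal_def)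
  moreover have "weight_le lam (j' k) r" if "k \<in> K" for k
    using j(2)[OF that] by (auto simp: weight_le_def j'_def in_keys_iff not_less)
  ultimately show ?thesis by blast
qed

section \<open>Squarefree initial forms\<close>

lemma coef_init:
  "coef (init lam g) m =
    (if m \<in> supp g \<and> (\<forall>m'\<in>supp g. weight lam m' \<le> weight lam m) then coef g m else 0)"
proof -
  have "finite {m \<in> supp g. \<forall>m'\<in>supp g. weight lam m' \<le> weight lam m}" by simp
  then show ?thesis by (simp add: init_def lookup_sum lookup_single when_def)
qed

lemma coef_init_eq:
  assumes "weight_le lam g (weight lam m)"
  shows "coef (init lam g) m = coef g m"
  using assms by (auto simp: coef_init weight_le_def in_keys_iff)

definition radical_exponent :: "('n \<Rightarrow>\<^sub>0 nat) \<Rightarrow> 'n \<Rightarrow>\<^sub>0 nat" where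
  "radical_exponent m = Poly_Mapping.map (\<lambda>_. 1) m"

lemma coef_radical_exponent: "coef (radical_exponent m) i = (if coef m i = 0 then 0 else 1)"
  by (simp add: radical_exponent_def Poly_Mapping.map.rep_eq when_def)

lemma init_all_varsD:
  fixes f :: "('n::finite, 'a::comm_ring_1) mpoly"
  assumes "init lam f = monomial all_vars 1"
  shows "weight_le lam f (weight lam all_vars)" "coef f all_vars = 1"
    "\<And>m. m \<in> supp f \<Longrightarrow> weight lam m = weight lam all_vars \<Longrightarrow> m = all_vars"
proof -
  have "coef (init lam f) all_vars = 1" by (simp add: assms)
  then have *: "all_vars \<in> supp f \<and> (\<forall>m'\<in>supp f. weight lam m' \<le> weight lam all_vars) \<and>
      coef f all_vars = 1"
    unfolding coef_init by (metis zero_neq_one)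
  then show "weight_le lam f (weight lam all_vars)" "coef f all_vars = 1"
    by (auto simp: weight_le_def)
  fix m assume m: "m \<in> supp f" "weight lam m = weight lam all_vars"
  then have "coef (init lam f) m = coef f m" using * by (simp add: coef_init)
  then have "coef (init lam f) m \<noteq> 0" using m(1) by (simp add: in_keys_iff)
  then show "m = all_vars" unfolding assms by (simp add: lookup_single when_def split: if_splits)
qed

text \<open>
  All monomials of \<open>f ^ k\<close> other than \<open>(\<Prod>i. x i) ^ k\<close> have smaller weight, so their products with
  monomials of \<open>g\<close> do not reach the weight of \<open>m\<close>.
\<close>

lemma coef_power_top:
  fixes f g :: "('n::finite, 'a::comm_ring_1) mpoly"
  assumes f: "init lam f = monomial all_vars 1"
  shows "weight_le lam g s \<Longrightarrow> real k * weight lam all_vars + s \<le> weight lam m \<Longrightarrow>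
    coef (f ^ k * g) m = coef (monomial (dilate k all_vars) 1 * g) m"
proof (induction k arbitrary: g s)
  case 0
  have "dilate 0 all_vars = (0 :: 'n \<Rightarrow>\<^sub>0 nat)" by (rule poly_mapping_eqI) simp
  then show ?case by simp
next
  case (Suc k)
  let ?w = "weight lam (all_vars :: 'n \<Rightarrow>\<^sub>0 nat)"
  have "weight_le lam (f * g) (?w + s)"
    by (rule weight_le_times[OF init_all_varsD(1)[OF f] Suc.prems(1)])
  then have "coef (f ^ k * (f * g)) m = coef (monomial (dilate k all_vars) 1 * (f * g)) m"
    using Suc.prems(2) by (intro Suc.IH[of "f * g" "?w + s"]) (auto simp: algebra_simps)
  also have "monomial (dilate k all_vars) 1 * (f * g) =
      monomial (dilate k all_vars) 1 * (monomial all_vars 1 * g)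
      + monomial (dilate k all_vars) 1 * ((f - monomial all_vars 1) * g)" by (simp add: algebra_simps)
  also have "coef \<dots> m = coef (monomial (dilate k all_vars) 1 * (monomial all_vars 1 * g)) m +
      coef (monomial (dilate k all_vars) 1 * ((f - monomial all_vars 1) * g)) m"
    by (simp add: lookup_add)
  also have "coef (monomial (dilate k all_vars) 1 * ((f - monomial all_vars 1) * g)) m = 0"
  proof (rule ccontr)
    assume "coef (monomial (dilate k all_vars) 1 * ((f - monomial all_vars 1) * g)) m \<noteq> 0"
    then have "m \<in> supp (monomial (dilate k all_vars) 1 * ((f - monomial all_vars 1) * g))"
      by (simp add: in_keys_iff)
    then obtain x where x: "x \<in> supp ((f - monomial all_vars 1) * g)" "m = dilate k all_vars + x"
      using supp_monomial_times by blast
    then obtain y z where yz: "y \<in> supp (f - monomial all_vars 1)" "z \<in> supp g" "x = y + z"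
      using keys_mult[of "f - monomial all_vars 1" g] by auto
    have "y \<noteq> all_vars"
      using yz(1) init_all_varsD(2)[OF f] by (auto simp: in_keys_iff lookup_minus)
    moreover from this have "y \<in> supp f"
      using yz(1) by (simp add: in_keys_iff lookup_minus lookup_single when_def)
    ultimately have "weight lam y < ?w"
      using init_all_varsD(1,3)[OF f] by (force simp: weight_le_def)
    moreover have "weight lam z \<le> s" using yz(2) Suc.prems(1) by (simp add: weight_le_def)
    ultimately show False using Suc.prems(2) by (simp add: x yz weight_dilate algebra_simps)
  qed
  also have "monomial (dilate k all_vars) 1 * (monomial all_vars 1 * g) = monomial (dilate (Suc k) all_vars) 1 * g"
  proof -
    have "dilate k all_vars + all_vars = dilate (Suc k) (all_vars :: 'n \<Rightarrow>\<^sub>0 nat)"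
      by (rule poly_mapping_eqI) (simp add: lookup_add)
    then show ?thesis by (simp add: mult.assoc[symmetric] mult_single)
  qed
  finally show ?case by (simp add: mult.assoc mult.left_commute)
qed

text \<open>
  With \<open>a\<close> such that \<open>a + m = p * q\<close>, where \<open>q\<close> is the radical of the exponent \<open>m\<close>, the trace of
  \<open>f ^ (p - 1) * x ^ a * g\<close> has top weight part \<open>c * x ^ q\<close>, where \<open>c\<close> is the coefficient of \<open>g\<close> at \<open>m\<close>:
  a monomial of \<open>g\<close> survives in weight at least that of \<open>q\<close> only if its exponents are congruent to
  those of \<open>m\<close> modulo \<open>p\<close>, and the exponents are smaller than \<open>p\<close>. Only coefficients of weight at
  least that of \<open>q\<close> are lifted to the rationals; these determine the initial form.
\<close>

theorem squarefree_initial_form: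
  fixes f :: "('n::finite, int) mpoly" and I :: "('n, rat) mpoly set"
  assumes f: "init lam f = monomial all_vars 1"
    and S: "infinite S" "\<And>p. p \<in> S \<Longrightarrow> prime p"
    and I: "poly_ideal I" and compat: "\<And>p. p \<in> S \<Longrightarrow> compatibly_split (Tr_pow p f) (reduction p I)"
    and g: "g \<in> I" "m \<in> supp (init lam g)"
  shows "\<exists>h\<in>I. init lam h = monomial (radical_exponent m) 1"
proof -
  define q where "q = radical_exponent m"
  define W where "W = weight lam (all_vars :: 'n \<Rightarrow>\<^sub>0 nat)"
  obtain d G where "d > 0" and G: "rat_poly G = monomial 0 (of_int d) * g"
    using clear_denominators[of "{()}" "\<lambda>_. g"] by auto
  have suppG: "supp G = supp g"
    using \<open>d > 0\<close> supp_scale[of "rat_of_int d" g] by (simp flip: G)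
  have GI: "rat_poly G \<in> I" using I g(1) G by (simp add: poly_ideal_def)
  have m: "m \<in> supp G" "weight_le lam G (weight lam m)"
    using g(2) by (auto simp: suppG in_keys_iff[of m "init lam g"] coef_init weight_le_def split: if_splits)
  obtain df where df: "\<And>m. m \<in> supp f \<Longrightarrow> mdeg m \<le> df"
    using mdeg_bound[of "{()}" "\<lambda>_. f"] by auto
  obtain dg where dg: "\<And>m. m \<in> supp G \<Longrightarrow> mdeg m \<le> dg"
    using mdeg_bound[of "{()}" "\<lambda>_. G"] by auto
  have coef_le: "coef l i \<le> mdeg l" for l :: "'n \<Rightarrow>\<^sub>0 nat" and i
    unfolding mdeg_def by (rule member_le_sum) auto
  define C where "C = df + mdeg q + dg"
  define T where "T = {p\<in>S. real dg < real p \<and> 0 \<le> p}"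
  have T: "infinite T" unfolding T_def by (rule infinite_primes_above[OF S(1)])
  have "\<exists>h. (\<forall>k\<in>{()}. h k \<in> reduction p I \<and> (\<forall>l\<in>supp (h k). mdeg l \<le> C \<and> l \<notin> {})) \<and>
      (\<forall>l\<in>{l. weight lam q \<le> weight lam l}.
        int p dvd coef (monomial q (coef G m)) l - (\<Sum>k\<in>{()}. coef (h k) l))" if "p \<in> T" for p
  proof -
    have p: "p \<in> S" "dg < p" "prime p" using that S(2) by (auto simp: T_def)
    then have p1: "p > 1" "p > 0" using prime_gt_1_nat prime_gt_0_nat by blast+
    have lt: "coef l i < p" if "l \<in> supp G" for l i
      using coef_le[of l i] dg[OF that] p(2) by simp
    define a where "a = dilate p q - m"
    have am: "a + m = dilate p q"
    proof (rule poly_mapping_eqI)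
      fix i show "coef (a + m) i = coef (dilate p q) i"
        using lt[OF m(1), of i] by (simp add: a_def q_def coef_radical_exponent lookup_add lookup_minus)
    qed
    define h where "h = frob_trace p f (monomial a 1 * G)"
    have "h \<in> reduction p I"
      unfolding h_def by (rule frob_trace_in_reduction[OF p1(1) compat[OF p(1)] I GI])
    moreover have "mdeg l \<le> C" if l: "l \<in> supp h" for l
    proof -
      have "mdeg k \<le> p * mdeg q + dg" if "k \<in> supp (monomial a 1 * G)" for k
      proof -
        obtain z where z: "z \<in> supp G" "k = a + z"
          using supp_monomial_times \<open>k \<in> supp (monomial a 1 * G)\<close> by blast
        have "mdeg a \<le> mdeg (a + m)" by simp
        also have "\<dots> = p * mdeg q" unfolding am by (simp add: mdeg_def sum_distrib_left)
        finally show ?thesis using dg[OF z(1)] by (simp add: z(2))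
      qed
      then have "p * mdeg l \<le> (p - 1) * df + (p * mdeg q + dg)"
        using p1 df l unfolding h_def by (intro mdeg_frob_trace_le)
      also have "\<dots> \<le> p * df + (p * mdeg q + p * dg)"
        using p1 by (intro add_mono mult_right_mono) auto
      finally have "p * mdeg l \<le> p * C" by (simp add: C_def algebra_simps)
      then show ?thesis using p1 by simp
    qed
    moreover have "int p dvd coef (monomial q (coef G m)) l - coef h l"
      if l: "weight lam q \<le> weight lam l" for l
    proof -
      define b where "b = dilate (p - 1) (all_vars :: 'n \<Rightarrow>\<^sub>0 nat) + a"
      have "weight_le lam (monomial a 1 * G) (weight lam a + weight lam m)"
        by (rule weight_le_times[OF _ m(2)]) (simp add: weight_le_def)
      moreover have "real (p - 1) * W + (weight lam a + weight lam m) \<le>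
          weight lam (trace_preimage p l)"
      proof -
        have "weight lam a + weight lam m = real p * weight lam q"
          using arg_cong[OF am, of "weight lam"] by (simp add: weight_dilate)
        also have "\<dots> \<le> real p * weight lam l" using l by (simp add: mult_left_mono)
        finally show ?thesis
          using p1 by (simp add: weight_trace_preimage W_def of_nat_diff algebra_simps)
      qed
      ultimately have "coef (f ^ (p - 1) * (monomial a 1 * G)) (trace_preimage p l) =
          coef (monomial (dilate (p - 1) all_vars) 1 * (monomial a 1 * G)) (trace_preimage p l)"
        unfolding W_def by (rule coef_power_top[OF f])
      also have "\<dots> = coef (monomial b 1 * G) (trace_preimage p l)"
        by (simp add: b_def mult.assoc[symmetric] mult_single)
      also have "\<dots> = coef (monomial q (coef G m)) l"
      proof (cases "l = q")
        case True
        have "b + m = trace_preimage p q"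
        proof -
          have "b + m = dilate (p - 1) all_vars + dilate p q" by (simp add: b_def add.assoc am)
          also have "\<dots> = trace_preimage p q"
            using p1 by (intro poly_mapping_eqI) (simp add: lookup_add coef_trace_preimage algebra_simps)
          finally show ?thesis .
        qed
        then show ?thesis using coef_monomial_times_add[of b 1 G m] True by simp
      next
        case False
        have "coef (monomial b 1 * G) (trace_preimage p l) = 0"
        proof (rule ccontr)
          assume "coef (monomial b 1 * G) (trace_preimage p l) \<noteq> 0"
          then have "trace_preimage p l \<in> supp (monomial b 1 * G)" by (simp add: in_keys_iff)
          then obtain z where z: "z \<in> supp G" "trace_preimage p l = b + z"
            using supp_monomial_times by blast
          have "coef l i = coef q i" for i
          proof -
            have e: "p * (coef l i + 1) - 1 = p - 1 + coef a i + coef z i"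
              using arg_cong[OF z(2), of "\<lambda>x. coef x i"]
              by (simp add: b_def coef_trace_preimage lookup_add)
            have "p * (coef l i + 1) - 1 = p - 1 + p * coef l i" using p1 by simp
            then have "p * coef l i + coef m i = p * coef q i + coef z i"
              using e arg_cong[OF am, of "\<lambda>x. coef x i"] by (simp add: lookup_add)
            (* Exponents below p are remainders, so division by p recovers the quotients. *)
            then have "(p * coef l i + coef m i) div p = (p * coef q i + coef z i) div p" by simp
            then show ?thesis using lt[OF m(1)] lt[OF z(1)] p1 by simp
          qed
          then have "l = q" by (rule poly_mapping_eqI)
          then show False using False by blast
        qed
        then show ?thesis using False by (simp add: lookup_single when_def)
      qed
      finally have "coef h l = coef (monomial q (coef G m)) l mod int p"
        unfolding h_def coef_frob_trace[OF p1(2)] by simp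
      then show ?thesis by (simp add: dvd_minus_mod)
    qed
    ultimately show ?thesis by (intro exI[of _ "\<lambda>_. h"]) auto
  qed
  moreover have "prime p" if "p \<in> T" for p using that S(2) by (auto simp: T_def)
  ultimately have "\<exists>j. (\<forall>k\<in>{()}. j k \<in> I \<and> (\<forall>l\<in>supp (j k). mdeg l \<le> C \<and> l \<notin> {})) \<and>
      (\<forall>l\<in>{l. weight lam q \<le> weight lam l}. mdeg l \<le> C \<longrightarrow>
        of_int (coef (monomial q (coef G m)) l) = (\<Sum>k\<in>{()}. coef (j k) l))"
    using T I by (intro lift_relation) auto
  then
  obtain j where j: "j \<in> I" "\<And>l. l \<in> supp j \<Longrightarrow> mdeg l \<le> C"
    "\<And>l. weight lam q \<le> weight lam l \<Longrightarrow> mdeg l \<le> C \<Longrightarrow>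
      of_int (coef (monomial q (coef G m)) l) = coef j l"
    by auto
  define c where "c = rat_of_int (coef G m)"
  have "c \<noteq> 0" using m(1) by (simp add: c_def in_keys_iff)
  have top: "coef j l = coef (monomial q c) l" if "weight lam q \<le> weight lam l" for l
  proof (cases "mdeg l \<le> C")
    case True
    then show ?thesis using j(3)[OF that True] by (simp add: lookup_single when_def c_def split: if_splits)
  next
    case False
    then have "l \<noteq> q" "l \<notin> supp j" using j(2) by (auto simp: C_def)
    then show ?thesis by (simp add: lookup_single when_def in_keys_iff)
  qed
  define h where "h = monomial 0 (1 / c) * j"
  have h: "coef h l = coef (monomial q 1) l" if "weight lam q \<le> weight lam l" for l
    using top[OF that] \<open>c \<noteq> 0\<close> by (simp add: h_def lookup_single when_def)
  have "h \<in> I" using I j(1) by (simp add: h_def poly_ideal_def)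
  moreover have "init lam h = monomial q 1"
  proof -
    have "q \<in> supp h" using h[of q] by (simp add: in_keys_iff)
    have wle: "weight_le lam h (weight lam q)"
      unfolding weight_le_def
    proof
      fix l assume "l \<in> supp h"
      then show "weight lam l \<le> weight lam q"
        using h[of l] by (cases "weight lam q \<le> weight lam l")
          (auto simp: in_keys_iff lookup_single when_def split: if_splits)
    qed
    show ?thesis
    proof (rule poly_mapping_eqI)
      fix l
      show "coef (init lam h) l = coef (monomial q 1) l"
      proof (cases "weight lam q \<le> weight lam l")
        case True
        then have "weight_le lam h (weight lam l)" using wle weight_le_mono by blast
        then show ?thesis using h[OF True] by (simp add: coef_init_eq)
      next
        case False
        then show ?thesis using \<open>q \<in> supp h\<close> by (auto simp: coef_init lookup_single when_def)
      qed
    qed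
  qed
  ultimately show ?thesis by (auto simp: q_def)
qed

section \<open>Prime ideals\<close>

lemma (in cring) ideal_cringI:
  assumes "I \<subseteq> carrier R" "\<zero> \<in> I" "\<And>a b. a \<in> I \<Longrightarrow> b \<in> I \<Longrightarrow> a \<oplus> b \<in> I"
    and l: "\<And>a x. a \<in> I \<Longrightarrow> x \<in> carrier R \<Longrightarrow> x \<otimes> a \<in> I"
  shows "ideal I R"
proof (rule idealI[OF ring_axioms])
  show "subgroup I (add_monoid R)"
  proof
    fix x assume x: "x \<in> I"
    then have "\<ominus> x = (\<ominus> \<one>) \<otimes> x" using assms(1) by (auto simp: l_minus)
    then show "inv\<^bsub>add_monoid R\<^esub> x \<in> I" using l[OF x, of "\<ominus> \<one>"] by (simp add: a_inv_def[symmetric])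
  qed (use assms in auto)
  fix a x assume a: "a \<in> I" "x \<in> carrier R"
  then show "x \<otimes> a \<in> I" by (rule l)
  then show "a \<otimes> x \<in> I" using a assms(1) by (metis m_comm subsetD)
qed

lemma (in cring) colon_ideal:
  assumes "ideal I R" "b \<in> carrier R"
  shows "ideal {r \<in> carrier R. r \<otimes> b \<in> I} R"
proof -
  interpret I: ideal I R by (rule assms(1))
  show ?thesis
  proof (rule ideal_cringI)
    fix a x assume "a \<in> {r \<in> carrier R. r \<otimes> b \<in> I}" "x \<in> carrier R"
    then show "x \<otimes> a \<in> {r \<in> carrier R. r \<otimes> b \<in> I}"
      using assms(2) I.I_l_closed by (auto simp: m_assoc)
  next
    fix a c assume "a \<in> {r \<in> carrier R. r \<otimes> b \<in> I}" "c \<in> {r \<in> carrier R. r \<otimes> b \<in> I}"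
    then show "a \<oplus> c \<in> {r \<in> carrier R. r \<otimes> b \<in> I}"
      using assms(2) I.a_closed by (auto simp: l_distr)
  qed (use assms(2) in auto)
qed

text \<open>
  An ideal that is maximal among those containing \<open>I\<close> and avoiding all powers of \<open>a\<close> is prime: if
  \<open>x \<otimes> y \<in> M\<close> with neither factor in \<open>M\<close>, the colon ideal of \<open>M\<close> by \<open>y\<close> is larger and hence contains a
  power of \<open>a\<close>; then \<open>y\<close> lies in the colon ideal of \<open>M\<close> by that power, which is therefore larger
  as well and contains a further power of \<open>a\<close>.
\<close>

lemma (in cring) prime_ideal_avoiding_powers:
  assumes I: "ideal I R" and a: "a \<in> carrier R" "\<And>n::nat. a [^] n \<notin> I"
  shows "\<exists>P. primeideal P R \<and> I \<subseteq> P \<and> a \<notin> P"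
proof -
  define A where "A = {J. ideal J R \<and> I \<subseteq> J \<and> (\<forall>n::nat. a [^] n \<notin> J)}"
  have "\<exists>M\<in>A. \<forall>X\<in>A. M \<subseteq> X \<longrightarrow> X = M"
  proof (rule subset_Zorn_nonempty)
    show "A \<noteq> {}" using I a(2) by (auto simp: A_def)
    fix C assume C: "C \<noteq> {}" "subset.chain A C"
    then have CA: "\<And>J. J \<in> C \<Longrightarrow> ideal J R \<and> I \<subseteq> J \<and> (\<forall>n::nat. a [^] n \<notin> J)"
      and tot: "\<And>J K. J \<in> C \<Longrightarrow> K \<in> C \<Longrightarrow> J \<subseteq> K \<or> K \<subseteq> J"
      by (auto simp: subset.chain_def A_def)
    have "ideal (\<Union>C) R"
    proof (rule ideal_cringI)
      show "\<Union>C \<subseteq> carrier R" using CA ideal.Icarr by fastforce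
      show "\<zero> \<in> \<Union>C"
        using C(1) CA by (metis UnionI additive_subgroup.zero_closed equals0I ideal.axioms(1))
    next
      fix x y assume "x \<in> \<Union>C" "y \<in> \<Union>C"
      then obtain J where J: "J \<in> C" "x \<in> J" "y \<in> J" using tot by blast
      then have "x \<oplus> y \<in> J"
        using CA by (metis additive_subgroup.a_closed ideal.axioms(1))
      then show "x \<oplus> y \<in> \<Union>C" using J by blast
    next
      fix x r assume "x \<in> \<Union>C" "r \<in> carrier R"
      then show "r \<otimes> x \<in> \<Union>C" using CA ideal.I_l_closed by (metis UnionE UnionI)
    qed
    then show "\<Union>C \<in> A" using C(1) CA unfolding A_def by blast
  qed
  then obtain M where MA: "M \<in> A" and M_max: "\<And>X. X \<in> A \<Longrightarrow> M \<subseteq> X \<Longrightarrow> X = M" by blast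
  have M: "ideal M R" "I \<subseteq> M" "\<And>n::nat. a [^] n \<notin> M" using MA by (auto simp: A_def)
  have max: "\<exists>n::nat. a [^] n \<in> X" if "ideal X R" "M \<subseteq> X" "X \<noteq> M" for X
  proof (rule ccontr)
    assume "\<nexists>n::nat. a [^] n \<in> X"
    then have "X \<in> A" using that M(2) by (auto simp: A_def)
    then show False using M_max that by blast
  qed
  interpret M: ideal M R by (rule M(1))
  have "primeideal M R"
  proof (rule primeidealI[OF M(1) is_cring])
    show "carrier R \<noteq> M" using M(3)[of 0] by auto
    fix x y assume xy: "x \<in> carrier R" "y \<in> carrier R" "x \<otimes> y \<in> M"
    show "x \<in> M \<or> y \<in> M"
    proof (rule ccontr)
      assume "\<not> ?thesis"
      then have nx: "x \<notin> M" and ny: "y \<notin> M" by auto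
      have sub: "M \<subseteq> {r \<in> carrier R. r \<otimes> b \<in> M}" if "b \<in> carrier R" for b
        using that M.I_r_closed M.Icarr by blast
      obtain n :: nat where n: "a [^] n \<otimes> y \<in> M"
        using max[OF colon_ideal[OF M(1) xy(2)] sub[OF xy(2)]] xy nx by blast
      have an: "a [^] n \<in> carrier R" using a(1) by simp
      have "y \<otimes> a [^] n \<in> M" using n an xy(2) by (simp add: m_comm)
      then obtain k :: nat where "a [^] k \<otimes> a [^] n \<in> M"
        using max[OF colon_ideal[OF M(1) an] sub[OF an]] xy ny by blast
      then have "a [^] (k + n) \<in> M" using a(1) by (simp add: nat_pow_mult)
      then show False using M(3) by blast
    qed
  qed
  moreover have "a \<notin> M" using M(3)[of 1] a(1) by simp
  ultimately show ?thesis using M(2) by blast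
qed

lemma cring_poly_ring_rat: "cring (poly_ring_rat :: ('n, rat) mpoly ring)"
proof (rule cringI)
  show "abelian_group (poly_ring_rat :: ('n, rat) mpoly ring)"
  proof (rule abelian_groupI)
    fix x :: "('n, rat) mpoly"
    show "\<exists>y\<in>carrier poly_ring_rat. y \<oplus>\<^bsub>poly_ring_rat\<^esub> x = \<zero>\<^bsub>poly_ring_rat\<^esub>"
      by (rule bexI[of _ "- x"]) (auto simp: poly_ring_rat_def)
  qed (auto simp: poly_ring_rat_def)
  show "comm_monoid (poly_ring_rat :: ('n, rat) mpoly ring)"
    by (rule comm_monoidI) (auto simp: poly_ring_rat_def)
qed (auto simp: poly_ring_rat_def distrib_right)

interpretation poly_ring_rat: cring "poly_ring_rat :: ('n, rat) mpoly ring"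
  by (rule cring_poly_ring_rat)

lemma poly_ring_rat_simps:
  "carrier poly_ring_rat = UNIV" "a \<otimes>\<^bsub>poly_ring_rat\<^esub> b = a * b" "a \<oplus>\<^bsub>poly_ring_rat\<^esub> b = a + b"
  "\<zero>\<^bsub>poly_ring_rat\<^esub> = 0" "\<one>\<^bsub>poly_ring_rat\<^esub> = 1"
  by (simp_all add: poly_ring_rat_def)

lemma poly_ring_rat_power: "a [^]\<^bsub>poly_ring_rat\<^esub> (n::nat) = a ^ n"
  by (induction n) (simp_all add: poly_ring_rat_simps mult.commute)

lemma ideal_poly_ring_rat_iff: "ideal I poly_ring_rat \<longleftrightarrow> poly_ideal I"
proof
  assume "ideal I poly_ring_rat"
  then interpret I: ideal I poly_ring_rat .
  have "0 \<in> I" using I.zero_closed by (simp add: poly_ring_rat_simps)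
  moreover have "a + b \<in> I" if "a \<in> I" "b \<in> I" for a b
    using I.a_closed[OF that] by (simp add: poly_ring_rat_simps)
  moreover have "r * a \<in> I" if "a \<in> I" for a r
    using I.I_l_closed[OF that, of r] by (simp add: poly_ring_rat_simps)
  ultimately show "poly_ideal I" by (simp add: poly_ideal_def)
next
  assume "poly_ideal I"
  then show "ideal I poly_ring_rat"
    unfolding poly_ideal_def
    by (intro poly_ring_rat.ideal_cringI) (auto simp: poly_ring_rat_simps)
qed

lemma subvariety_rat_iff:
  "subvariety_rat P \<longleftrightarrow> poly_ideal P \<and> P \<noteq> UNIV \<and> (\<forall>a b. a * b \<in> P \<longrightarrow> a \<in> P \<or> b \<in> P)"
proof
  assume "subvariety_rat P"
  then interpret P: primeideal P poly_ring_rat .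
  have "poly_ideal P" using P.is_ideal by (simp add: ideal_poly_ring_rat_iff)
  moreover have "P \<noteq> UNIV" using P.I_notcarr by (simp add: poly_ring_rat_simps)
  moreover have "a \<in> P \<or> b \<in> P" if "a * b \<in> P" for a b
    using P.I_prime[of a b] that by (simp add: poly_ring_rat_simps)
  ultimately show "poly_ideal P \<and> P \<noteq> UNIV \<and> (\<forall>a b. a * b \<in> P \<longrightarrow> a \<in> P \<or> b \<in> P)" by blast
next
  assume "poly_ideal P \<and> P \<noteq> UNIV \<and> (\<forall>a b. a * b \<in> P \<longrightarrow> a \<in> P \<or> b \<in> P)"
  then show "subvariety_rat P"
    by (intro primeidealI poly_ring_rat.is_cring)
      (auto simp: ideal_poly_ring_rat_iff poly_ring_rat_simps)
qed

text \<open>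
  The intersection of a chain of primes is prime, so Zorn's lemma applies to the complements of the
  primes between \<open>I\<close> and \<open>Q\<close>, for which minimal becomes maximal.
\<close>

lemma minimal_prime_below:
  assumes Q: "subvariety_rat Q" "I \<subseteq> Q"
  shows "\<exists>P\<subseteq>Q. component_rat I P"
proof -
  define A where "A = uminus ` {P. subvariety_rat P \<and> I \<subseteq> P \<and> P \<subseteq> Q}"
  have "\<exists>M\<in>A. \<forall>X\<in>A. M \<subseteq> X \<longrightarrow> X = M"
  proof (rule subset_Zorn_nonempty)
    show "A \<noteq> {}" using Q by (auto simp: A_def)
    fix C assume C: "C \<noteq> {}" "subset.chain A C"
    define D where "D = uminus ` C"
    have D: "\<And>P. P \<in> D \<Longrightarrow> subvariety_rat P \<and> I \<subseteq> P \<and> P \<subseteq> Q"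
      using C(2) by (auto simp: subset_chain_def A_def D_def)
    have "X \<subseteq> Y \<or> Y \<subseteq> X" if "X \<in> C" "Y \<in> C" for X Y
      using C(2) that by (simp add: subset_chain_def)
    then have tot: "J \<subseteq> K \<or> K \<subseteq> J" if "J \<in> D" "K \<in> D" for J K
      using that by (fastforce simp: D_def)
    have "D \<noteq> {}" using C(1) by (simp add: D_def)
    have "subvariety_rat (\<Inter>D)"
      unfolding subvariety_rat_iff
    proof (intro conjI allI impI)
      show "poly_ideal (\<Inter>D)"
        using D unfolding subvariety_rat_iff poly_ideal_def by blast
      show "\<Inter>D \<noteq> UNIV" using D \<open>D \<noteq> {}\<close> unfolding subvariety_rat_iff by blast
      fix a b assume ab: "a * b \<in> \<Inter>D"
      show "a \<in> \<Inter>D \<or> b \<in> \<Inter>D"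
      proof (rule ccontr)
        assume "\<not> ?thesis"
        then obtain J K where "J \<in> D" "a \<notin> J" "K \<in> D" "b \<notin> K" by blast
        then obtain L where "L \<in> D" "a \<notin> L" "b \<notin> L" using tot by blast
        then show False using ab D unfolding subvariety_rat_iff by blast
      qed
    qed
    moreover have "\<Union>C = - \<Inter>D" by (auto simp: D_def)
    moreover have "I \<subseteq> \<Inter>D" using D by blast
    moreover have "\<Inter>D \<subseteq> Q" using D \<open>D \<noteq> {}\<close> by blast
    ultimately show "\<Union>C \<in> A" unfolding A_def by (intro image_eqI[of _ _ "\<Inter>D"]) auto
  qed
  then obtain M where MA: "M \<in> A" and M_max: "\<And>X. X \<in> A \<Longrightarrow> M \<subseteq> X \<Longrightarrow> X = M" by blast
  obtain P where P: "subvariety_rat P" "I \<subseteq> P" "P \<subseteq> Q" "M = - P" using MA by (auto simp: A_def)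
  have "P' = P" if "subvariety_rat P'" "I \<subseteq> P'" "P' \<subseteq> P" for P'
  proof -
    have "- P' \<in> A" using that P(3) by (auto simp: A_def)
    then have "- P' = M" using M_max that(3) P(4) by blast
    then show ?thesis using P(4) by auto
  qed
  then have "component_rat I P" using P by (simp add: component_rat_def)
  then show ?thesis using P(3) by blast
qed

lemma intersection_ideal_decompose:
  assumes fin: "finite \<Z>" and id: "\<And>Z. Z \<in> \<Z> \<Longrightarrow> poly_ideal Z" and u: "u \<in> intersection_ideal \<Z>"
  shows "\<exists>i. (\<forall>Z\<in>\<Z>. i Z \<in> Z) \<and> u = (\<Sum>Z\<in>\<Z>. i Z)"
proof -
  define J where "J = {(\<Sum>Z\<in>\<Z>. i Z) | i. \<forall>Z\<in>\<Z>. i Z \<in> Z}"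
  have "poly_ideal J"
    unfolding poly_ideal_def
  proof (intro conjI ballI allI)
    show "0 \<in> J" unfolding J_def using id by (auto simp: poly_ideal_def intro!: exI[of _ "\<lambda>_. 0"])
  next
    fix a b assume "a \<in> J" "b \<in> J"
    then obtain i j where ij: "\<forall>Z\<in>\<Z>. i Z \<in> Z" "a = (\<Sum>Z\<in>\<Z>. i Z)" "\<forall>Z\<in>\<Z>. j Z \<in> Z" "b = (\<Sum>Z\<in>\<Z>. j Z)"
      unfolding J_def by blast
    then have "a + b = (\<Sum>Z\<in>\<Z>. i Z + j Z)" "\<forall>Z\<in>\<Z>. i Z + j Z \<in> Z"
      using id by (auto simp: sum.distrib poly_ideal_def)
    then show "a + b \<in> J" unfolding J_def by blast
  next
    fix r a assume "a \<in> J"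
    then obtain i where ij: "\<forall>Z\<in>\<Z>. i Z \<in> Z" "a = (\<Sum>Z\<in>\<Z>. i Z)" unfolding J_def by blast
    then have "r * a = (\<Sum>Z\<in>\<Z>. r * i Z)" "\<forall>Z\<in>\<Z>. r * i Z \<in> Z"
      using id by (auto simp: sum_distrib_left poly_ideal_def)
    then show "r * a \<in> J" unfolding J_def by blast
  qed
  moreover have "\<Union>\<Z> \<subseteq> J"
  proof
    fix x assume "x \<in> \<Union>\<Z>"
    then obtain Z where Z: "Z \<in> \<Z>" "x \<in> Z" by blast
    have "x = (\<Sum>Z'\<in>\<Z>. if Z' = Z then x else 0)" using fin Z(1) by simp
    moreover have "\<forall>Z'\<in>\<Z>. (if Z' = Z then x else 0) \<in> Z'" using Z id by (auto simp: poly_ideal_def)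
    ultimately show "x \<in> J" unfolding J_def by blast
  qed
  ultimately have "intersection_ideal \<Z> \<subseteq> J"
    unfolding intersection_ideal_def ideal_poly_ring_rat_iff[symmetric]
    by (rule poly_ring_rat.genideal_minimal)
  then show ?thesis using u unfolding J_def by blast
qed

section \<open>Initial ideals\<close>

lemma poly_ideal_Idl: "poly_ideal (Idl\<^bsub>poly_ring_rat\<^esub> B)"
  unfolding ideal_poly_ring_rat_iff[symmetric]
  by (rule poly_ring_rat.genideal_ideal) (simp add: poly_ring_rat_simps)

lemma Idl_superset: "B \<subseteq> Idl\<^bsub>poly_ring_rat\<^esub> B"
  by (rule poly_ring_rat.genideal_self) (simp add: poly_ring_rat_simps)

lemma Idl_least: "poly_ideal I \<Longrightarrow> B \<subseteq> I \<Longrightarrow> Idl\<^bsub>poly_ring_rat\<^esub> B \<subseteq> I"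
  unfolding ideal_poly_ring_rat_iff[symmetric] by (rule poly_ring_rat.genideal_minimal)

lemma poly_ideal_sum: "poly_ideal I \<Longrightarrow> (\<And>x. x \<in> A \<Longrightarrow> g x \<in> I) \<Longrightarrow> (\<Sum>x\<in>A. g x) \<in> I"
  by (induction A rule: infinite_finite_induct) (auto simp: poly_ideal_def)

lemma init_monomial_times:
  fixes g :: "('n::finite, rat) mpoly"
  assumes "c \<noteq> 0"
  shows "init lam (monomial a c * g) = monomial a c * init lam g"
proof (rule poly_mapping_eqI)
  fix k
  have supp: "a + l \<in> supp (monomial a c * g) \<longleftrightarrow> l \<in> supp g" for l
    using assms by (simp add: in_keys_iff coef_monomial_times_add)
  show "coef (init lam (monomial a c * g)) k = coef (monomial a c * init lam g) k"
  proof (cases "\<exists>l. k = a + l")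
    case True
    then obtain l where k: "k = a + l" by blast
    have "(\<forall>m\<in>supp (monomial a c * g). weight lam m \<le> weight lam (a + l)) \<longleftrightarrow>
        (\<forall>m\<in>supp g. weight lam m \<le> weight lam l)"
    proof
      assume L: "\<forall>m\<in>supp (monomial a c * g). weight lam m \<le> weight lam (a + l)"
      show "\<forall>m\<in>supp g. weight lam m \<le> weight lam l"
      proof
        fix m assume "m \<in> supp g"
        then have "a + m \<in> supp (monomial a c * g)" by (simp add: supp)
        then show "weight lam m \<le> weight lam l" using L by fastforce
      qed
    next
      assume R: "\<forall>m\<in>supp g. weight lam m \<le> weight lam l"
      show "\<forall>m\<in>supp (monomial a c * g). weight lam m \<le> weight lam (a + l)"
      proof
        fix m assume "m \<in> supp (monomial a c * g)"
        then obtain z where "z \<in> supp g" "m = a + z" using supp_monomial_times by blast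
        then show "weight lam m \<le> weight lam (a + l)" using R by simp
      qed
    qed
    then show ?thesis unfolding k coef_init coef_monomial_times_add supp by simp
  next
    case False
    then show ?thesis by (simp add: coef_init coef_monomial_times_notin)
  qed
qed

interpretation rat_span: Modules.module "\<lambda>c (g :: ('n, rat) mpoly). monomial 0 c * g"
  by standard (simp_all add: distrib_left distrib_right single_add mult.assoc[symmetric] mult_single)

text \<open>
  The span is closed under multiplication because a monomial multiple of an initial form is again an
  initial form (\<open>init_monomial_times\<close>).
\<close>

lemma init_ideal_eq_Idl:
  fixes I :: "('n::finite, rat) mpoly set"
  assumes I: "poly_ideal I"
  shows "init_ideal lam I = Idl\<^bsub>poly_ring_rat\<^esub> (init lam ` I)"
proof
  show "init_ideal lam I \<subseteq> Idl\<^bsub>poly_ring_rat\<^esub> (init lam ` I)"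
    unfolding init_ideal_def
  proof (rule rat_span.span_minimal[OF Idl_superset])
    show "rat_span.subspace (Idl\<^bsub>poly_ring_rat\<^esub> (init lam ` I))"
      using poly_ideal_Idl[of "init lam ` I"]
      by (auto simp: rat_span.subspace_def poly_ideal_def)
  qed
  have mult: "r * x \<in> rat_span.span (init lam ` I)" if x: "x \<in> rat_span.span (init lam ` I)" for r x
    using x
  proof (induction rule: rat_span.span_induct_alt)
    case base
    then show ?case by (simp add: rat_span.span_zero)
  next
    case (step c y x)
    then obtain g where g: "g \<in> I" "y = init lam g" by blast
    have "r * (init lam g) \<in> rat_span.span (init lam ` I)"
    proof (induction r rule: poly_induct)
      case zero
      then show ?case by (simp add: rat_span.span_zero)
    next
      case (add r s)
      then show ?case by (simp add: distrib_right rat_span.span_add)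
    next
      case (monomial m d)
      show ?case
      proof (cases "d = 0")
        case True
        then show ?thesis by (simp add: rat_span.span_zero)
      next
        case False
        have "monomial m d * g \<in> I" using I g(1) by (simp add: poly_ideal_def)
        then have "init lam (monomial m d * g) \<in> rat_span.span (init lam ` I)"
          by (intro rat_span.span_base imageI)
        then show ?thesis by (simp add: init_monomial_times[OF False])
      qed
    qed
    then have "monomial 0 c * (r * y) + r * x \<in> rat_span.span (init lam ` I)"
      using step.IH g(2) by (intro rat_span.span_add rat_span.span_scale) auto
    then show ?case by (simp add: distrib_left mult.left_commute)
  qed
  show "Idl\<^bsub>poly_ring_rat\<^esub> (init lam ` I) \<subseteq> init_ideal lam I"
    unfolding init_ideal_def
  proof (rule Idl_least[OF _ rat_span.span_superset])
    show "poly_ideal (rat_span.span (init lam ` I))"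
      unfolding poly_ideal_def using mult rat_span.span_zero rat_span.span_add by blast
  qed
qed

section \<open>Basic elements of a finite poset\<close>

lemma minimal_element_below:
  fixes le :: "'a \<Rightarrow> 'a \<Rightarrow> bool"
  assumes refl: "\<And>x. le x x" and trans: "\<And>x y z. le x y \<Longrightarrow> le y z \<Longrightarrow> le x z"
    and antisym: "\<And>x y. le x y \<Longrightarrow> le y x \<Longrightarrow> x = y"
    and A: "finite A" "z \<in> A"
  shows "\<exists>w\<in>minimal_elements \<lparr>carrier = \<Y>, eq = (=), le = le\<rparr> A. le w z"
  using A(2)
proof (induction "card {w \<in> A. le w z}" arbitrary: z rule: less_induct)
  case less
  show ?case
  proof (cases "\<forall>w\<in>A. le w z \<longrightarrow> w = z")
    case True
    then have "z \<in> minimal_elements \<lparr>carrier = \<Y>, eq = (=), le = le\<rparr> A"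
      using less.prems by (simp add: minimal_elements_def)
    then show ?thesis using refl by blast
  next
    case False
    then obtain w where w: "w \<in> A" "le w z" "w \<noteq> z" by blast
    have "{v \<in> A. le v w} \<subset> {v \<in> A. le v z}"
      using w less.prems refl trans antisym by blast
    then have "card {v \<in> A. le v w} < card {v \<in> A. le v z}" using A(1) by (simp add: psubset_card_mono)
    from less.hyps[OF this w(1)] show ?thesis using w(2) trans by blast
  qed
qed

text \<open>
  The elements \<open>y\<close> of the poset stand for sets \<open>D y\<close> of points of \<open>T\<close>. The hypothesis \<open>cover\<close> says that
  whenever \<open>y\<close> is the greatest lower bound of the elements strictly above it, the set of \<open>y\<close> contains
  the intersection of theirs. Going up in the poset, a point that lies on all basic elements above \<open>y\<close>
  then lies on \<open>y\<close>: the basic elements above some \<open>r > y\<close> are among those above \<open>y\<close>.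
\<close>

lemma points_of_basics:
  fixes le :: "'a \<Rightarrow> 'a \<Rightarrow> bool" and D :: "'a \<Rightarrow> 'b set" and \<Y> :: "'a set"
  defines "L \<equiv> \<lparr>carrier = \<Y>, eq = (=), le = le\<rparr>"
  assumes refl: "\<And>x. le x x" and trans: "\<And>x y z. le x y \<Longrightarrow> le y z \<Longrightarrow> le x z"
    and antisym: "\<And>x y. le x y \<Longrightarrow> le y x \<Longrightarrow> x = y"
    and fin: "finite \<Y>"
    and cover: "\<And>y x. y \<in> \<Y> \<Longrightarrow> (\<And>w. w \<in> \<Y> \<Longrightarrow> (\<And>r. r \<in> \<Y> \<Longrightarrow> le y r \<Longrightarrow> r \<noteq> y \<Longrightarrow> le w r) \<Longrightarrow> le w y) \<Longrightarrow>
      x \<in> T \<Longrightarrow> (\<And>r. r \<in> \<Y> \<Longrightarrow> le y r \<Longrightarrow> r \<noteq> y \<Longrightarrow> x \<in> D r) \<Longrightarrow> x \<in> D y"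
    and y: "y \<in> \<Y>" and x: "x \<in> T" "\<And>z. z \<in> basics_above L y \<Longrightarrow> x \<in> D z"
  shows "x \<in> D y"
  using y x(2)
proof (induction "card {r \<in> \<Y>. le y r}" arbitrary: y rule: less_induct)
  case less
  show ?case
  proof (cases "basic L y")
    case True
    then have "y \<in> basics_above L y" using less.prems refl by (simp add: basics_above_def L_def)
    then show ?thesis using less.prems by blast
  next
    case False
    then have glb: "greatest L y (Lower L {r \<in> carrier L. y \<sqsubset>\<^bsub>L\<^esub> r})"
      using less.prems(1) by (simp add: basic_def L_def)
    show ?thesis
    proof (rule cover[OF less.prems(1) _ x(1)])
      fix w assume w: "w \<in> \<Y>" "\<And>r. r \<in> \<Y> \<Longrightarrow> le y r \<Longrightarrow> r \<noteq> y \<Longrightarrow> le w r"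
      then have "w \<in> Lower L {r \<in> carrier L. y \<sqsubset>\<^bsub>L\<^esub> r}"
        by (auto simp: Lower_def lless_def L_def)
      then have "w \<sqsubseteq>\<^bsub>L\<^esub> y" using glb by (simp add: greatest_def)
      then show "le w y" by (simp add: L_def)
    next
      fix r assume r: "r \<in> \<Y>" "le y r" "r \<noteq> y"
      have "{s \<in> \<Y>. le r s} \<subset> {s \<in> \<Y>. le y s}"
        using r less.prems(1) refl trans antisym by blast
      then have "card {s \<in> \<Y>. le r s} < card {s \<in> \<Y>. le y s}" using fin by (simp add: psubset_card_mono)
      moreover have "x \<in> D z" if "z \<in> basics_above L r" for z
      proof (rule less.prems(2))
        show "z \<in> basics_above L y"
          using that r(2) trans by (auto simp: basics_above_def L_def)
      qed
      ultimately show "x \<in> D r" using less.hyps r(1) by blast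
    qed
  qed
qed

lemma points_of_minimal_basics:
  fixes le :: "'a \<Rightarrow> 'a \<Rightarrow> bool" and D :: "'a \<Rightarrow> 'b set" and \<Y> :: "'a set"
  defines "L \<equiv> \<lparr>carrier = \<Y>, eq = (=), le = le\<rparr>"
  assumes refl: "\<And>x. le x x" and trans: "\<And>x y z. le x y \<Longrightarrow> le y z \<Longrightarrow> le x z"
    and antisym: "\<And>x y. le x y \<Longrightarrow> le y x \<Longrightarrow> x = y"
    and fin: "finite \<Y>" and mono: "\<And>y z. le y z \<Longrightarrow> D y \<subseteq> D z"
    and x: "\<And>z. z \<in> minimal_elements L (basics_above L y) \<Longrightarrow> x \<in> D z"
    and z: "z \<in> basics_above L y"
  shows "x \<in> D z"
proof -
  have "finite (basics_above L y)" using fin by (simp add: basics_above_def L_def)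
  moreover have "\<exists>w\<in>minimal_elements L B. le w z" if "finite B" "z \<in> B" for B
    unfolding L_def using refl trans antisym that by (rule minimal_element_below)
  ultimately obtain w where "w \<in> minimal_elements L (basics_above L y)" "le w z"
    using z by blast
  then show ?thesis using x mono by blast
qed

section \<open>Compatibly split subvarieties of affine space\<close>

text \<open>
  The common part of both sets of hypotheses on \<open>f\<close>. Of the splitting property only
  \<open>trace_one\<close> is a condition, since \<open>frob_trace\<close> is always a near-splitting.
\<close>

locale split_subvarieties =
  fixes f :: "('n::finite, int) mpoly" and S :: "nat set" and \<Y> :: "('n, rat) mpoly set set"
  assumes infinite_primes: "infinite S" and primes: "\<And>p. p \<in> S \<Longrightarrow> prime p"
    and trace_one: "\<And>p. p \<in> S \<Longrightarrow> frob_trace p f 1 = 1"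
    and subvarieties: "\<And>Y. Y \<in> \<Y> \<Longrightarrow> subvariety_rat Y"
    and compatible: "\<And>Y p. Y \<in> \<Y> \<Longrightarrow> p \<in> S \<Longrightarrow> compatibly_split (Tr_pow p f) (reduction p Y)"
begin

lemma ideal_member: "Y \<in> \<Y> \<Longrightarrow> poly_ideal Y"
  using subvarieties subvariety_rat_iff by blast

lemma intersection_decomposition:
  assumes f: "weight_le lam f (weight lam all_vars)"
    and \<Z>: "finite \<Z>" "\<Z> \<subseteq> \<Y>"
    and a: "a ^ N \<in> intersection_ideal \<Z>" "N > 0" "weight_le lam a r"
  shows "\<exists>j. (\<forall>Z\<in>\<Z>. j Z \<in> Z \<and> weight_le lam (j Z) r) \<and> a = (\<Sum>Z\<in>\<Z>. j Z)"
proof -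
  have "\<And>Z. Z \<in> \<Z> \<Longrightarrow> poly_ideal Z" using \<Z>(2) ideal_member by blast
  from intersection_ideal_decompose[OF \<Z>(1) this a(1)]
  obtain i where i: "\<forall>Z\<in>\<Z>. i Z \<in> Z" "a ^ N = (\<Sum>Z\<in>\<Z>. i Z)" by blast
  show ?thesis
  proof (rule power_decomposition[OF infinite_primes primes trace_one f \<Z>(1) _ _ a(3) a(2) i(2)])
  qed (use \<Z>(2) ideal_member compatible i(1) in auto)
qed

lemma sum_in_intersection_ideal:
  assumes "\<And>Z. Z \<in> \<Z> \<Longrightarrow> j Z \<in> Z"
  shows "(\<Sum>Z\<in>\<Z>. j Z) \<in> intersection_ideal \<Z>"
  unfolding intersection_ideal_def
  by (rule poly_ideal_sum[OF poly_ideal_Idl]) (use assms Idl_superset in blast)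

text \<open>
  A set-theoretic intersection is scheme-theoretic: if every point of the intersection of \<open>\<Z>\<close> lies on
  the subscheme of \<open>Y\<close>, each \<open>a \<in> Y\<close> has a power in the sum of the ideals by
  \<open>prime_ideal_avoiding_powers\<close>, and then lies in the sum by \<open>intersection_decomposition\<close>.
\<close>

lemma intersection_ideal_eqI:
  assumes \<Z>: "finite \<Z>" "\<Z> \<subseteq> \<Y>" and Y: "poly_ideal Y" "\<And>Z. Z \<in> \<Z> \<Longrightarrow> Z \<subseteq> Y"
    and points: "\<And>P. subvariety_rat P \<Longrightarrow> (\<And>Z. Z \<in> \<Z> \<Longrightarrow> Z \<subseteq> P) \<Longrightarrow> Y \<subseteq> P"
  shows "Y = intersection_ideal \<Z>"
proof
  show "intersection_ideal \<Z> \<subseteq> Y"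
    unfolding intersection_ideal_def by (rule Idl_least[OF Y(1)]) (use Y(2) in blast)
  show "Y \<subseteq> intersection_ideal \<Z>"
  proof
    fix a assume a: "a \<in> Y"
    have id: "ideal (intersection_ideal \<Z>) poly_ring_rat"
      by (simp add: ideal_poly_ring_rat_iff intersection_ideal_def poly_ideal_Idl)
    have "\<exists>n. a ^ n \<in> intersection_ideal \<Z>"
    proof (rule ccontr)
      assume "\<nexists>n. a ^ n \<in> intersection_ideal \<Z>"
      then have "\<exists>P. subvariety_rat P \<and> intersection_ideal \<Z> \<subseteq> P \<and> a \<notin> P"
        by (intro poly_ring_rat.prime_ideal_avoiding_powers[OF id])
          (auto simp: poly_ring_rat_power poly_ring_rat_simps)
      then obtain P where P: "subvariety_rat P" "intersection_ideal \<Z> \<subseteq> P" "a \<notin> P" by blast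
      have "\<Union>\<Z> \<subseteq> P" using P(2) Idl_superset unfolding intersection_ideal_def by blast
      then have "Y \<subseteq> P" using points[OF P(1)] by blast
      then show False using a P(3) by blast
    qed
    then obtain n where "a ^ n \<in> intersection_ideal \<Z>" by blast
    then have n: "a ^ Suc n \<in> intersection_ideal \<Z>"
      using poly_ideal_Idl[of "\<Union>\<Z>"] unfolding intersection_ideal_def poly_ideal_def by simp
    (* With all weights zero, the bounds on weights hold trivially. *)
    have "weight_le (\<lambda>_. 0) g (weight (\<lambda>_. 0) m)" for g :: "('n, int) mpoly" and m :: "'n \<Rightarrow>\<^sub>0 nat"
      by (simp add: weight_le_def weight_def)
    moreover have "weight_le (\<lambda>_. 0) a 0" by (simp add: weight_le_def weight_def)
    ultimately obtain j where "\<forall>Z\<in>\<Z>. j Z \<in> Z" "a = (\<Sum>Z\<in>\<Z>. j Z)"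
      using intersection_decomposition[OF _ \<Z> n, of "\<lambda>_. 0" 0] by blast
    then show "a \<in> intersection_ideal \<Z>" using sum_in_intersection_ideal[of \<Z> j] by simp
  qed
qed

text \<open>
  By \<open>intersection_decomposition\<close> with exponent \<open>1\<close>, an element \<open>u\<close> of weight \<open>r\<close> is a sum of \<open>j Z \<in> Z\<close>
  of weight at most \<open>r\<close>. Its initial form is the sum of their parts of weight \<open>r\<close>, each of which
  is either zero or the initial form of \<open>j Z\<close>.
\<close>

lemma groebner_basis_union:
  assumes f: "weight_le lam f (weight lam all_vars)"
    and \<Z>: "finite \<Z>" "\<Z> \<subseteq> \<Y>" and Y: "Y = intersection_ideal \<Z>"
    and G: "\<And>Z. Z \<in> \<Z> \<Longrightarrow> groebner_basis lam Z (G Z)"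
  shows "groebner_basis lam Y (\<Union>Z\<in>\<Z>. G Z)"
proof -
  let ?G = "\<Union>Z\<in>\<Z>. G Z"
  let ?J = "Idl\<^bsub>poly_ring_rat\<^esub> (init lam ` ?G)"
  have Yid: "poly_ideal Y" by (simp add: Y intersection_ideal_def poly_ideal_Idl)
  have sub: "?G \<subseteq> Y"
    using G Idl_superset[of "\<Union>\<Z>"] unfolding groebner_basis_def Y intersection_ideal_def by blast
  have initJ: "init lam z \<in> ?J" if "Z \<in> \<Z>" "z \<in> Z" for Z z
  proof -
    have "init lam z \<in> Idl\<^bsub>poly_ring_rat\<^esub> (init lam ` Z)" using Idl_superset that(2) by blast
    also have "\<dots> = init_ideal lam Z"
      using init_ideal_eq_Idl[of Z] that(1) \<Z>(2) ideal_member by blast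
    also have "\<dots> = Idl\<^bsub>poly_ring_rat\<^esub> (init lam ` G Z)"
      using G[OF that(1)] by (simp add: groebner_basis_def)
    also have "\<dots> \<subseteq> ?J"
      by (rule Idl_least[OF poly_ideal_Idl order_trans[OF _ Idl_superset]]) (use that(1) in blast)
    finally show ?thesis .
  qed
  have "init lam u \<in> ?J" if u: "u \<in> Y" for u
  proof (cases "u = 0")
    case True
    have "init lam u = 0" by (rule poly_mapping_eqI) (simp add: True coef_init)
    then show ?thesis using poly_ideal_Idl[of "init lam ` ?G"] by (simp add: poly_ideal_def)
  next
    case False
    define r where "r = Max (weight lam ` supp u)"
    have "supp u \<noteq> {}" using False by (metis empty_iff in_keys_iff lookup_zero poly_mapping_eqI)
    then have ne: "finite (weight lam ` supp u)" "weight lam ` supp u \<noteq> {}" by auto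
    have ur: "weight_le lam u r" unfolding weight_le_def r_def using ne by auto
    obtain m0 where m0: "m0 \<in> supp u" "weight lam m0 = r"
      using Max_in[OF ne] unfolding r_def by fastforce
    have "u ^ 1 \<in> intersection_ideal \<Z>" using u Y by simp
    from intersection_decomposition[OF f \<Z> this _ ur]
    obtain j where j: "\<And>Z. Z \<in> \<Z> \<Longrightarrow> j Z \<in> Z" "\<And>Z. Z \<in> \<Z> \<Longrightarrow> weight_le lam (j Z) r"
      "u = (\<Sum>Z\<in>\<Z>. j Z)" by auto
    define top where "top Z = (if \<exists>m\<in>supp (j Z). weight lam m = r then init lam (j Z) else 0)" for Z
    have coef_top: "coef (top Z) m = (if weight lam m = r then coef (j Z) m else 0)" if "Z \<in> \<Z>" for Z m
    proof (cases "\<exists>m\<in>supp (j Z). weight lam m = r")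
      case True
      then obtain m1 where m1: "m1 \<in> supp (j Z)" "weight lam m1 = r" by blast
      have iff: "(\<forall>m'\<in>supp (j Z). weight lam m' \<le> weight lam m) \<longleftrightarrow> weight lam m = r"
        if "m \<in> supp (j Z)"
        using j(2)[OF \<open>Z \<in> \<Z>\<close>] m1 that by (fastforce simp: weight_le_def)
      have "top Z = init lam (j Z)" using True by (simp add: top_def)
      then show ?thesis using iff by (cases "m \<in> supp (j Z)") (simp_all add: coef_init in_keys_iff)
    next
      case False
      then show ?thesis by (auto simp: top_def in_keys_iff)
    qed
    have "init lam u = (\<Sum>Z\<in>\<Z>. top Z)"
    proof (rule poly_mapping_eqI)
      fix m
      have *: "(m \<in> supp u \<and> (\<forall>m'\<in>supp u. weight lam m' \<le> weight lam m)) \<longleftrightarrow>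
          m \<in> supp u \<and> weight lam m = r"
        using ur m0 by (fastforce simp: weight_le_def)
      have "coef (init lam u) m = (if weight lam m = r then coef u m else 0)"
        unfolding coef_init * by (simp add: in_keys_iff)
      also have "coef u m = (\<Sum>Z\<in>\<Z>. coef (j Z) m)" by (simp add: j(3) lookup_sum)
      finally show "coef (init lam u) m = coef (\<Sum>Z\<in>\<Z>. top Z) m"
        by (simp add: lookup_sum coef_top)
    qed
    moreover have "top Z \<in> ?J" if "Z \<in> \<Z>" for Z
      using initJ[OF that j(1)[OF that]] poly_ideal_Idl[of "init lam ` ?G"]
      by (simp add: top_def poly_ideal_def)
    ultimately show ?thesis by (simp add: poly_ideal_sum[OF poly_ideal_Idl])
  qed
  then have "init lam ` Y \<subseteq> ?J" by blast
  then have "Idl\<^bsub>poly_ring_rat\<^esub> (init lam ` Y) \<subseteq> ?J" by (rule Idl_least[OF poly_ideal_Idl])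
  moreover have "?J \<subseteq> Idl\<^bsub>poly_ring_rat\<^esub> (init lam ` Y)"
    by (rule Idl_least[OF poly_ideal_Idl order_trans[OF _ Idl_superset]]) (use sub in blast)
  moreover have "finite ?G" using \<Z>(1) G by (simp add: groebner_basis_def)
  ultimately show ?thesis using sub init_ideal_eq_Idl[OF Yid] by (simp add: groebner_basis_def)
qed

text \<open>
  The condition \<open>cover\<close> of \<open>points_of_basics\<close> for the sets of primes containing the ideals: a prime above
  the sum of the \<open>r\<close> contains a minimal one, which belongs to the stratification and is therefore a
  lower bound of the \<open>r\<close>.
\<close>

lemma prime_above_basics:
  assumes fin: "finite \<Y>" and strat: "stratification_rat \<Y>" and Y: "Y \<in> \<Y>"
    and P: "subvariety_rat P" "\<And>Z. Z \<in> basics_above (subvariety_poset \<Y>) Y \<Longrightarrow> Z \<subseteq> P"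
  shows "Y \<subseteq> P"
proof -
  let ?D = "\<lambda>Z. {P. subvariety_rat P \<and> Z \<subseteq> P}"
  have "P \<in> ?D Y"
  proof (rule points_of_basics[where \<Y> = \<Y> and le = "\<lambda>I J. J \<subseteq> I" and T = "Collect subvariety_rat" and D = ?D])
    fix y Q
    assume y: "y \<in> \<Y>"
      and glb: "\<And>w. w \<in> \<Y> \<Longrightarrow> (\<And>r. r \<in> \<Y> \<Longrightarrow> r \<subseteq> y \<Longrightarrow> r \<noteq> y \<Longrightarrow> r \<subseteq> w) \<Longrightarrow> y \<subseteq> w"
      and Q: "Q \<in> Collect subvariety_rat" "\<And>r. r \<in> \<Y> \<Longrightarrow> r \<subseteq> y \<Longrightarrow> r \<noteq> y \<Longrightarrow> Q \<in> ?D r"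
    define \<Z> where "\<Z> = {r \<in> \<Y>. r \<subseteq> y \<and> r \<noteq> y}"
    have "poly_ideal Q" using Q(1) subvariety_rat_iff by blast
    moreover have "\<Union>\<Z> \<subseteq> Q" using Q(2) by (auto simp: \<Z>_def)
    ultimately have "intersection_ideal \<Z> \<subseteq> Q" unfolding intersection_ideal_def by (rule Idl_least)
    then obtain P' where P': "P' \<subseteq> Q" "component_rat (intersection_ideal \<Z>) P'"
      using minimal_prime_below Q(1) by blast
    have "\<Z> \<subseteq> \<Y>" by (auto simp: \<Z>_def)
    then have "P' \<in> \<Y>" using strat P'(2) unfolding stratification_rat_def by blast
    have "intersection_ideal \<Z> \<subseteq> P'" using P'(2) by (simp add: component_rat_def)
    then have "\<Union>\<Z> \<subseteq> P'" unfolding intersection_ideal_def using Idl_superset by blast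
    then have "r \<subseteq> P'" if "r \<in> \<Y>" "r \<subseteq> y" "r \<noteq> y" for r using that by (auto simp: \<Z>_def)
    with \<open>P' \<in> \<Y>\<close> have "y \<subseteq> P'" by (rule glb)
    then show "Q \<in> ?D y" using P'(1) Q(1) by blast
  qed (use fin Y P in \<open>auto simp: subvariety_poset_def\<close>)
  then show ?thesis by blast
qed

lemma
  assumes fin: "finite \<Y>" and strat: "stratification_rat \<Y>" and Y: "Y \<in> \<Y>"
  shows intersection_of_basics: "Y = intersection_ideal (basics_above (subvariety_poset \<Y>) Y)"
    and intersection_of_minimal_basics: "Y = intersection_ideal
      (minimal_elements (subvariety_poset \<Y>) (basics_above (subvariety_poset \<Y>) Y))"
proof -
  let ?B = "basics_above (subvariety_poset \<Y>) Y"
  let ?M = "minimal_elements (subvariety_poset \<Y>) ?B"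
  have B: "?B \<subseteq> \<Y>" "\<And>Z. Z \<in> ?B \<Longrightarrow> Z \<subseteq> Y"
    by (auto simp: basics_above_def subvariety_poset_def)
  have M: "?M \<subseteq> ?B" by (auto simp: minimal_elements_def)
  have id: "poly_ideal Y" by (rule ideal_member[OF Y])
  show "Y = intersection_ideal ?B"
    using finite_subset[OF B(1) fin] B(1) id B(2) prime_above_basics[OF fin strat Y]
    by (rule intersection_ideal_eqI)
  show "Y = intersection_ideal ?M"
  proof (rule intersection_ideal_eqI[OF _ _ id])
    fix P assume P: "subvariety_rat P" "\<And>Z. Z \<in> ?M \<Longrightarrow> Z \<subseteq> P"
    have "Z \<subseteq> P" if "Z \<in> ?B" for Z
    proof -
      have "P \<in> {P. Z \<subseteq> P}"
        by (rule points_of_minimal_basics[where \<Y> = \<Y> and le = "\<lambda>I J. J \<subseteq> I" and y = Y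
              and D = "\<lambda>Z. {P. Z \<subseteq> P}"])
          (use fin P(2) that in \<open>auto simp: subvariety_poset_def\<close>)
      then show ?thesis by blast
    qed
    then show "Y \<subseteq> P" using prime_above_basics[OF fin strat Y P(1)] by blast
  qed (use M B fin in \<open>auto intro: finite_subset\<close>)
qed

lemma groebner_basis_of_minimal_basics:
  assumes f: "weight_le lam f (weight lam all_vars)"
    and fin: "finite \<Y>" and strat: "stratification_rat \<Y>" and Y: "Y \<in> \<Y>"
    and G: "\<And>Z. Z \<in> minimal_elements (subvariety_poset \<Y>) (basics_above (subvariety_poset \<Y>) Y) \<Longrightarrow>
      groebner_basis lam Z (G Z)"
  shows "groebner_basis lam Y
    (\<Union>Z\<in>minimal_elements (subvariety_poset \<Y>) (basics_above (subvariety_poset \<Y>) Y). G Z)"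
proof (rule groebner_basis_union[OF f _ _ intersection_of_minimal_basics[OF fin strat Y] G])
  show "minimal_elements (subvariety_poset \<Y>) (basics_above (subvariety_poset \<Y>) Y) \<subseteq> \<Y>"
    by (auto simp: minimal_elements_def basics_above_def subvariety_poset_def)
  then show "finite (minimal_elements (subvariety_poset \<Y>) (basics_above (subvariety_poset \<Y>) Y))"
    using fin finite_subset by blast
qed

end

text \<open>
  There are only finitely many squarefree monomials; for each of them that is the initial form of an
  element of \<open>I\<close>, one such element is chosen.
\<close>

lemma squarefree_groebner_basis:
  fixes f :: "('n::finite, int) mpoly" and I :: "('n, rat) mpoly set"
  assumes f: "init lam f = monomial all_vars 1"
    and S: "infinite S" "\<And>p. p \<in> S \<Longrightarrow> prime p"
    and I: "poly_ideal I" and compat: "\<And>p. p \<in> S \<Longrightarrow> compatibly_split (Tr_pow p f) (reduction p I)"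
  shows "\<exists>G. groebner_basis lam I G \<and> (\<forall>g\<in>G. squarefree_monomial (init lam g))"
proof -
  define Q where "Q = {q :: 'n \<Rightarrow>\<^sub>0 nat. (\<forall>i. coef q i \<le> 1) \<and> (\<exists>h\<in>I. init lam h = monomial q 1)}"
  have "\<forall>q\<in>Q. \<exists>h\<in>I. init lam h = monomial q 1" by (auto simp: Q_def)
  then obtain h where h: "\<And>q. q \<in> Q \<Longrightarrow> h q \<in> I \<and> init lam (h q) = monomial q 1" by metis
  have "finite Q"
  proof (rule finite_subset[OF _ finite_mdeg_le])
    show "Q \<subseteq> {m. mdeg m \<le> CARD('n)}"
    proof
      fix q assume "q \<in> Q"
      then have "mdeg q \<le> (\<Sum>i\<in>(UNIV::'n set). 1)" unfolding mdeg_def by (intro sum_mono) (simp add: Q_def)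
      then show "q \<in> {m. mdeg m \<le> CARD('n)}" by simp
    qed
  qed
  let ?J = "Idl\<^bsub>poly_ring_rat\<^esub> (init lam ` h ` Q)"
  have "init lam g \<in> ?J" if g: "g \<in> I" for g
  proof -
    have "monomial m (coef (init lam g) m) \<in> ?J" if m: "m \<in> supp (init lam g)" for m
    proof -
      have q: "radical_exponent m \<in> Q"
        using squarefree_initial_form[OF f S I compat g m] by (simp add: Q_def coef_radical_exponent)
      then have "init lam (h (radical_exponent m)) \<in> ?J"
        using Idl_superset[of "init lam ` h ` Q"] by blast
      then have "monomial (radical_exponent m) 1 \<in> ?J" using h[OF q] by simp
      moreover have m_split: "m = (m - radical_exponent m) + radical_exponent m"
        by (rule poly_mapping_eqI) (simp add: lookup_add lookup_minus coef_radical_exponent)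
      have "monomial m (coef (init lam g) m) =
          monomial (m - radical_exponent m) (coef (init lam g) m) * monomial (radical_exponent m) 1"
        by (simp add: mult_single m_split[symmetric])
      ultimately show ?thesis using poly_ideal_Idl[of "init lam ` h ` Q"] by (simp add: poly_ideal_def)
    qed
    then have "(\<Sum>m\<in>supp (init lam g). monomial m (coef (init lam g) m)) \<in> ?J"
      by (rule poly_ideal_sum[OF poly_ideal_Idl])
    then show ?thesis by (simp only: poly_eq_sum_monomials[symmetric])
  qed
  then have "Idl\<^bsub>poly_ring_rat\<^esub> (init lam ` I) \<subseteq> ?J" by (intro Idl_least[OF poly_ideal_Idl]) blast
  moreover have "?J \<subseteq> Idl\<^bsub>poly_ring_rat\<^esub> (init lam ` I)"
    by (rule Idl_least[OF poly_ideal_Idl order_trans[OF _ Idl_superset]]) (use h in blast)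
  ultimately have "groebner_basis lam I (h ` Q)"
    using \<open>finite Q\<close> h init_ideal_eq_Idl[OF I] by (auto simp: groebner_basis_def)
  moreover have "squarefree_monomial (init lam g)" if "g \<in> h ` Q" for g
    using that h by (auto simp: squarefree_monomial_def Q_def)
  ultimately show ?thesis by blast
qed

lemma mdeg_all_vars: "mdeg (all_vars :: 'n::finite \<Rightarrow>\<^sub>0 nat) = CARD('n)"
  by (simp add: mdeg_def)

text \<open>
  As \<open>f\<close> has degree \<open>n\<close>, the trace of \<open>f ^ (p - 1)\<close> is constant. The constant is the coefficient
  of \<open>(\<Prod>i. x i) ^ (p - 1)\<close>, which is \<open>1\<close> because of the initial form.
\<close>

lemma frob_trace_one:
  fixes f :: "('n::finite, int) mpoly"
  assumes p: "prime p" and f: "init lam f = monomial all_vars 1" and deg: "total_degree f = CARD('n)"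
  shows "frob_trace p f 1 = 1"
proof (rule poly_mapping_eqI)
  fix k
  have p0: "p > 0" "p > 1" using p prime_gt_0_nat prime_gt_1_nat by blast+
  show "coef (frob_trace p f 1) k = coef 1 k"
  proof (cases "k = 0")
    case True
    have nu: "trace_preimage p 0 = dilate (p - 1) (all_vars :: 'n \<Rightarrow>\<^sub>0 nat)"
      using p0 by (intro poly_mapping_eqI) (simp add: coef_trace_preimage)
    have "coef (f ^ (p - 1) * 1) (dilate (p - 1) all_vars) =
        coef (monomial (dilate (p - 1) all_vars) 1 * 1) (dilate (p - 1) all_vars)"
      using coef_power_top[OF f, of 1 0 "p - 1" "dilate (p - 1) all_vars"]
      by (simp add: weight_le_def weight_dilate)
    then show ?thesis using True p0 by (simp add: coef_frob_trace nu)
  next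
    case False
    have "k \<notin> supp (frob_trace p f 1)"
    proof
      assume k: "k \<in> supp (frob_trace p f 1)"
      have "mdeg m \<le> CARD('n)" if "m \<in> supp f" for m
      proof -
        have "mdeg m \<le> total_degree f" unfolding total_degree_def mdeg_def using that by (intro Max_ge) auto
        then show ?thesis by (simp add: deg)
      qed
      then have "weight_le (\<lambda>_. 1) f (real CARD('n))" by (simp add: weight_le_mdeg)
      moreover have "weight_le (\<lambda>_. 1) (1 :: ('n, int) mpoly) 0" by (simp add: weight_le_def)
      ultimately have "real p * (real (mdeg k) + real CARD('n)) \<le> real (p - 1) * real CARD('n) + 0 + real CARD('n)"
        using weight_le_frob_trace[OF p0(1) _ _ k] by (metis mdeg_eq_weight mdeg_all_vars)
      then have "real p * real (mdeg k) \<le> 0" using p0 by (simp add: of_nat_diff algebra_simps)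
      then have "mdeg k = 0" using p0 by (simp add: mult_le_0_iff)
      then have "k = 0" by (intro poly_mapping_eqI) (simp add: mdeg_def)
      then show False using False by blast
    qed
    then show ?thesis using False by (simp add: in_keys_iff lookup_one)
  qed
qed

lemma splitting_trace_one:
  assumes "prime p" "splitting p (poly_ring_mod p) (Tr_pow p f)"
  shows "frob_trace p f 1 = 1"
proof -
  have p: "p > 1" using assms(1) prime_gt_1_nat by blast
  have "Tr_pow p f 1 = 1" using assms(2) by (simp add: splitting_def poly_ring_mod_def)
  then show ?thesis using Tr_pow_reduce[OF p, of f 1] by (simp add: reduce_one[OF p])
qed

text \<open>
  The initial form is homogeneous, of weight \<open>r\<close> say. As the trace of its \<open>(p - 1)\<close>-th power is \<open>1\<close>, this power
  contains the monomial \<open>(\<Prod>i. x i) ^ (p - 1)\<close>, which determines \<open>r\<close>.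
\<close>

lemma splitting_init_weight:
  fixes f :: "('n::finite, int) mpoly"
  assumes p: "prime p" and one: "frob_trace p (init lam f) 1 = 1"
  shows "weight_le lam f (weight lam all_vars)"
proof -
  let ?W = "weight lam (all_vars :: 'n \<Rightarrow>\<^sub>0 nat)"
  have p0: "p > 0" "p > 1" using p prime_gt_0_nat prime_gt_1_nat by blast+
  have "f \<noteq> 0"
  proof
    assume "f = 0"
    then have "init lam f = 0" by (intro poly_mapping_eqI) (simp add: coef_init)
    then have "coef (frob_trace p (init lam f) 1) 0 = 0"
      using p0 by (simp add: coef_frob_trace power_0_left)
    then show False by (simp add: one)
  qed
  define r where "r = Max (weight lam ` supp f)"
  have "supp f \<noteq> {}" using \<open>f \<noteq> 0\<close> by (metis empty_iff in_keys_iff lookup_zero poly_mapping_eqI)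
  then have ne: "finite (weight lam ` supp f)" "weight lam ` supp f \<noteq> {}" by auto
  have fr: "weight_le lam f r" unfolding weight_le_def r_def using ne by auto
  obtain m0 where m0: "m0 \<in> supp f" "weight lam m0 = r"
    using Max_in[OF ne] unfolding r_def by fastforce
  have "weight lam m = r" if "m \<in> supp (init lam f)" for m
    using that m0 fr by (fastforce simp: in_keys_iff[of m "init lam f"] coef_init weight_le_def split: if_splits)
  (* The bound for the negated weights gives the lower bound on the weight of the product of the
     variables. *)
  then have "weight_le (\<lambda>i. - lam i) (init lam f) (- r)"
    by (simp add: weight_le_def weight_def sum_negf)
  moreover have "weight_le (\<lambda>i. - lam i) (1 :: ('n, int) mpoly) 0" by (simp add: weight_le_def)
  moreover have "0 \<in> supp (frob_trace p (init lam f) 1)" by (simp add: one)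
  ultimately have "real p * (weight (\<lambda>i. - lam i) (0 :: 'n \<Rightarrow>\<^sub>0 nat) + weight (\<lambda>i. - lam i) (all_vars :: 'n \<Rightarrow>\<^sub>0 nat)) \<le>
      real (p - 1) * (- r) + 0 + weight (\<lambda>i. - lam i) (all_vars :: 'n \<Rightarrow>\<^sub>0 nat)"
    by (rule weight_le_frob_trace[OF p0(1)])
  moreover have "weight (\<lambda>i. - lam i) (all_vars :: 'n \<Rightarrow>\<^sub>0 nat) = - ?W" by (simp add: weight_def sum_negf)
  ultimately have "real (p - 1) * r \<le> real (p - 1) * ?W"
    using p0 by (simp add: of_nat_diff algebra_simps)
  then have "r \<le> ?W" using p0 by simp
  then show ?thesis using fr weight_le_mono by blast
qed

section \<open>Irreducible components\<close>

text \<open>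
  Zorn's lemma for the irreducible closed subsets of \<open>A\<close> through \<open>x\<close>. A chain is bounded by the
  closure of its union, which is irreducible because the members of the chain are nested. Adding
  \<open>x\<close> to the union lets the closure of the point bound the empty chain.
\<close>

lemma point_in_component:
  assumes A: "closedin (space_top X) A" and x: "x \<in> A"
  shows "\<exists>W. component X A W \<and> x \<in> W"
proof -
  define \<W> where "\<W> = {W. subvariety X W \<and> W \<subseteq> A \<and> x \<in> W}"
  have xT: "x \<in> topspace (space_top X)" using A x closedin_subset by blast
  have "\<exists>M\<in>\<W>. \<forall>W\<in>\<W>. M \<subseteq> W \<longrightarrow> W = M"
  proof (rule subset_Zorn)
    fix C assume C: "subset.chain \<W> C"
    then have CW: "\<And>W. W \<in> C \<Longrightarrow> subvariety X W \<and> W \<subseteq> A \<and> x \<in> W"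
      and tot: "\<And>V W. V \<in> C \<Longrightarrow> W \<in> C \<Longrightarrow> V \<subseteq> W \<or> W \<subseteq> V"
      by (auto simp: subset_chain_def \<W>_def)
    define G where "G = insert x (\<Union>C)"
    have GA: "G \<subseteq> A" using x CW by (auto simp: G_def)
    define U where "U = (space_top X) closure_of G"
    have GT: "G \<subseteq> topspace (space_top X)" using GA A closedin_subset by blast
    have GU: "G \<subseteq> U" unfolding U_def by (rule closure_of_subset[OF GT])
    have "subvariety X U"
      unfolding subvariety_def
    proof (intro conjI allI impI)
      show "closedin (space_top X) U" by (simp add: U_def)
      show "U \<noteq> {}" using GU by (auto simp: G_def)
      fix B B' assume "closedin (space_top X) B \<and> closedin (space_top X) B' \<and> U \<subseteq> B \<union> B'"
      then have B: "closedin (space_top X) B" "closedin (space_top X) B'" "U \<subseteq> B \<union> B'" by auto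
      have irr: "W \<subseteq> B \<or> W \<subseteq> B'" if "W \<in> C" for W
      proof -
        have "W \<subseteq> B \<union> B'" using that GU B(3) by (auto simp: G_def)
        then show ?thesis using CW[OF that] B(1,2) unfolding subvariety_def by blast
      qed
      have "G \<subseteq> B \<or> G \<subseteq> B'"
      proof (cases "C = {}")
        case True
        then show ?thesis using GU B(3) by (auto simp: G_def)
      next
        case False
        then have G: "G = \<Union>C" using CW by (auto simp: G_def)
        show ?thesis
        proof (rule ccontr)
          assume "\<not> ?thesis"
          then obtain V W where VW: "V \<in> C" "\<not> V \<subseteq> B" "W \<in> C" "\<not> W \<subseteq> B'" unfolding G by blast
          then show False using tot[OF VW(1,3)] irr[OF VW(1)] irr[OF VW(3)] by blast
        qed
      qed
      then show "U \<subseteq> B \<or> U \<subseteq> B'"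
        unfolding U_def using closure_of_minimal B(1,2) by blast
    qed
    moreover have "U \<subseteq> A" unfolding U_def by (rule closure_of_minimal[OF GA A])
    moreover have "x \<in> U" using GU by (auto simp: G_def)
    ultimately have "U \<in> \<W>" by (simp add: \<W>_def)
    moreover have "\<forall>W\<in>C. W \<subseteq> U" using GU by (auto simp: G_def)
    ultimately show "\<exists>U\<in>\<W>. \<forall>W\<in>C. W \<subseteq> U" by blast
  qed
  then obtain M where M: "M \<in> \<W>" "\<And>W. W \<in> \<W> \<Longrightarrow> M \<subseteq> W \<Longrightarrow> W = M" by blast
  have "component X A M"
    unfolding component_def
  proof (intro conjI allI impI)
    fix W' assume W': "subvariety X W' \<and> M \<subseteq> W' \<and> W' \<subseteq> A"
    then have "W' \<in> \<W>" using M(1) by (auto simp: \<W>_def)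
    then show "W' = M" using M(2) W' by blast
  qed (use M(1) in \<open>auto simp: \<W>_def\<close>)
  then show ?thesis using M(1) by (auto simp: \<W>_def)
qed

section \<open>Ideals stable under a splitting\<close>

text \<open>
  The splitting maps \<open>s ^ (p ^ (k + 1))\<close> to \<open>s ^ (p ^ k)\<close>, so one may descend from a large power
  to \<open>s\<close>.
\<close>

lemma (in cring) frobenius_stable_radical:
  assumes p: "prime p" and \<phi>: "splitting p R \<phi>" and J: "ideal J R" "\<phi> ` J \<subseteq> J"
    and s: "s \<in> carrier R" "s [^] (N::nat) \<in> J"
  shows "s \<in> J"
proof -
  have down: "s [^] (p ^ k) \<in> J \<Longrightarrow> s \<in> J" for k :: nat
  proof (induction k)
    case 0
    then show ?case using s(1) by simp
  next
    case (Suc k)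
    let ?t = "s [^] (p ^ k)"
    have t: "?t \<in> carrier R" using s(1) by simp
    have "s [^] (p ^ Suc k) = ?t [^] p \<otimes> \<one>" using s(1) by (simp add: nat_pow_pow mult.commute)
    then have "\<phi> (s [^] (p ^ Suc k)) = \<phi> (?t [^] p \<otimes> \<one>)" by (rule arg_cong)
    also have "\<dots> = ?t \<otimes> \<phi> \<one>"
      using \<phi> t one_closed unfolding splitting_def near_splitting_def by blast
    also have "\<dots> = ?t" using \<phi> t by (simp add: splitting_def)
    finally have "?t \<in> J" using J(2) Suc.prems by (metis image_subset_iff)
    then show ?case by (rule Suc.IH)
  qed
  have "N < p ^ N" using p prime_gt_1_nat by (simp add: less_exp power_gt_expt)
  then have "s [^] (p ^ N) = s [^] (p ^ N - N) \<otimes> s [^] N" using s(1) by (simp add: nat_pow_mult)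
  then have "s [^] (p ^ N) \<in> J" using ideal.I_l_closed[OF J(1) s(2)] s(1) by simp
  then show ?thesis by (rule down)
qed

lemma (in ring) add_idem_zero:
  assumes "x \<in> carrier R" "x \<oplus> x = x"
  shows "x = \<zero>"
proof -
  have "x = (\<ominus> x) \<oplus> (x \<oplus> x)" using assms(1) by (simp add: r_neg1)
  then show ?thesis using assms by (simp add: l_neg)
qed

text \<open>
  The elements all of whose multiples are mapped into the sum form an ideal \<open>H\<close>, which contains each
  of the given ideals and hence their sum.
\<close>

lemma (in cring) Idl_frobenius_stable:
  assumes \<phi>: "splitting p R \<phi>" and I: "\<And>Z. Z \<in> A \<Longrightarrow> ideal (I Z) R \<and> \<phi> ` I Z \<subseteq> I Z"
  shows "\<phi> ` (Idl (\<Union>Z\<in>A. I Z)) \<subseteq> Idl (\<Union>Z\<in>A. I Z)"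
proof -
  let ?J = "Idl (\<Union>Z\<in>A. I Z)"
  have sub: "(\<Union>Z\<in>A. I Z) \<subseteq> carrier R"
  proof
    fix x assume "x \<in> (\<Union>Z\<in>A. I Z)"
    then obtain Z where "Z \<in> A" "x \<in> I Z" by blast
    then show "x \<in> carrier R" using I[of Z] ideal.Icarr[of "I Z" R x] by simp
  qed
  interpret J: ideal ?J R by (rule genideal_ideal[OF sub])
  have \<phi>c: "\<And>a. a \<in> carrier R \<Longrightarrow> \<phi> a \<in> carrier R"
    and \<phi>a: "\<And>a b. a \<in> carrier R \<Longrightarrow> b \<in> carrier R \<Longrightarrow> \<phi> (a \<oplus> b) = \<phi> a \<oplus> \<phi> b"
    using \<phi> by (auto simp: splitting_def near_splitting_def)
  have \<phi>0: "\<phi> \<zero> = \<zero>"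
    using \<phi>a[of \<zero> \<zero>] \<phi>c[of \<zero>] by (intro add_idem_zero) auto
  define H where "H = {s \<in> carrier R. \<forall>r\<in>carrier R. \<phi> (r \<otimes> s) \<in> ?J}"
  have "ideal H R"
  proof (rule ideal_cringI)
    show "\<zero> \<in> H" by (simp add: H_def \<phi>0)
  next
    fix a b assume "a \<in> H" "b \<in> H"
    then show "a \<oplus> b \<in> H" by (simp add: H_def r_distr \<phi>a)
  next
    fix a x assume a: "a \<in> H" and x: "x \<in> carrier R"
    have "\<phi> (r \<otimes> (x \<otimes> a)) \<in> ?J" if "r \<in> carrier R" for r
    proof -
      have "r \<otimes> (x \<otimes> a) = (r \<otimes> x) \<otimes> a" using a x that by (simp add: H_def m_assoc)
      then show ?thesis using a x that by (simp add: H_def)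
    qed
    then show "x \<otimes> a \<in> H" using a x by (simp add: H_def)
  qed (auto simp: H_def)
  moreover have "(\<Union>Z\<in>A. I Z) \<subseteq> H"
  proof
    fix s assume "s \<in> (\<Union>Z\<in>A. I Z)"
    then obtain Z where Z: "Z \<in> A" "s \<in> I Z" by blast
    have "\<phi> (r \<otimes> s) \<in> ?J" if "r \<in> carrier R" for r
    proof -
      have "r \<otimes> s \<in> I Z" using I[OF Z(1)] Z(2) that by (simp add: ideal.I_l_closed)
      then have "\<phi> (r \<otimes> s) \<in> I Z" using I[OF Z(1)] by blast
      then show ?thesis using Z(1) genideal_self[OF sub] by blast
    qed
    then show "s \<in> H" using sub Z by (auto simp: H_def)
  qed
  ultimately have "?J \<subseteq> H" by (rule genideal_minimal)
  moreover have "\<phi> s \<in> ?J" if "s \<in> H" for s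
  proof -
    have "\<phi> (\<one> \<otimes> s) \<in> ?J" "s \<in> carrier R" using that unfolding H_def by blast+
    then show ?thesis by simp
  qed
  ultimately show ?thesis by blast
qed

section \<open>Localisation at a prime ideal\<close>

locale prime_point = primeideal P R for P and R :: "'r ring" (structure)
begin

lemma one_notin: "\<one> \<in> carrier R - P"
  using one_imp_carrier I_notcarr by auto

lemma mult_notin: "s \<in> carrier R - P \<Longrightarrow> t \<in> carrier R - P \<Longrightarrow> s \<otimes> t \<in> carrier R - P"
  using I_prime by auto

text \<open>
  Equality of the fractions \<open>a / s\<close> and \<open>b / t\<close> in the localisation, without differences.
\<close>

definition frac_eq where
  "frac_eq a s b t \<longleftrightarrow> (\<exists>u\<in>carrier R - P. u \<otimes> (t \<otimes> a) = u \<otimes> (s \<otimes> b))"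

lemma mult_diff_zero_iff:
  assumes "u \<in> carrier R" "x \<in> carrier R" "y \<in> carrier R"
  shows "u \<otimes> (x \<ominus> y) = \<zero> \<longleftrightarrow> u \<otimes> x = u \<otimes> y"
proof -
  have "u \<otimes> (x \<ominus> y) = u \<otimes> x \<ominus> u \<otimes> y" using assms by (simp add: minus_eq r_distr r_minus)
  then show ?thesis using assms by (simp add: r_right_minus_eq)
qed

lemma in_local_frac:
  assumes "a \<in> carrier R" "s \<in> carrier R - P"
  shows "(b, t) \<in> local_frac R P a s \<longleftrightarrow> b \<in> carrier R \<and> t \<in> carrier R - P \<and> frac_eq a s b t"
proof -
  have "(\<exists>u\<in>carrier R - P. u \<otimes> (t \<otimes> a \<ominus> s \<otimes> b) = \<zero>) \<longleftrightarrow> frac_eq a s b t"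
    if "b \<in> carrier R" "t \<in> carrier R - P"
    unfolding frac_eq_def
    by (rule bex_cong[OF refl], rule mult_diff_zero_iff) (use assms that in auto)
  then show ?thesis by (auto simp: local_frac_def)
qed

lemma frac_eq_refl: "frac_eq a s a s"
  unfolding frac_eq_def using one_notin by blast

lemma frac_eq_sym: "frac_eq a s b t \<Longrightarrow> frac_eq b t a s"
  unfolding frac_eq_def by metis

lemma frac_eq_trans:
  assumes c: "a \<in> carrier R" "b \<in> carrier R" "c \<in> carrier R"
    "s \<in> carrier R - P" "t \<in> carrier R - P" "v \<in> carrier R - P"
    and "frac_eq a s b t" "frac_eq b t c v"
  shows "frac_eq a s c v"
proof -
  obtain u u' where u: "u \<in> carrier R - P" "u \<otimes> (t \<otimes> a) = u \<otimes> (s \<otimes> b)"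
    and u': "u' \<in> carrier R - P" "u' \<otimes> (v \<otimes> b) = u' \<otimes> (t \<otimes> c)"
    using assms(7,8) unfolding frac_eq_def by blast
  have k: "u \<in> carrier R" "u' \<in> carrier R" "s \<in> carrier R" "t \<in> carrier R" "v \<in> carrier R"
    using u u' c by auto
  have "(u \<otimes> u' \<otimes> t) \<otimes> (v \<otimes> a) = (u' \<otimes> v) \<otimes> (u \<otimes> (t \<otimes> a))" using k c by (simp add: m_ac)
  also have "\<dots> = (u \<otimes> s) \<otimes> (u' \<otimes> (v \<otimes> b))" unfolding u(2) using k c by (simp add: m_ac)
  also have "\<dots> = (u \<otimes> u' \<otimes> t) \<otimes> (s \<otimes> c)" unfolding u'(2) using k c by (simp add: m_ac)
  finally show ?thesis unfolding frac_eq_def using mult_notin u(1) u'(1) c(5) by blast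
qed

lemma local_frac_eq_iff:
  assumes "a \<in> carrier R" "b \<in> carrier R" "s \<in> carrier R - P" "t \<in> carrier R - P"
  shows "local_frac R P a s = local_frac R P b t \<longleftrightarrow> frac_eq a s b t"
proof
  assume "local_frac R P a s = local_frac R P b t"
  moreover have "(b, t) \<in> local_frac R P b t" using assms by (simp add: in_local_frac frac_eq_refl)
  ultimately show "frac_eq a s b t" using assms in_local_frac by blast
next
  assume eq: "frac_eq a s b t"
  have "(c, v) \<in> local_frac R P a s \<longleftrightarrow> (c, v) \<in> local_frac R P b t" for c v
    unfolding in_local_frac[OF assms(1,3)] in_local_frac[OF assms(2,4)]
    using frac_eq_trans[OF assms(2,1) _ assms(4,3) _ frac_eq_sym[OF eq]]
      frac_eq_trans[OF assms(1,2) _ assms(3,4) _ eq] by blast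
  then show "local_frac R P a s = local_frac R P b t" by auto
qed

lemma frac_eq_mult:
  assumes c: "a \<in> carrier R" "b \<in> carrier R" "a' \<in> carrier R" "b' \<in> carrier R"
    "s \<in> carrier R - P" "t \<in> carrier R - P" "s' \<in> carrier R - P" "t' \<in> carrier R - P"
    and "frac_eq a s a' s'" "frac_eq b t b' t'"
  shows "frac_eq (a \<otimes> b) (s \<otimes> t) (a' \<otimes> b') (s' \<otimes> t')"
    and "frac_eq (a \<otimes> t \<oplus> b \<otimes> s) (s \<otimes> t) (a' \<otimes> t' \<oplus> b' \<otimes> s') (s' \<otimes> t')"
proof -
  obtain u v where u: "u \<in> carrier R - P" "u \<otimes> (s' \<otimes> a) = u \<otimes> (s \<otimes> a')"
    and v: "v \<in> carrier R - P" "v \<otimes> (t' \<otimes> b) = v \<otimes> (t \<otimes> b')"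
    using assms(9,10) unfolding frac_eq_def by blast
  have k: "u \<in> carrier R" "v \<in> carrier R" "s \<in> carrier R" "t \<in> carrier R" "s' \<in> carrier R" "t' \<in> carrier R"
    using u v c by auto
  have uv: "u \<otimes> v \<in> carrier R - P" using mult_notin u(1) v(1) by blast
  have "(u \<otimes> v) \<otimes> ((s' \<otimes> t') \<otimes> (a \<otimes> b)) = (u \<otimes> (s' \<otimes> a)) \<otimes> (v \<otimes> (t' \<otimes> b))"
    using k c by (simp add: m_ac)
  also have "\<dots> = (u \<otimes> v) \<otimes> ((s \<otimes> t) \<otimes> (a' \<otimes> b'))"
    unfolding u(2) v(2) using k c by (simp add: m_ac)
  finally show "frac_eq (a \<otimes> b) (s \<otimes> t) (a' \<otimes> b') (s' \<otimes> t')" unfolding frac_eq_def using uv by blast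
  have "(u \<otimes> v) \<otimes> ((s' \<otimes> t') \<otimes> (a \<otimes> t \<oplus> b \<otimes> s)) =
      (u \<otimes> (s' \<otimes> a)) \<otimes> (v \<otimes> t' \<otimes> t) \<oplus> (v \<otimes> (t' \<otimes> b)) \<otimes> (u \<otimes> s' \<otimes> s)"
    using k c by (simp add: m_ac r_distr)
  also have "\<dots> = (u \<otimes> v) \<otimes> ((s \<otimes> t) \<otimes> (a' \<otimes> t' \<oplus> b' \<otimes> s'))"
    unfolding u(2) v(2) using k c by (simp add: m_ac r_distr)
  finally show "frac_eq (a \<otimes> t \<oplus> b \<otimes> s) (s \<otimes> t) (a' \<otimes> t' \<oplus> b' \<otimes> s') (s' \<otimes> t')"
    unfolding frac_eq_def using uv by blast
qed

text \<open>
  The operations on germs are unions over all representatives of both fractions; they can be computed with any one pair.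
\<close>

lemma local_frac_UNION:
  fixes F :: "'r \<Rightarrow> 'r \<Rightarrow> 'r \<Rightarrow> 'r \<Rightarrow> 'c set"
  assumes ab: "a \<in> carrier R" "b \<in> carrier R" "s \<in> carrier R - P" "t \<in> carrier R - P"
    and F: "\<And>a' s' b' t'. a' \<in> carrier R \<Longrightarrow> b' \<in> carrier R \<Longrightarrow> s' \<in> carrier R - P \<Longrightarrow>
      t' \<in> carrier R - P \<Longrightarrow> frac_eq a s a' s' \<Longrightarrow> frac_eq b t b' t' \<Longrightarrow> F a' s' b' t' = F a s b t"
  shows "(\<Union>(a', s')\<in>local_frac R P a s. \<Union>(b', t')\<in>local_frac R P b t. F a' s' b' t') = F a s b t"
proof -
  have 1: "F a' s' b' t' = F a s b t"
    if "(a', s') \<in> local_frac R P a s" "(b', t') \<in> local_frac R P b t" for a' s' b' t'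
  proof -
    have "a' \<in> carrier R \<and> s' \<in> carrier R - P \<and> frac_eq a s a' s'"
      using that(1) in_local_frac[OF ab(1,3), of a' s'] by simp
    moreover have "b' \<in> carrier R \<and> t' \<in> carrier R - P \<and> frac_eq b t b' t'"
      using that(2) in_local_frac[OF ab(2,4), of b' t'] by simp
    ultimately show ?thesis using F by simp
  qed
  have "(a, s) \<in> local_frac R P a s" "(b, t) \<in> local_frac R P b t"
    using ab by (simp_all add: in_local_frac frac_eq_refl)
  then have 2: "(a, s) \<in> local_frac R P a s \<and> (b, t) \<in> local_frac R P b t" by simp
  show ?thesis
  proof (rule equalityI; rule subsetI)
    fix x assume "x \<in> (\<Union>(a', s')\<in>local_frac R P a s. \<Union>(b', t')\<in>local_frac R P b t. F a' s' b' t')"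
    then obtain q r where qr: "q \<in> local_frac R P a s" "r \<in> local_frac R P b t"
      "x \<in> F (fst q) (snd q) (fst r) (snd r)" by (auto simp: case_prod_beta)
    then show "x \<in> F a s b t" using 1[of "fst q" "snd q" "fst r" "snd r"] by simp
  next
    fix x assume "x \<in> F a s b t"
    then show "x \<in> (\<Union>(a', s')\<in>local_frac R P a s. \<Union>(b', t')\<in>local_frac R P b t. F a' s' b' t')"
      unfolding case_prod_beta using 2 by (intro UN_I[of "(a, s)"] UN_I[of "(b, t)"]) simp_all
  qed
qed

lemma local_frac_mult:
  assumes ab: "a \<in> carrier R" "b \<in> carrier R" "s \<in> carrier R - P" "t \<in> carrier R - P"
  shows "(\<Union>(a', s')\<in>local_frac R P a s. \<Union>(b', t')\<in>local_frac R P b t.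
      local_frac R P (a' \<otimes> b') (s' \<otimes> t')) = local_frac R P (a \<otimes> b) (s \<otimes> t)"
proof (rule local_frac_UNION[OF ab])
  fix a' s' b' t'
  assume *: "a' \<in> carrier R" "b' \<in> carrier R" "s' \<in> carrier R - P" "t' \<in> carrier R - P"
    "frac_eq a s a' s'" "frac_eq b t b' t'"
  show "local_frac R P (a' \<otimes> b') (s' \<otimes> t') = local_frac R P (a \<otimes> b) (s \<otimes> t)"
    by (subst local_frac_eq_iff)
      (use * ab mult_notin frac_eq_sym[OF frac_eq_mult(1)[OF ab(1,2) *(1,2) ab(3,4) *(3,4,5,6)]] in auto)
qed

lemma local_frac_add:
  assumes ab: "a \<in> carrier R" "b \<in> carrier R" "s \<in> carrier R - P" "t \<in> carrier R - P"
  shows "(\<Union>(a', s')\<in>local_frac R P a s. \<Union>(b', t')\<in>local_frac R P b t.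
      local_frac R P (a' \<otimes> t' \<oplus> b' \<otimes> s') (s' \<otimes> t')) = local_frac R P (a \<otimes> t \<oplus> b \<otimes> s) (s \<otimes> t)"
proof (rule local_frac_UNION[OF ab])
  fix a' s' b' t'
  assume *: "a' \<in> carrier R" "b' \<in> carrier R" "s' \<in> carrier R - P" "t' \<in> carrier R - P"
    "frac_eq a s a' s'" "frac_eq b t b' t'"
  show "local_frac R P (a' \<otimes> t' \<oplus> b' \<otimes> s') (s' \<otimes> t') = local_frac R P (a \<otimes> t \<oplus> b \<otimes> s) (s \<otimes> t)"
    by (subst local_frac_eq_iff)
      (use * ab mult_notin frac_eq_sym[OF frac_eq_mult(2)[OF ab(1,2) *(1,2) ab(3,4) *(3,4,5,6)]] in auto)
qed

end

section \<open>Sections over open subsets of a spectrum\<close>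

lemma topspace_zariski: "topspace (zariski_topology R) = {P. primeideal P R}"
proof -
  have "zariski_open R {P. primeideal P R}"
    unfolding zariski_open_def
  proof (intro exI conjI)
    show "{P. primeideal P R} = {P. primeideal P R \<and> \<not> carrier R \<subseteq> P}"
    proof -
      have "\<not> carrier R \<subseteq> P" if "primeideal P R" for P
      proof -
        interpret primeideal P R by (rule that)
        show ?thesis using I_notcarr a_subset by blast
      qed
      then show ?thesis by blast
    qed
  qed simp
  then have "{P. primeideal P R} \<subseteq> topspace (zariski_topology R)"
    by (simp add: openin_subset openin_zariski_topology)
  moreover have "openin (zariski_topology R) (topspace (zariski_topology R))" by simp
  then have "topspace (zariski_topology R) \<subseteq> {P. primeideal P R}"
    unfolding openin_zariski_topology zariski_open_def by blast
  ultimately show ?thesis by blast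
qed

definition frac_section :: "'r ring \<Rightarrow> 'r set set \<Rightarrow> 'r \<Rightarrow> 'r \<Rightarrow> 'r set \<Rightarrow> ('r \<times> 'r) set" where
  "frac_section R U a s = (\<lambda>P\<in>U. local_frac R P a s)"

lemma frac_section_carrier:
  assumes "openin (zariski_topology R) U" "a \<in> carrier R" "s \<in> carrier R" "\<And>P. P \<in> U \<Longrightarrow> s \<notin> P"
  shows "frac_section R U a s \<in> carrier (spec_sections R U)"
  unfolding spec_sections_def frac_section_def using assms by auto

lemma primeideal_if_open: "openin (zariski_topology R) U \<Longrightarrow> P \<in> U \<Longrightarrow> primeideal P R"
  using openin_subset topspace_zariski by blast

lemma spec_section_germ:
  assumes "\<sigma> \<in> carrier (spec_sections R U)" "P \<in> U"
  shows "\<exists>V a s. openin (zariski_topology R) V \<and> P \<in> V \<and> V \<subseteq> U \<and> a \<in> carrier R \<and> s \<in> carrier R \<and>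
    (\<forall>Q\<in>V. s \<notin> Q \<and> \<sigma> Q = local_frac R Q a s)"
  using assms unfolding spec_sections_def by simp

lemma spec_mult_at:
  assumes "primeideal P R" "P \<in> U" "\<sigma> P = local_frac R P a s" "\<tau> P = local_frac R P b t"
    "a \<in> carrier R" "b \<in> carrier R" "s \<in> carrier R - P" "t \<in> carrier R - P"
  shows "(\<sigma> \<otimes>\<^bsub>spec_sections R U\<^esub> \<tau>) P = local_frac R P (a \<otimes>\<^bsub>R\<^esub> b) (s \<otimes>\<^bsub>R\<^esub> t)"
proof -
  interpret prime_point P R by (intro prime_point.intro assms(1))
  show ?thesis using assms(2-4) local_frac_mult[OF assms(5-8)] by (simp add: spec_sections_def)
qed

lemma spec_add_at:
  assumes "primeideal P R" "P \<in> U" "\<sigma> P = local_frac R P a s" "\<tau> P = local_frac R P b t"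
    "a \<in> carrier R" "b \<in> carrier R" "s \<in> carrier R - P" "t \<in> carrier R - P"
  shows "(\<sigma> \<oplus>\<^bsub>spec_sections R U\<^esub> \<tau>) P =
    local_frac R P (a \<otimes>\<^bsub>R\<^esub> t \<oplus>\<^bsub>R\<^esub> b \<otimes>\<^bsub>R\<^esub> s) (s \<otimes>\<^bsub>R\<^esub> t)"
proof -
  interpret prime_point P R by (intro prime_point.intro assms(1))
  show ?thesis using assms(2-4) local_frac_add[OF assms(5-8)] by (simp add: spec_sections_def)
qed

lemma frac_section_mult:
  assumes U: "openin (zariski_topology R) U"
    and a: "a \<in> carrier R" "b \<in> carrier R" "s \<in> carrier R" "t \<in> carrier R"
      "\<And>P. P \<in> U \<Longrightarrow> s \<notin> P" "\<And>P. P \<in> U \<Longrightarrow> t \<notin> P"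
  shows "frac_section R U a s \<otimes>\<^bsub>spec_sections R U\<^esub> frac_section R U b t =
    frac_section R U (a \<otimes>\<^bsub>R\<^esub> b) (s \<otimes>\<^bsub>R\<^esub> t)"
proof
  fix P
  show "(frac_section R U a s \<otimes>\<^bsub>spec_sections R U\<^esub> frac_section R U b t) P =
    frac_section R U (a \<otimes>\<^bsub>R\<^esub> b) (s \<otimes>\<^bsub>R\<^esub> t) P"
  proof (cases "P \<in> U")
    case True
    then show ?thesis
      using a by (subst spec_mult_at[OF primeideal_if_open[OF U True] True])
        (auto simp: frac_section_def)
  next
    case False
    then show ?thesis by (simp add: frac_section_def spec_sections_def)
  qed
qed

lemma frac_section_add:
  assumes U: "openin (zariski_topology R) U"
    and a: "a \<in> carrier R" "b \<in> carrier R" "s \<in> carrier R" "t \<in> carrier R"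
      "\<And>P. P \<in> U \<Longrightarrow> s \<notin> P" "\<And>P. P \<in> U \<Longrightarrow> t \<notin> P"
  shows "frac_section R U a s \<oplus>\<^bsub>spec_sections R U\<^esub> frac_section R U b t =
    frac_section R U (a \<otimes>\<^bsub>R\<^esub> t \<oplus>\<^bsub>R\<^esub> b \<otimes>\<^bsub>R\<^esub> s) (s \<otimes>\<^bsub>R\<^esub> t)"
proof
  fix P
  show "(frac_section R U a s \<oplus>\<^bsub>spec_sections R U\<^esub> frac_section R U b t) P =
    frac_section R U (a \<otimes>\<^bsub>R\<^esub> t \<oplus>\<^bsub>R\<^esub> b \<otimes>\<^bsub>R\<^esub> s) (s \<otimes>\<^bsub>R\<^esub> t) P"
  proof (cases "P \<in> U")
    case True
    then show ?thesis
      using a by (subst spec_add_at[OF primeideal_if_open[OF U True] True])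
        (auto simp: frac_section_def)
  next
    case False
    then show ?thesis by (simp add: frac_section_def spec_sections_def)
  qed
qed

lemma frac_section_eqI:
  assumes U: "openin (zariski_topology R) U"
    and a: "a \<in> carrier R" "b \<in> carrier R" "s \<in> carrier R" "t \<in> carrier R"
      "\<And>P. P \<in> U \<Longrightarrow> s \<notin> P" "\<And>P. P \<in> U \<Longrightarrow> t \<notin> P"
    and eq: "t \<otimes>\<^bsub>R\<^esub> a = s \<otimes>\<^bsub>R\<^esub> b"
  shows "frac_section R U a s = frac_section R U b t"
proof
  fix P
  show "frac_section R U a s P = frac_section R U b t P"
  proof (cases "P \<in> U")
    case True
    interpret prime_point P R by (intro prime_point.intro primeideal_if_open[OF U True])
    have "frac_eq a s b t" unfolding frac_eq_def using eq one_notin by auto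
    then show ?thesis using True a by (simp add: frac_section_def local_frac_eq_iff)
  next
    case False
    then show ?thesis by (simp add: frac_section_def)
  qed
qed

lemma one_frac_section: "\<one>\<^bsub>spec_sections R U\<^esub> = frac_section R U \<one>\<^bsub>R\<^esub> \<one>\<^bsub>R\<^esub>"
  by (simp add: spec_sections_def frac_section_def)

lemma ringed_spaceD:
  assumes "ringed_space X"
  shows "is_open X U \<Longrightarrow> cring (sections X U)"
    "is_open X U \<Longrightarrow> is_open X V \<Longrightarrow> V \<subseteq> U \<Longrightarrow> restr X U V \<in> ring_hom (sections X U) (sections X V)"
    "is_open X U \<Longrightarrow> s \<in> carrier (sections X U) \<Longrightarrow> restr X U U s = s"
    "is_open X U \<Longrightarrow> is_open X V \<Longrightarrow> is_open X W \<Longrightarrow> W \<subseteq> V \<Longrightarrow> V \<subseteq> U \<Longrightarrow>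
      s \<in> carrier (sections X U) \<Longrightarrow> restr X V W (restr X U V s) = restr X U W s"
  subgoal using assms[unfolded ringed_space_def, THEN conjunct1] by blast
  subgoal using assms[unfolded ringed_space_def, THEN conjunct2, THEN conjunct1] by blast
  subgoal using assms[unfolded ringed_space_def, THEN conjunct2, THEN conjunct2, THEN conjunct1] by blast
  subgoal using assms[unfolded ringed_space_def, THEN conjunct2, THEN conjunct2, THEN conjunct2,
        THEN conjunct1] by blast
  done

lemma restr_closed:
  assumes "ringed_space X" "is_open X U" "is_open X V" "V \<subseteq> U" "s \<in> carrier (sections X U)"
  shows "restr X U V s \<in> carrier (sections X V)"
  using ring_hom_closed[OF ringed_spaceD(2)[OF assms(1-4)] assms(5)] .

lemma ring_hom_Units:
  assumes "h \<in> ring_hom R S" "u \<in> Units R"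
  shows "h u \<in> Units S"
proof -
  obtain v where v: "u \<in> carrier R" "v \<in> carrier R" "v \<otimes>\<^bsub>R\<^esub> u = \<one>\<^bsub>R\<^esub>" "u \<otimes>\<^bsub>R\<^esub> v = \<one>\<^bsub>R\<^esub>"
    using assms(2) unfolding Units_def by blast
  then have "h v \<otimes>\<^bsub>S\<^esub> h u = \<one>\<^bsub>S\<^esub>" "h u \<otimes>\<^bsub>S\<^esub> h v = \<one>\<^bsub>S\<^esub>"
    using assms(1) by (metis ring_hom_mult ring_hom_one)+
  then show ?thesis using v ring_hom_closed[OF assms(1)] unfolding Units_def by blast
qed

lemma vanishes_at_restr:
  assumes X: "ringed_space X" and U: "is_open X U" and V: "is_open X V" "V \<subseteq> U" "x \<in> V"
    and s: "s \<in> carrier (sections X U)"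
  shows "vanishes_at X V (restr X U V s) x \<longleftrightarrow> vanishes_at X U s x"
proof -
  have "(\<exists>W. is_open X W \<and> x \<in> W \<and> W \<subseteq> V \<and> restr X V W (restr X U V s) \<in> Units (sections X W)) \<longleftrightarrow>
    (\<exists>W. is_open X W \<and> x \<in> W \<and> W \<subseteq> U \<and> restr X U W s \<in> Units (sections X W))"
  proof
    assume "\<exists>W. is_open X W \<and> x \<in> W \<and> W \<subseteq> V \<and> restr X V W (restr X U V s) \<in> Units (sections X W)"
    then obtain W where W: "is_open X W" "x \<in> W" "W \<subseteq> V" "restr X V W (restr X U V s) \<in> Units (sections X W)"
      by blast
    moreover have "restr X V W (restr X U V s) = restr X U W s"
      by (rule ringed_spaceD(4)[OF X U V(1) W(1,3) V(2) s])
    ultimately show "\<exists>W. is_open X W \<and> x \<in> W \<and> W \<subseteq> U \<and> restr X U W s \<in> Units (sections X W)"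
      using V(2) by auto
  next
    assume "\<exists>W. is_open X W \<and> x \<in> W \<and> W \<subseteq> U \<and> restr X U W s \<in> Units (sections X W)"
    then obtain W where W: "is_open X W" "x \<in> W" "W \<subseteq> U" "restr X U W s \<in> Units (sections X W)" by blast
    define W' where "W' = W \<inter> V"
    have W': "is_open X W'" "W' \<subseteq> W" "W' \<subseteq> V" "x \<in> W'" using W V by (auto simp: W'_def)
    have "restr X W W' (restr X U W s) \<in> Units (sections X W')"
      by (rule ring_hom_Units[OF ringed_spaceD(2)[OF X W(1) W'(1,2)] W(4)])
    moreover have "restr X W W' (restr X U W s) = restr X U W' s"
      by (rule ringed_spaceD(4)[OF X U W(1) W'(1,2) W(3) s])
    moreover have "restr X V W' (restr X U V s) = restr X U W' s"
      by (rule ringed_spaceD(4)[OF X U V(1) W'(1,3) V(2) s])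
    ultimately show "\<exists>W. is_open X W \<and> x \<in> W \<and> W \<subseteq> V \<and> restr X V W (restr X U V s) \<in> Units (sections X W)"
      using W' by auto
  qed
  then show ?thesis by (simp add: vanishes_at_def)
qed

section \<open>Affine charts of a scheme\<close>

text \<open>
  An isomorphism of the open subspace \<open>U0\<close> with the spectrum of \<open>R\<close>. Germs at \<open>x\<close> are fractions
  with respect to the prime ideal \<open>h x\<close>; this local description suffices, and the ring of global
  sections of the spectrum is never computed.
\<close>

locale affine_chart =
  fixes X :: "('x, 'r) ringed_space" and U0 :: "'x set" and R :: "'r ring" (structure) and h :: "'x \<Rightarrow> 'r set"
    and \<psi> :: "'x set \<Rightarrow> 'r \<Rightarrow> ('r set \<Rightarrow> ('r \<times> 'r) set)"
  assumes X: "ringed_space X" and U0: "is_open X U0" and R: "cring R"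
    and homeo: "homeomorphic_map (subtopology (space_top X) U0) (zariski_topology R) h"
    and iso: "\<And>U. is_open X U \<Longrightarrow> U \<subseteq> U0 \<Longrightarrow> \<psi> U \<in> ring_iso (sections X U) (spec_sections R (h ` U))"
    and natural: "\<And>U V s. is_open X U \<Longrightarrow> is_open X V \<Longrightarrow> V \<subseteq> U \<Longrightarrow> U \<subseteq> U0 \<Longrightarrow>
      s \<in> carrier (sections X U) \<Longrightarrow> \<psi> V (restr X U V s) = restrict (\<psi> U s) (h ` V)"

lemma scheme_chart:
  assumes "scheme X" "x \<in> topspace (space_top X)"
  obtains U0 R h \<psi> where "affine_chart X U0 R h \<psi>" "x \<in> U0"
proof -
  obtain U0 and R :: "'b ring" where U0: "is_open X U0" "x \<in> U0" "cring R"
    "ringed_space_iso (open_subspace X U0) (Spec R)"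
    using assms unfolding scheme_def by blast
  have op: "openin (subtopology (space_top X) U0) U \<longleftrightarrow> is_open X U \<and> U \<subseteq> U0" for U
    by (rule openin_open_subtopology[OF U0(1)])
  have sec: "sections (open_subspace X U0) = sections X" "restr (open_subspace X U0) = restr X"
    "space_top (open_subspace X U0) = subtopology (space_top X) U0"
    by (simp_all add: open_subspace_def)
  have spec: "space_top (Spec R) = zariski_topology R" "sections (Spec R) = spec_sections R"
    "restr (Spec R) = (\<lambda>U V \<sigma>. restrict \<sigma> V)"
    by (simp_all add: Spec_def)
  from U0(4)[unfolded ringed_space_iso_def sec spec op]
  obtain h \<psi> where h: "homeomorphic_map (subtopology (space_top X) U0) (zariski_topology R) h"
    and iso: "\<forall>U. is_open X U \<and> U \<subseteq> U0 \<longrightarrow> \<psi> U \<in> ring_iso (sections X U) (spec_sections R (h ` U))"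
    and nat: "\<forall>U V. (is_open X U \<and> U \<subseteq> U0) \<and> (is_open X V \<and> V \<subseteq> U0) \<and> V \<subseteq> U \<longrightarrow>
      (\<forall>s\<in>carrier (sections X U). \<psi> V (restr X U V s) = restrict (\<psi> U s) (h ` V))"
    by (elim exE conjE)
  have "affine_chart X U0 R h \<psi>"
  proof (rule affine_chart.intro)
    show "ringed_space X" using assms(1) by (simp add: scheme_def)
    fix U V s
    assume "is_open X U" "is_open X V" "V \<subseteq> U" "U \<subseteq> U0" "s \<in> carrier (sections X U)"
    then show "\<psi> V (restr X U V s) = restrict (\<psi> U s) (h ` V)" using nat by (meson order_trans)
  qed (use U0 h iso in auto)
  then show thesis using U0(2) that by blast
qed

context affine_chart
begin

lemma inj_h: "inj_on h U0"
  using homeo homeomorphic_imp_injective_map openin_subset[OF U0]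
  by (metis topspace_subtopology_subset)

lemma image_h: "h ` U0 = {P. primeideal P R}"
  using homeomorphic_imp_surjective_map[OF homeo] openin_subset[OF U0] topspace_zariski
  by (metis topspace_subtopology_subset)

lemma prime_h: "x \<in> U0 \<Longrightarrow> primeideal (h x) R"
  using image_h by blast

lemma open_image: "is_open X U \<Longrightarrow> U \<subseteq> U0 \<Longrightarrow> openin (zariski_topology R) (h ` U)"
  using homeomorphic_imp_open_map[OF homeo] openin_open_subtopology[OF U0]
  by (simp add: open_map_def)

lemma open_preimage:
  assumes "openin (zariski_topology R) W"
  shows "is_open X {x \<in> U0. h x \<in> W}" "h ` {x \<in> U0. h x \<in> W} = W"
proof -
  have "openin (subtopology (space_top X) U0) {x \<in> topspace (subtopology (space_top X) U0). h x \<in> W}"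
    using homeomorphic_imp_continuous_map[OF homeo] assms by (simp add: continuous_map_def)
  moreover have "{x \<in> topspace (subtopology (space_top X) U0). h x \<in> W} = {x \<in> U0. h x \<in> W}"
    using openin_subset[OF U0] by auto
  ultimately show "is_open X {x \<in> U0. h x \<in> W}"
    using openin_open_subtopology[OF U0] by simp
  have "W \<subseteq> h ` U0" using openin_subset[OF assms] topspace_zariski image_h by blast
  then show "h ` {x \<in> U0. h x \<in> W} = W" by auto
qed

lemma germ:
  assumes "is_open X V" "V \<subseteq> U0" "x \<in> V" "s \<in> carrier (sections X V)"
  obtains a t where "a \<in> carrier R" "t \<in> carrier R - h x" "\<psi> V s (h x) = local_frac R (h x) a t"
proof -
  have "\<psi> V s \<in> carrier (spec_sections R (h ` V))"
    using iso[OF assms(1,2)] assms(4) by (auto simp: ring_iso_def ring_hom_closed)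
  moreover have "h x \<in> h ` V" using assms(3) by blast
  ultimately obtain V' a t where V': "openin (zariski_topology R) V'" "h x \<in> V'" "V' \<subseteq> h ` V" "a \<in> carrier R" "t \<in> carrier R"
    "\<forall>Q\<in>V'. t \<notin> Q \<and> \<psi> V s Q = local_frac R Q a t"
    using spec_section_germ by metis
  show thesis by (rule that[of a t]) (use V' in auto)
qed

lemma section_of:
  assumes "is_open X V" "V \<subseteq> U0" "\<sigma> \<in> carrier (spec_sections R (h ` V))"
  obtains s where "s \<in> carrier (sections X V)" "\<psi> V s = \<sigma>"
proof -
  have "\<psi> V ` carrier (sections X V) = carrier (spec_sections R (h ` V))"
    using iso[OF assms(1,2)] by (simp add: ring_iso_def bij_betw_def)
  then obtain s where "s \<in> carrier (sections X V)" "\<sigma> = \<psi> V s" using assms(3) by (metis imageE)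
  then show thesis using that by simp
qed

lemma \<psi>_inject:
  assumes "is_open X V" "V \<subseteq> U0" "s \<in> carrier (sections X V)" "t \<in> carrier (sections X V)" "\<psi> V s = \<psi> V t"
  shows "s = t"
proof -
  have "inj_on (\<psi> V) (carrier (sections X V))"
    using iso[OF assms(1,2)] by (simp add: ring_iso_def bij_betw_def)
  then show ?thesis using assms(3-5) by (simp add: inj_onD)
qed

lemma \<psi>_hom:
  assumes "is_open X V" "V \<subseteq> U0"
  shows "\<psi> V \<in> ring_hom (sections X V) (spec_sections R (h ` V))"
  using iso[OF assms] by (simp add: ring_iso_def)

text \<open>
  A germ \<open>a / t\<close> is a unit exactly if \<open>a\<close> lies outside the prime. If so, the section equals some \<open>a' / s'\<close>
  near the point, and \<open>s' / a'\<close> is an inverse where \<open>a'\<close> does not vanish. If not,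
  an inverse \<open>b / t'\<close> would give \<open>u * a * b = u * t * t'\<close> with only the left-hand side in the prime.
\<close>

lemma vanishes_iff:
  assumes V: "is_open X V" "V \<subseteq> U0" "x \<in> V" and s: "s \<in> carrier (sections X V)"
    and a: "a \<in> carrier R" "t \<in> carrier R - h x" "\<psi> V s (h x) = local_frac R (h x) a t"
  shows "vanishes_at X V s x \<longleftrightarrow> a \<in> h x"
proof -
  interpret P: prime_point "h x" R by (intro prime_point.intro prime_h) (use V in blast)
  show ?thesis
  proof
    assume v: "vanishes_at X V s x"
    show "a \<in> h x"
    proof (rule ccontr)
      assume na: "a \<notin> h x"
      have "\<psi> V s \<in> carrier (spec_sections R (h ` V))"
        by (rule ring_hom_closed[OF \<psi>_hom[OF V(1,2)] s])
      moreover have "h x \<in> h ` V" using V(3) by blast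
      ultimately obtain V' a' s' where V': "openin (zariski_topology R) V'" "h x \<in> V'" "V' \<subseteq> h ` V"
        "a' \<in> carrier R" "s' \<in> carrier R"
        "\<forall>Q\<in>V'. s' \<notin> Q \<and> \<psi> V s Q = local_frac R Q a' s'"
        using spec_section_germ by metis
      have "local_frac R (h x) a' s' = local_frac R (h x) a t" using V'(2,6) a(3) by simp
      then have "P.frac_eq a' s' a t"
        using V'(2,4,5,6) a by (subst (asm) P.local_frac_eq_iff) auto
      then obtain u where u: "u \<in> carrier R - h x" "u \<otimes> (t \<otimes> a') = u \<otimes> (s' \<otimes> a)"
        unfolding P.frac_eq_def by blast
      have "u \<otimes> (s' \<otimes> a) \<in> carrier R - h x"
        using u(1) V'(2,5,6) a(1) na by (intro P.mult_notin) auto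
      then have na': "a' \<notin> h x" using u a(2) V'(4) P.I_l_closed by (metis DiffD1 DiffD2)
      (* The inverse s' / a' exists on the part of V' where a' does not vanish. *)
      define W' where "W' = V' \<inter> {Q. primeideal Q R \<and> \<not> {a'} \<subseteq> Q}"
      have W': "openin (zariski_topology R) W'"
        unfolding W'_def using V'(1,4)
        by (intro openin_Int) (auto simp: openin_zariski_topology zariski_open_def)
      have xW': "h x \<in> W'" using V'(2) na' P.primeideal by (simp add: W'_def)
      define W where "W = {y \<in> U0. h y \<in> W'}"
      have W: "is_open X W" "h ` W = W'" unfolding W_def by (rule open_preimage[OF W'])+
      have xW: "x \<in> W" using xW' V by (auto simp: W_def)
      have WU0: "W \<subseteq> U0" by (auto simp: W_def)
      have WV: "W \<subseteq> V"
      proof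
        fix y assume "y \<in> W"
        then have "y \<in> U0" "h y \<in> h ` V" using V'(3) by (auto simp: W_def W'_def)
        then show "y \<in> V" using inj_h V(2) by (auto simp: inj_on_def)
      qed
      have nota: "a' \<notin> Q" "s' \<notin> Q" if "Q \<in> W'" for Q using that V'(6) by (auto simp: W'_def)
      obtain w where w: "w \<in> carrier (sections X W)" "\<psi> W w = frac_section R W' s' a'"
        using section_of[OF W(1) WU0] frac_section_carrier[OF W' V'(5,4)] nota W(2) by metis
      let ?s = "restr X V W s"
      have sW: "?s \<in> carrier (sections X W)" by (rule restr_closed[OF X V(1) W(1) WV s])
      have "\<psi> W ?s = frac_section R W' a' s'"
        unfolding natural[OF V(1) W(1) WV V(2) s] W(2) frac_section_def
        by (rule restrict_ext) (use V'(6) in \<open>auto simp: W'_def\<close>)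
      then have "\<psi> W (?s \<otimes>\<^bsub>sections X W\<^esub> w) = frac_section R W' (a' \<otimes> s') (s' \<otimes> a')"
        using frac_section_mult[OF W' V'(4,5,5,4)] nota ring_hom_mult[OF \<psi>_hom[OF W(1) WU0] sW w(1)]
        by (simp add: w(2) W(2))
      also have "\<dots> = frac_section R W' \<one> \<one>"
      proof (rule frac_section_eqI[OF W'])
        fix Q assume Q: "Q \<in> W'"
        interpret Q: prime_point Q R by (intro prime_point.intro primeideal_if_open[OF W' Q])
        show "s' \<otimes> a' \<notin> Q" using Q.mult_notin[of s' a'] nota[OF Q] V'(4,5) by blast
        show "\<one> \<notin> Q" using Q.one_notin by blast
      qed (use V'(4,5) in \<open>auto simp: P.m_comm\<close>)
      also have "\<dots> = \<psi> W \<one>\<^bsub>sections X W\<^esub>"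
        using ring_hom_one[OF \<psi>_hom[OF W(1) WU0]] by (simp add: one_frac_section W(2))
      finally have eq: "\<psi> W (?s \<otimes>\<^bsub>sections X W\<^esub> w) = \<psi> W \<one>\<^bsub>sections X W\<^esub>" .
      interpret XW: cring "sections X W" by (rule ringed_spaceD(1)[OF X W(1)])
      have "?s \<otimes>\<^bsub>sections X W\<^esub> w = \<one>\<^bsub>sections X W\<^esub>"
        by (rule \<psi>_inject[OF W(1) WU0 _ _ eq]) (use sW w(1) in auto)
      then have "?s \<in> Units (sections X W)"
        using sW w(1) XW.m_comm[OF sW w(1)] unfolding Units_def by auto
      then show False using v W(1) xW WV unfolding vanishes_at_def by blast
    qed
  next
    assume aP: "a \<in> h x"
    show "vanishes_at X V s x"
      unfolding vanishes_at_def
    proof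
      assume "\<exists>W. is_open X W \<and> x \<in> W \<and> W \<subseteq> V \<and> restr X V W s \<in> Units (sections X W)"
      then obtain W where W: "is_open X W" "x \<in> W" "W \<subseteq> V" "restr X V W s \<in> Units (sections X W)" by blast
      then obtain w where w: "w \<in> carrier (sections X W)"
        "restr X V W s \<otimes>\<^bsub>sections X W\<^esub> w = \<one>\<^bsub>sections X W\<^esub>" unfolding Units_def by blast
      have WU0: "W \<subseteq> U0" using W(3) V(2) by blast
      obtain b t' where b: "b \<in> carrier R" "t' \<in> carrier R - h x" "\<psi> W w (h x) = local_frac R (h x) b t'"
        using germ[OF W(1) WU0 W(2) w(1)] .
      have sW: "restr X V W s \<in> carrier (sections X W)" by (rule restr_closed[OF X V(1) W(1,3) s])
      have sx: "\<psi> W (restr X V W s) (h x) = local_frac R (h x) a t"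
        using natural[OF V(1) W(1,3) V(2) s] W(2) a(3) by simp
      have hxW: "h x \<in> h ` W" using W(2) by blast
      have "\<psi> W (restr X V W s \<otimes>\<^bsub>sections X W\<^esub> w) (h x) =
          local_frac R (h x) (a \<otimes> b) (t \<otimes> t')"
        unfolding ring_hom_mult[OF \<psi>_hom[OF W(1) WU0] sW w(1)]
        by (rule spec_mult_at; fact P.primeideal hxW sx b(3) a(1) b(1) a(2) b(2))
      moreover have "\<psi> W \<one>\<^bsub>sections X W\<^esub> (h x) = local_frac R (h x) \<one> \<one>"
        unfolding ring_hom_one[OF \<psi>_hom[OF W(1) WU0]] using hxW by (simp add: one_frac_section frac_section_def)
      ultimately have "local_frac R (h x) (a \<otimes> b) (t \<otimes> t') = local_frac R (h x) \<one> \<one>"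
        using w(2) by simp
      moreover have tt: "t \<otimes> t' \<in> carrier R - h x" by (rule P.mult_notin[OF a(2) b(2)])
      ultimately have "P.frac_eq (a \<otimes> b) (t \<otimes> t') \<one> \<one>"
        using a(1) b(1) P.one_notin by (subst (asm) P.local_frac_eq_iff) auto
      then obtain u where u: "u \<in> carrier R - h x"
        "u \<otimes> (\<one> \<otimes> (a \<otimes> b)) = u \<otimes> (t \<otimes> t' \<otimes> \<one>)"
        unfolding P.frac_eq_def by blast
      have "u \<otimes> (\<one> \<otimes> (a \<otimes> b)) \<in> h x"
        using aP a(1) b(1) u(1) by (intro P.I_l_closed P.I_r_closed) auto
      moreover have "u \<otimes> (t \<otimes> t' \<otimes> \<one>) \<in> carrier R - h x"
        by (rule P.mult_notin[OF u(1) P.mult_notin[OF tt P.one_notin]])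
      ultimately show False using u(2) by simp
    qed
  qed
qed

lemma vanishing_closed:
  assumes V: "is_open X V" "V \<subseteq> U0" "x \<in> V"
    and s: "s \<in> carrier (sections X V)" "s' \<in> carrier (sections X V)"
  shows "vanishes_at X V s x \<Longrightarrow> vanishes_at X V s' x \<Longrightarrow> vanishes_at X V (s \<oplus>\<^bsub>sections X V\<^esub> s') x"
    and "vanishes_at X V s x \<Longrightarrow> vanishes_at X V (s' \<otimes>\<^bsub>sections X V\<^esub> s) x"
    and "vanishes_at X V \<zero>\<^bsub>sections X V\<^esub> x"
proof -
  interpret P: prime_point "h x" R by (intro prime_point.intro prime_h) (use V in blast)
  interpret XV: cring "sections X V" by (rule ringed_spaceD(1)[OF X V(1)])
  have hx: "h x \<in> h ` V" using V(3) by blast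
  obtain a t where a: "a \<in> carrier R" "t \<in> carrier R - h x" "\<psi> V s (h x) = local_frac R (h x) a t"
    using germ[OF V s(1)] .
  obtain b u where b: "b \<in> carrier R" "u \<in> carrier R - h x" "\<psi> V s' (h x) = local_frac R (h x) b u"
    using germ[OF V s(2)] .
  note iff = vanishes_iff[OF V s(1) a] vanishes_iff[OF V s(2) b]
  have tu: "t \<otimes> u \<in> carrier R - h x" by (rule P.mult_notin[OF a(2) b(2)])
  have ut: "u \<otimes> t \<in> carrier R - h x" by (rule P.mult_notin[OF b(2) a(2)])
  have "\<psi> V (s \<oplus>\<^bsub>sections X V\<^esub> s') (h x) =
      local_frac R (h x) (a \<otimes> u \<oplus> b \<otimes> t) (t \<otimes> u)"
    unfolding ring_hom_add[OF \<psi>_hom[OF V(1,2)] s]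
    by (rule spec_add_at; fact P.primeideal hx a(3) b(3) a(1) b(1) a(2) b(2))
  from vanishes_iff[OF V _ _ tu this] s a b
  have add: "vanishes_at X V (s \<oplus>\<^bsub>sections X V\<^esub> s') x \<longleftrightarrow> a \<otimes> u \<oplus> b \<otimes> t \<in> h x"
    by auto
  have "\<psi> V (s' \<otimes>\<^bsub>sections X V\<^esub> s) (h x) = local_frac R (h x) (b \<otimes> a) (u \<otimes> t)"
    unfolding ring_hom_mult[OF \<psi>_hom[OF V(1,2)] s(2,1)]
    by (rule spec_mult_at; fact P.primeideal hx b(3) a(3) b(1) a(1) b(2) a(2))
  from vanishes_iff[OF V _ _ ut this] s a b
  have mult: "vanishes_at X V (s' \<otimes>\<^bsub>sections X V\<^esub> s) x \<longleftrightarrow> b \<otimes> a \<in> h x" by auto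
  show "vanishes_at X V s x \<Longrightarrow> vanishes_at X V s' x \<Longrightarrow> vanishes_at X V (s \<oplus>\<^bsub>sections X V\<^esub> s') x"
    unfolding add iff using a b
    by (intro additive_subgroup.a_closed[OF P.is_additive_subgroup] P.I_r_closed) auto
  show "vanishes_at X V s x \<Longrightarrow> vanishes_at X V (s' \<otimes>\<^bsub>sections X V\<^esub> s) x"
    unfolding mult iff using b by (intro P.I_l_closed) auto
  obtain c v where c: "c \<in> carrier R" "v \<in> carrier R - h x"
    "\<psi> V \<zero>\<^bsub>sections X V\<^esub> (h x) = local_frac R (h x) c v"
    using germ[OF V XV.zero_closed] .
  (* The zero section may a priori have any germ c / v; comparing 0 + 1 with 1 shows that c is
     killed by an element outside the prime. *)
  have one: "\<psi> V \<one>\<^bsub>sections X V\<^esub> (h x) = local_frac R (h x) \<one> \<one>"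
    unfolding ring_hom_one[OF \<psi>_hom[OF V(1,2)]] using hx by (simp add: one_frac_section frac_section_def)
  have v1: "v \<otimes> \<one> \<in> carrier R - h x" by (rule P.mult_notin[OF c(2) P.one_notin])
  have "\<psi> V (\<zero>\<^bsub>sections X V\<^esub> \<oplus>\<^bsub>sections X V\<^esub> \<one>\<^bsub>sections X V\<^esub>) (h x) =
      local_frac R (h x) (c \<otimes> \<one> \<oplus> \<one> \<otimes> v) (v \<otimes> \<one>)"
    unfolding ring_hom_add[OF \<psi>_hom[OF V(1,2)] XV.zero_closed XV.one_closed]
    by (rule spec_add_at; fact P.primeideal hx c(3) one c(1) P.one_closed c(2) P.one_notin)
  then have "local_frac R (h x) (c \<otimes> \<one> \<oplus> \<one> \<otimes> v) (v \<otimes> \<one>) =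
      local_frac R (h x) \<one> \<one>"
    using one by simp
  then have "P.frac_eq (c \<otimes> \<one> \<oplus> \<one> \<otimes> v) (v \<otimes> \<one>) \<one> \<one>"
    using c v1 P.one_notin by (subst (asm) P.local_frac_eq_iff) auto
  then obtain w where w: "w \<in> carrier R - h x" "w \<otimes> (c \<oplus> v) = w \<otimes> v"
    using c unfolding P.frac_eq_def by auto
  have "w \<otimes> c \<oplus> w \<otimes> v = \<zero> \<oplus> w \<otimes> v" using w c by (simp add: P.r_distr)
  then have "w \<otimes> c = \<zero>" using w c by (subst (asm) P.add.right_cancel) auto
  then have "w \<otimes> c \<in> h x" using additive_subgroup.zero_closed[OF P.is_additive_subgroup] by simp
  then have "c \<in> h x" using P.I_prime[of w c] w(1) c(1) by blast
  then show "vanishes_at X V \<zero>\<^bsub>sections X V\<^esub> x"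
    using vanishes_iff[OF V XV.zero_closed c] by simp
qed

end

section \<open>Intersections of split subvarieties of a scheme\<close>

text \<open>
  The sections vanishing at one point form an ideal because the stalk there is local, which is checked
  in a chart.
\<close>

lemma ideal_sheaf_ideal:
  assumes X: "scheme X" and V: "is_open X V"
  shows "ideal (ideal_sheaf X Z V) (sections X V)"
proof -
  have rs: "ringed_space X" using X by (simp add: scheme_def)
  interpret XV: cring "sections X V" by (rule ringed_spaceD(1)[OF rs V])
  have local: "(vanishes_at X V s x \<longrightarrow> vanishes_at X V s' x \<longrightarrow> vanishes_at X V (s \<oplus>\<^bsub>sections X V\<^esub> s') x) \<and>
      (vanishes_at X V s x \<longrightarrow> vanishes_at X V (s' \<otimes>\<^bsub>sections X V\<^esub> s) x) \<and>
      vanishes_at X V \<zero>\<^bsub>sections X V\<^esub> x"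
    if x: "x \<in> V" and s: "s \<in> carrier (sections X V)" "s' \<in> carrier (sections X V)" for x s s'
  proof -
    have "x \<in> topspace (space_top X)" using V x openin_subset by blast
    then obtain U0 and R :: "'b ring" and h \<psi> where chart: "affine_chart X U0 R h \<psi>" and xU0: "x \<in> U0"
      using scheme_chart[OF X] by metis
    interpret affine_chart X U0 R h \<psi> by (rule chart)
    define W where "W = V \<inter> U0"
    have W: "is_open X W" "W \<subseteq> V" "W \<subseteq> U0" "x \<in> W" using V U0 x xU0 by (auto simp: W_def)
    have hom: "restr X V W \<in> ring_hom (sections X V) (sections X W)"
      by (rule ringed_spaceD(2)[OF rs V W(1,2)])
    interpret XW: cring "sections X W" by (rule ringed_spaceD(1)[OF rs W(1)])
    interpret hom: ring_hom_ring "sections X V" "sections X W" "restr X V W"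
      by (intro ring_hom_ringI2 XV.ring_axioms XW.ring_axioms hom)
    note r = restr_closed[OF rs V W(1,2)]
    note iff = vanishes_at_restr[OF rs V W(1,2,4)]
    note closed = vanishing_closed[OF W(1,3,4) r[OF s(1)] r[OF s(2)]]
    have "vanishes_at X V (s \<oplus>\<^bsub>sections X V\<^esub> s') x" if "vanishes_at X V s x" "vanishes_at X V s' x"
      using closed(1) that s unfolding iff[OF s(1), symmetric] iff[OF s(2), symmetric]
        iff[OF XV.a_closed[OF s], symmetric] by simp
    moreover have "vanishes_at X V (s' \<otimes>\<^bsub>sections X V\<^esub> s) x" if "vanishes_at X V s x"
      using closed(2) that s unfolding iff[OF s(1), symmetric]
        iff[OF XV.m_closed[OF s(2,1)], symmetric] by simp
    moreover have "vanishes_at X V \<zero>\<^bsub>sections X V\<^esub> x"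
      using closed(3) unfolding iff[OF XV.zero_closed, symmetric] by simp
    ultimately show ?thesis by blast
  qed
  show ?thesis
  proof (rule XV.ideal_cringI)
    show "\<zero>\<^bsub>sections X V\<^esub> \<in> ideal_sheaf X Z V"
      using local[OF _ XV.zero_closed XV.zero_closed] by (auto simp: ideal_sheaf_def)
  next
    fix a b assume "a \<in> ideal_sheaf X Z V" "b \<in> ideal_sheaf X Z V"
    then show "a \<oplus>\<^bsub>sections X V\<^esub> b \<in> ideal_sheaf X Z V"
      using local[of _ a b] by (auto simp: ideal_sheaf_def)
  next
    fix a x assume "a \<in> ideal_sheaf X Z V" "x \<in> carrier (sections X V)"
    then show "x \<otimes>\<^bsub>sections X V\<^esub> a \<in> ideal_sheaf X Z V"
      using local[of _ a x] by (auto simp: ideal_sheaf_def)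
  qed (auto simp: ideal_sheaf_def)
qed

text \<open>
  Near \<open>x\<close> write \<open>s = a / t\<close> on the basic open set \<open>W\<close> where \<open>e\<close> does not vanish. Let \<open>F Z\<close> cut out
  \<open>Z\<close> in the chart. A prime that contains all \<open>F Z\<close> but not \<open>e\<close> is a point of \<open>W\<close> on the
  intersection, so \<open>s\<close> vanishes there and the prime contains \<open>a\<close>. Thus \<open>e * a\<close> lies in every prime
  containing the \<open>F Z\<close>, and a power of it in the ideal they generate. Elements of \<open>F Z\<close> become sections
  of the ideal sheaf of \<open>Z\<close> over \<open>W\<close>, where \<open>s\<close> is a multiple of \<open>e * a\<close>.
\<close>

lemma (in affine_chart) local_power_in_sum:
  assumes closed: "\<And>Z. Z \<in> \<Z> \<Longrightarrow> closedin (space_top X) Z"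
    and Y: "topspace (space_top X) \<inter> \<Inter>\<Z> \<subseteq> Y"
    and U: "is_open X U" "x \<in> U" "x \<in> U0" and s: "s \<in> ideal_sheaf X Y U"
    and ideals: "\<And>Z W. is_open X W \<Longrightarrow> ideal (ideal_sheaf X Z W) (sections X W)"
  shows "\<exists>W. is_open X W \<and> x \<in> W \<and> W \<subseteq> U \<and> (\<exists>N::nat.
    restr X U W s [^]\<^bsub>sections X W\<^esub> N \<in> Idl\<^bsub>sections X W\<^esub> (\<Union>Z\<in>\<Z>. ideal_sheaf X Z W))"
proof -
  interpret R: cring R by (rule R)
  define V0 where "V0 = U \<inter> U0"
  have V0: "is_open X V0" "V0 \<subseteq> U" "V0 \<subseteq> U0" "x \<in> V0" using U U0 by (auto simp: V0_def)
  have sU: "s \<in> carrier (sections X U)" using s by (simp add: ideal_sheaf_def)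
  define s0 where "s0 = restr X U V0 s"
  have s0: "s0 \<in> carrier (sections X V0)" unfolding s0_def by (rule restr_closed[OF X U(1) V0(1,2) sU])
  have "\<psi> V0 s0 \<in> carrier (spec_sections R (h ` V0))"
    by (rule ring_hom_closed[OF \<psi>_hom[OF V0(1,3)] s0])
  moreover have "h x \<in> h ` V0" using V0(4) by blast
  ultimately obtain V' a t where V': "openin (zariski_topology R) V'" "h x \<in> V'" "V' \<subseteq> h ` V0"
    and at: "a \<in> carrier R" "t \<in> carrier R" "\<forall>Q\<in>V'. t \<notin> Q \<and> \<psi> V0 s0 Q = local_frac R Q a t"
    using spec_section_germ by metis
  obtain E where E: "E \<subseteq> carrier R" "V' = {Q. primeideal Q R \<and> \<not> E \<subseteq> Q}"
    using V'(1) unfolding openin_zariski_topology zariski_open_def by blast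
  obtain e where e: "e \<in> E" "e \<notin> h x" using V'(2) E(2) by blast
  have eR: "e \<in> carrier R" using e(1) E(1) by blast
  define W' where "W' = {Q. primeideal Q R \<and> \<not> {e} \<subseteq> Q}"
  have W'open: "openin (zariski_topology R) W'"
    unfolding W'_def openin_zariski_topology zariski_open_def using eR by blast
  have W'V': "W' \<subseteq> V'" using e(1) by (auto simp: W'_def E(2))
  define W where "W = {y \<in> U0. h y \<in> W'}"
  have W: "is_open X W" "h ` W = W'" unfolding W_def by (rule open_preimage[OF W'open])+
  have WU0: "W \<subseteq> U0" by (auto simp: W_def)
  have xW: "x \<in> W" using e(2) U(3) prime_h by (auto simp: W_def W'_def)
  have WV0: "W \<subseteq> V0"
  proof
    fix y assume "y \<in> W"
    then have "y \<in> U0" "h y \<in> h ` V0" using V'(3) W'V' by (auto simp: W_def)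
    then show "y \<in> V0" using inj_h V0(3) by (auto simp: inj_on_def)
  qed
  have WU: "W \<subseteq> U" using WV0 V0(2) by blast
  have "\<exists>F\<subseteq>carrier R. \<forall>y\<in>U0. y \<in> Z \<longleftrightarrow> F \<subseteq> h y" if "Z \<in> \<Z>" for Z
  proof -
    have "is_open X (U0 - Z)" using U0 closed[OF that] by (rule openin_diff)
    then have "openin (zariski_topology R) (h ` (U0 - Z))" by (intro open_image) auto
    then obtain F where F: "F \<subseteq> carrier R" "h ` (U0 - Z) = {Q. primeideal Q R \<and> \<not> F \<subseteq> Q}"
      unfolding openin_zariski_topology zariski_open_def by blast
    have "y \<in> Z \<longleftrightarrow> F \<subseteq> h y" if y: "y \<in> U0" for y
    proof -
      have "h y \<in> h ` (U0 - Z) \<longleftrightarrow> y \<notin> Z" using inj_h y by (auto simp: inj_on_def)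
      then show ?thesis using prime_h[OF y] unfolding F(2) by blast
    qed
    then show ?thesis using F(1) by blast
  qed
  then obtain F where F: "\<And>Z. Z \<in> \<Z> \<Longrightarrow> F Z \<subseteq> carrier R"
    "\<And>Z y. Z \<in> \<Z> \<Longrightarrow> y \<in> U0 \<Longrightarrow> y \<in> Z \<longleftrightarrow> F Z \<subseteq> h y" by metis
  let ?I = "Idl (\<Union>Z\<in>\<Z>. F Z)"
  have Fc: "(\<Union>Z\<in>\<Z>. F Z) \<subseteq> carrier R" using F(1) by blast
  have ea: "e \<otimes> a \<in> carrier R" using eR at(1) by simp
  have "\<exists>N::nat. (e \<otimes> a) [^] N \<in> ?I"
  proof (rule ccontr)
    assume "\<nexists>N::nat. (e \<otimes> a) [^] N \<in> ?I"
    then have "\<exists>Q. primeideal Q R \<and> ?I \<subseteq> Q \<and> e \<otimes> a \<notin> Q"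
      by (intro R.prime_ideal_avoiding_powers R.genideal_ideal Fc ea) auto
    then obtain Q where Q: "primeideal Q R" "?I \<subseteq> Q" "e \<otimes> a \<notin> Q" by blast
    interpret Q: primeideal Q R by (rule Q(1))
    have eQ: "e \<notin> Q" using Q(3) at(1) Q.I_r_closed by blast
    have aQ: "a \<notin> Q" using Q(3) eR Q.I_l_closed by blast
    have "Q \<in> W'" using Q(1) eQ by (simp add: W'_def)
    then obtain y where y: "y \<in> W" "h y = Q" using W(2) by blast
    have yU0: "y \<in> U0" using y(1) WU0 by blast
    have "y \<in> Z" if "Z \<in> \<Z>" for Z
    proof -
      have "F Z \<subseteq> h y" using that Q(2) R.genideal_self[OF Fc] y(2) by blast
      then show ?thesis using F(2)[OF that yU0] by blast
    qed
    moreover have "y \<in> topspace (space_top X)" using yU0 openin_subset[OF U0] by blast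
    ultimately have "y \<in> Y" using Y by blast
    moreover have yV0: "y \<in> V0" using y(1) WV0 by blast
    ultimately have "vanishes_at X U s y" using s V0(2) by (auto simp: ideal_sheaf_def)
    then have "vanishes_at X V0 s0 y"
      unfolding s0_def using vanishes_at_restr[OF X U(1) V0(1,2) yV0 sU] by simp
    moreover have "\<psi> V0 s0 (h y) = local_frac R (h y) a t" "t \<in> carrier R - h y"
      using at \<open>Q \<in> W'\<close> W'V' y(2) by auto
    ultimately have "a \<in> h y" using vanishes_iff[OF V0(1,3) yV0 s0 at(1)] by blast
    then show False using aQ y(2) by simp
  qed
  then obtain N :: nat where N: "(e \<otimes> a) [^] N \<in> ?I" by blast
  interpret XW: cring "sections X W" by (rule ringed_spaceD(1)[OF X W(1)])
  have one_notin: "\<one> \<notin> Q" and e_notin: "e \<notin> Q" and t_notin: "t \<notin> Q"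
    and et_notin: "e \<otimes> t \<notin> Q" if "Q \<in> W'" for Q
  proof -
    interpret Q: prime_point Q R using that by (intro prime_point.intro) (simp add: W'_def)
    show "\<one> \<notin> Q" using Q.one_notin by blast
    show "e \<notin> Q" using that by (simp add: W'_def)
    show "t \<notin> Q" using that at(3) W'V' by blast
    then show "e \<otimes> t \<notin> Q" using Q.mult_notin[of e t] \<open>e \<notin> Q\<close> eR at(2) by blast
  qed
  (* The ring homomorphism from R to the sections over W, r being sent to r / 1. *)
  have "\<forall>r\<in>carrier R. \<exists>c\<in>carrier (sections X W). \<psi> W c = frac_section R W' r \<one>"
    using section_of[OF W(1) WU0] frac_section_carrier[OF W'open _ R.one_closed one_notin] W(2) by metis
  then obtain \<rho> where \<rho>: "\<And>r. r \<in> carrier R \<Longrightarrow> \<rho> r \<in> carrier (sections X W)"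
    "\<And>r. r \<in> carrier R \<Longrightarrow> \<psi> W (\<rho> r) = frac_section R W' r \<one>" by metis
  note hom = \<psi>_hom[OF W(1) WU0]
  note inj = \<psi>_inject[OF W(1) WU0]
  have \<rho>_mult: "\<rho> (r \<otimes> r') = \<rho> r \<otimes>\<^bsub>sections X W\<^esub> \<rho> r'" if r: "r \<in> carrier R" "r' \<in> carrier R" for r r'
  proof (rule inj)
    have "\<psi> W (\<rho> r \<otimes>\<^bsub>sections X W\<^esub> \<rho> r') = frac_section R W' (r \<otimes> r') (\<one> \<otimes> \<one>)"
      unfolding ring_hom_mult[OF hom \<rho>(1)[OF r(1)] \<rho>(1)[OF r(2)]] \<rho>(2)[OF r(1)] \<rho>(2)[OF r(2)] W(2)
      by (rule frac_section_mult[OF W'open r R.one_closed R.one_closed one_notin one_notin])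
    then show "\<psi> W (\<rho> (r \<otimes> r')) = \<psi> W (\<rho> r \<otimes>\<^bsub>sections X W\<^esub> \<rho> r')" using r by (simp add: \<rho>(2))
  qed (use r \<rho>(1) in auto)
  have \<rho>_add: "\<rho> (r \<oplus> r') = \<rho> r \<oplus>\<^bsub>sections X W\<^esub> \<rho> r'" if r: "r \<in> carrier R" "r' \<in> carrier R" for r r'
  proof (rule inj)
    have "\<psi> W (\<rho> r \<oplus>\<^bsub>sections X W\<^esub> \<rho> r') =
        frac_section R W' (r \<otimes> \<one> \<oplus> r' \<otimes> \<one>) (\<one> \<otimes> \<one>)"
      unfolding ring_hom_add[OF hom \<rho>(1)[OF r(1)] \<rho>(1)[OF r(2)]] \<rho>(2)[OF r(1)] \<rho>(2)[OF r(2)] W(2)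
      by (rule frac_section_add[OF W'open r R.one_closed R.one_closed one_notin one_notin])
    then show "\<psi> W (\<rho> (r \<oplus> r')) = \<psi> W (\<rho> r \<oplus>\<^bsub>sections X W\<^esub> \<rho> r')" using r by (simp add: \<rho>(2))
  qed (use r \<rho>(1) in auto)
  have \<rho>_one: "\<rho> \<one> = \<one>\<^bsub>sections X W\<^esub>"
    by (rule inj) (use \<rho> ring_hom_one[OF hom] in \<open>auto simp: one_frac_section W(2)\<close>)
  have \<rho>_zero: "\<rho> \<zero> = \<zero>\<^bsub>sections X W\<^esub>"
    using \<rho>_add[of "\<zero>" "\<zero>"] \<rho>(1) by (intro XW.add_idem_zero) auto
  have \<rho>_pow: "\<rho> (r [^] n) = \<rho> r [^]\<^bsub>sections X W\<^esub> n" if "r \<in> carrier R" for r and n :: nat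
    using that by (induction n) (auto simp: \<rho>_one \<rho>_mult)
  let ?J = "Idl\<^bsub>sections X W\<^esub> (\<Union>Z\<in>\<Z>. ideal_sheaf X Z W)"
  have Jc: "(\<Union>Z\<in>\<Z>. ideal_sheaf X Z W) \<subseteq> carrier (sections X W)" by (auto simp: ideal_sheaf_def)
  interpret J: ideal ?J "sections X W" by (rule XW.genideal_ideal[OF Jc])
  define K where "K = {r \<in> carrier R. \<rho> r \<in> ?J}"
  have "ideal K R"
  proof (rule R.ideal_cringI)
    fix a b assume "a \<in> K" "b \<in> K"
    then show "a \<oplus> b \<in> K"
      using additive_subgroup.a_closed[OF J.is_additive_subgroup] by (simp add: K_def \<rho>_add)
  next
    fix a x assume "a \<in> K" "x \<in> carrier R"
    then show "x \<otimes> a \<in> K" using \<rho>(1) by (simp add: K_def \<rho>_mult J.I_l_closed)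
  qed (use additive_subgroup.zero_closed[OF J.is_additive_subgroup] in \<open>auto simp: K_def \<rho>_zero\<close>)
  moreover have "(\<Union>Z\<in>\<Z>. F Z) \<subseteq> K"
  proof
    fix r assume "r \<in> (\<Union>Z\<in>\<Z>. F Z)"
    then obtain Z where Z: "Z \<in> \<Z>" "r \<in> F Z" by blast
    have r: "r \<in> carrier R" using Z F(1) by blast
    have "vanishes_at X W (\<rho> r) y" if y: "y \<in> W" "y \<in> Z" for y
    proof -
      have hy: "h y \<in> W'" using y(1) by (simp add: W_def)
      have "r \<in> h y" using F(2)[OF Z(1), of y] y WU0 Z(2) by blast
      moreover have "\<psi> W (\<rho> r) (h y) = local_frac R (h y) r \<one>"
        using hy by (simp add: \<rho>(2)[OF r] frac_section_def)
      moreover have "\<one> \<in> carrier R - h y" using one_notin[OF hy] by simp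
      ultimately show ?thesis using vanishes_iff[OF W(1) WU0 y(1) \<rho>(1)[OF r] r] by blast
    qed
    then have "\<rho> r \<in> ideal_sheaf X Z W" using \<rho>(1)[OF r] by (simp add: ideal_sheaf_def)
    then show "r \<in> K" using r Z(1) XW.genideal_self[OF Jc] by (auto simp: K_def)
  qed
  ultimately have "?I \<subseteq> K" by (rule R.genideal_minimal)
  then have \<rho>N: "\<rho> (e \<otimes> a) [^]\<^bsub>sections X W\<^esub> N \<in> ?J"
    using N ea by (auto simp: K_def \<rho>_pow)
  have et: "e \<otimes> t \<in> carrier R" using eR at(2) by simp
  (* Since a / t = 1 / (e * t) * (e * a) / 1, the section c with value 1 / (e * t) turns e * a
     into s. *)
  obtain c where c: "c \<in> carrier (sections X W)" "\<psi> W c = frac_section R W' \<one> (e \<otimes> t)"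
    using section_of[OF W(1) WU0] frac_section_carrier[OF W'open R.one_closed et et_notin] W(2) by metis
  let ?s = "restr X U W s"
  have sW: "?s \<in> carrier (sections X W)" by (rule restr_closed[OF X U(1) W(1) WU sU])
  have "?s = restr X V0 W s0" unfolding s0_def by (rule ringed_spaceD(4)[OF X U(1) V0(1) W(1) WV0 V0(2) sU, symmetric])
  then have "\<psi> W ?s = restrict (\<psi> V0 s0) (h ` W)" using natural[OF V0(1) W(1) WV0 V0(3) s0] by simp
  also have "\<dots> = frac_section R W' a t"
    unfolding frac_section_def W(2) by (rule restrict_ext) (use at(3) W'V' in blast)
  also have "\<dots> = frac_section R W' (\<one> \<otimes> (e \<otimes> a)) (e \<otimes> t \<otimes> \<one>)"
    using eR at(1,2) et_notin t_notin
    by (intro frac_section_eqI[OF W'open]) (auto simp: R.m_ac)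
  also have "\<dots> = frac_section R W' \<one> (e \<otimes> t) \<otimes>\<^bsub>spec_sections R W'\<^esub> frac_section R W' (e \<otimes> a) \<one>"
    by (rule frac_section_mult[OF W'open R.one_closed ea et R.one_closed et_notin one_notin, symmetric])
  also have "\<dots> = \<psi> W (c \<otimes>\<^bsub>sections X W\<^esub> \<rho> (e \<otimes> a))"
    unfolding ring_hom_mult[OF hom c(1) \<rho>(1)[OF ea]] c(2) \<rho>(2)[OF ea] W(2) ..
  finally have "?s = c \<otimes>\<^bsub>sections X W\<^esub> \<rho> (e \<otimes> a)"
    by (rule inj[OF sW XW.m_closed[OF c(1) \<rho>(1)[OF ea]]])
  then have "?s [^]\<^bsub>sections X W\<^esub> N = c [^]\<^bsub>sections X W\<^esub> N \<otimes>\<^bsub>sections X W\<^esub> \<rho> (e \<otimes> a) [^]\<^bsub>sections X W\<^esub> N"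
    using XW.nat_pow_distrib[OF c(1) \<rho>(1)[OF ea]] by simp
  also have "\<dots> \<in> ?J" by (rule J.I_l_closed[OF \<rho>N]) (use c(1) in simp)
  finally show ?thesis using W(1) xW WU by blast
qed

text \<open>
  The nontrivial inclusion is local: a power of \<open>s\<close> is in the sum near each point, and the sum is
  stable under the splitting of the sections there.
\<close>

theorem scheme_intersection_of_split:
  assumes p: "prime p" and X: "scheme X" and \<phi>: "scheme_splitting p X \<phi>"
    and \<Z>: "\<And>Z. Z \<in> \<Z> \<Longrightarrow> compatibly_split_subvariety X \<phi> Z"
    and Y: "Y = topspace (space_top X) \<inter> \<Inter>\<Z>"
  shows "is_scheme_intersection X Y \<Z>"
  unfolding is_scheme_intersection_def
proof (intro allI impI equalityI subsetI)
  have rs: "ringed_space X" using X by (simp add: scheme_def)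
  fix U s assume U: "is_open X U"
  {
    assume s: "s \<in> ideal_sheaf X Y U"
    have sU: "s \<in> carrier (sections X U)" using s by (simp add: ideal_sheaf_def)
    have "\<exists>V. is_open X V \<and> x \<in> V \<and> V \<subseteq> U \<and>
        restr X U V s \<in> Idl\<^bsub>sections X V\<^esub> (\<Union>Z\<in>\<Z>. ideal_sheaf X Z V)" if x: "x \<in> U" for x
    proof -
      have "x \<in> topspace (space_top X)" using U x openin_subset by blast
      then obtain U0 and R :: "'b ring" and h \<psi> where chart: "affine_chart X U0 R h \<psi>" and xU0: "x \<in> U0"
        using scheme_chart[OF X] by metis
      have "\<And>Z. Z \<in> \<Z> \<Longrightarrow> closedin (space_top X) Z"
        using \<Z> by (simp add: compatibly_split_subvariety_def subvariety_def)
      from affine_chart.local_power_in_sum[OF chart this _ U x xU0 s ideal_sheaf_ideal[OF X]] Y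
      obtain W and N :: nat where W: "is_open X W" "x \<in> W" "W \<subseteq> U" and N:
        "restr X U W s [^]\<^bsub>sections X W\<^esub> N \<in> Idl\<^bsub>sections X W\<^esub> (\<Union>Z\<in>\<Z>. ideal_sheaf X Z W)"
        by blast
      interpret XW: cring "sections X W" by (rule ringed_spaceD(1)[OF rs W(1)])
      have split: "splitting p (sections X W) (\<phi> W)" using \<phi> W(1) by (simp add: scheme_splitting_def)
      have Jc: "(\<Union>Z\<in>\<Z>. ideal_sheaf X Z W) \<subseteq> carrier (sections X W)" by (auto simp: ideal_sheaf_def)
      have "ideal (ideal_sheaf X Z W) (sections X W) \<and> \<phi> W ` ideal_sheaf X Z W \<subseteq> ideal_sheaf X Z W"
        if "Z \<in> \<Z>" for Z
        using \<Z>[OF that] W(1) ideal_sheaf_ideal[OF X W(1)]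
        by (simp add: compatibly_split_subvariety_def compatibly_split_def)
      then have "\<phi> W ` (Idl\<^bsub>sections X W\<^esub> (\<Union>Z\<in>\<Z>. ideal_sheaf X Z W)) \<subseteq>
          Idl\<^bsub>sections X W\<^esub> (\<Union>Z\<in>\<Z>. ideal_sheaf X Z W)"
        by (rule XW.Idl_frobenius_stable[OF split])
      then have "restr X U W s \<in> Idl\<^bsub>sections X W\<^esub> (\<Union>Z\<in>\<Z>. ideal_sheaf X Z W)"
        using XW.frobenius_stable_radical[OF p split XW.genideal_ideal[OF Jc] _
            restr_closed[OF rs U W(1,3) sU] N] by blast
      then show ?thesis using W by blast
    qed
    then show "s \<in> intersection_sheaf X \<Z> U" using sU by (simp add: intersection_sheaf_def)
  }
  {
    assume s: "s \<in> intersection_sheaf X \<Z> U"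
    have sU: "s \<in> carrier (sections X U)" using s by (simp add: intersection_sheaf_def)
    have "vanishes_at X U s x" if x: "x \<in> U \<inter> Y" for x
    proof -
      obtain V where V: "is_open X V" "x \<in> V" "V \<subseteq> U"
        "restr X U V s \<in> Idl\<^bsub>sections X V\<^esub> (\<Union>Z\<in>\<Z>. ideal_sheaf X Z V)"
        using s x unfolding intersection_sheaf_def by blast
      interpret XV: cring "sections X V" by (rule ringed_spaceD(1)[OF rs V(1)])
      have "(\<Union>Z\<in>\<Z>. ideal_sheaf X Z V) \<subseteq> ideal_sheaf X Y V" using Y by (auto simp: ideal_sheaf_def)
      then have "restr X U V s \<in> ideal_sheaf X Y V"
        using XV.genideal_minimal[OF ideal_sheaf_ideal[OF X V(1)]] V(4) by blast
      then have "vanishes_at X V (restr X U V s) x" using V(2) x by (simp add: ideal_sheaf_def)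
      then show ?thesis using vanishes_at_restr[OF rs U V(1,3,2) sU] by simp
    qed
    then show "s \<in> ideal_sheaf X Y U" using sU by (simp add: ideal_sheaf_def)
  }
qed

text \<open>
  The condition \<open>cover\<close> of \<open>points_of_basics\<close> for the closed sets themselves: a point of the intersection
  lies on one of its components, which belongs to the stratification.
\<close>

lemma point_on_basics:
  assumes fin: "finite \<Y>" and sub: "\<And>Y. Y \<in> \<Y> \<Longrightarrow> subvariety X Y" and strat: "stratification X \<Y>"
    and Y: "Y \<in> \<Y>" and x: "x \<in> topspace (space_top X)"
      "\<And>Z. Z \<in> basics_above (closed_set_poset \<Y>) Y \<Longrightarrow> x \<in> Z"
  shows "x \<in> Y"
proof -
  have "x \<in> (\<lambda>Z. Z) Y"
  proof (rule points_of_basics[where \<Y> = \<Y> and le = "(\<subseteq>)" and T = "topspace (space_top X)" and D = "\<lambda>Z. Z"])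
    fix y x
    assume y: "y \<in> \<Y>"
      and glb: "\<And>w. w \<in> \<Y> \<Longrightarrow> (\<And>r. r \<in> \<Y> \<Longrightarrow> y \<subseteq> r \<Longrightarrow> r \<noteq> y \<Longrightarrow> w \<subseteq> r) \<Longrightarrow> w \<subseteq> y"
      and x: "x \<in> topspace (space_top X)" "\<And>r. r \<in> \<Y> \<Longrightarrow> y \<subseteq> r \<Longrightarrow> r \<noteq> y \<Longrightarrow> x \<in> r"
    define \<Z> where "\<Z> = {r \<in> \<Y>. y \<subseteq> r \<and> r \<noteq> y}"
    define A where "A = topspace (space_top X) \<inter> \<Inter>\<Z>"
    have "\<And>Z. Z \<in> \<Z> \<Longrightarrow> closedin (space_top X) Z" using sub by (auto simp: \<Z>_def subvariety_def)
    then have "closedin (space_top X) (\<Inter>(insert (topspace (space_top X)) \<Z>))"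
      by (intro closedin_Inter) auto
    then have "closedin (space_top X) A" by (simp add: A_def)
    moreover have "x \<in> A" using x by (auto simp: A_def \<Z>_def)
    ultimately have "\<exists>W. component X A W \<and> x \<in> W" by (rule point_in_component)
    then obtain W where W: "component X A W" "x \<in> W" by blast
    have "\<Z> \<subseteq> \<Y>" by (auto simp: \<Z>_def)
    then have "W \<in> \<Y>" using strat W(1) unfolding stratification_def A_def by blast
    moreover have "W \<subseteq> A" using W(1) by (simp add: component_def)
    then have "W \<subseteq> r" if "r \<in> \<Y>" "y \<subseteq> r" "r \<noteq> y" for r using that by (auto simp: A_def \<Z>_def)
    ultimately have "W \<subseteq> y" by (rule glb)
    then show "x \<in> y" using W(2) by blast
  qed (use fin Y x in \<open>auto simp: closed_set_poset_def\<close>)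
  then show ?thesis by simp
qed

theorem split_stratification_basics:
  assumes p: "prime p" and X: "scheme X" and \<phi>: "scheme_splitting p X \<phi>" and fin: "finite \<Y>"
    and split: "\<And>Y. Y \<in> \<Y> \<Longrightarrow> compatibly_split_subvariety X \<phi> Y"
    and strat: "stratification X \<Y>" and Y: "Y \<in> \<Y>"
  shows "is_scheme_intersection X Y (basics_above (closed_set_poset \<Y>) Y)"
    and "is_scheme_intersection X Y
      (minimal_elements (closed_set_poset \<Y>) (basics_above (closed_set_poset \<Y>) Y))"
proof -
  let ?B = "basics_above (closed_set_poset \<Y>) Y"
  let ?M = "minimal_elements (closed_set_poset \<Y>) ?B"
  have B: "?B \<subseteq> \<Y>" "\<And>Z. Z \<in> ?B \<Longrightarrow> Y \<subseteq> Z"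
    by (auto simp: basics_above_def closed_set_poset_def)
  have M: "?M \<subseteq> ?B" by (auto simp: minimal_elements_def)
  have sub: "\<And>Z. Z \<in> \<Y> \<Longrightarrow> subvariety X Z" using split by (simp add: compatibly_split_subvariety_def)
  have YT: "Y \<subseteq> topspace (space_top X)"
    using sub[OF Y] closedin_subset by (auto simp: subvariety_def)
  have TB: "x \<in> Y" if "x \<in> topspace (space_top X)" "\<And>Z. Z \<in> ?B \<Longrightarrow> x \<in> Z" for x
    by (rule point_on_basics[OF fin sub strat Y that])
  have TM: "x \<in> Y" if x: "x \<in> topspace (space_top X)" "\<And>Z. Z \<in> ?M \<Longrightarrow> x \<in> Z" for x
  proof (rule TB[OF x(1)])
    fix Z assume Z: "Z \<in> ?B"
    have "x \<in> (\<lambda>Z. Z) Z"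
      by (rule points_of_minimal_basics[where \<Y> = \<Y> and le = "(\<subseteq>)" and y = Y and D = "\<lambda>Z. Z"])
        (use fin x(2) Z in \<open>auto simp: closed_set_poset_def\<close>)
    then show "x \<in> Z" by simp
  qed
  show "is_scheme_intersection X Y ?B"
    by (rule scheme_intersection_of_split[OF p X \<phi>]) (use B split YT TB in auto)
  show "is_scheme_intersection X Y ?M"
    by (rule scheme_intersection_of_split[OF p X \<phi>]) (use B M split YT TM in blast)+
qed

section \<open>Initial ideals and intersections of split subvarieties\<close>

theorem theorem6:
  fixes lam :: "'n::finite \<Rightarrow> real"
  shows
    "(\<forall>(f :: ('n, int) mpoly) (S :: nat set) (\<Y> :: ('n, rat) mpoly set set).
        total_degree f = CARD('n) \<and> init lam f = Poly_Mapping.single all_vars 1 \<and>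
        infinite S \<and> (\<forall>p\<in>S. prime p) \<and>
        (\<forall>Y\<in>\<Y>. subvariety_rat Y) \<and>
        (\<forall>Y\<in>\<Y>. \<forall>p\<in>S. compatibly_split (Tr_pow p f) (reduction p Y)) \<longrightarrow>
        (\<forall>Y\<in>\<Y>. \<exists>G. groebner_basis lam Y G \<and> (\<forall>g\<in>G. squarefree_monomial (init lam g))) \<and>
        (finite \<Y> \<and> stratification_rat \<Y> \<longrightarrow>
          (let L = subvariety_poset \<Y> in \<forall>Y\<in>\<Y>.
             Y = intersection_ideal (basics_above L Y) \<and>
             Y = intersection_ideal (minimal_elements L (basics_above L Y)) \<and>
             (\<forall>G. (\<forall>Z\<in>minimal_elements L (basics_above L Y). groebner_basis lam Z (G Z)) \<longrightarrow>
                groebner_basis lam Y (\<Union>Z\<in>minimal_elements L (basics_above L Y). G Z)))))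
     \<and>
     (\<forall>(p :: nat) (X :: ('x, 'r) ringed_space) \<phi> (\<Y> :: 'x set set).
        prime p \<and> scheme X \<and> scheme_splitting p X \<phi> \<and>
        finite \<Y> \<and> (\<forall>Y\<in>\<Y>. compatibly_split_subvariety X \<phi> Y) \<and> stratification X \<Y> \<longrightarrow>
        (let L = closed_set_poset \<Y> in \<forall>Y\<in>\<Y>.
           is_scheme_intersection X Y (basics_above L Y) \<and>
           is_scheme_intersection X Y (minimal_elements L (basics_above L Y))))
     \<and>
     (\<forall>(f :: ('n, int) mpoly) (S :: nat set) (\<Y> :: ('n, rat) mpoly set set).
        infinite S \<and> (\<forall>p\<in>S. prime p) \<and>
        (\<forall>p\<in>S. splitting p (poly_ring_mod p) (Tr_pow p f)) \<and>
        (\<forall>p\<in>S. splitting p (poly_ring_mod p) (Tr_pow p (init lam f))) \<and>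
        finite \<Y> \<and> (\<forall>Y\<in>\<Y>. subvariety_rat Y) \<and>
        (\<forall>Y\<in>\<Y>. \<forall>p\<in>S. compatibly_split (Tr_pow p f) (reduction p Y)) \<and>
        stratification_rat \<Y> \<longrightarrow>
        (let L = subvariety_poset \<Y> in \<forall>Y\<in>\<Y>.
           \<forall>G. (\<forall>Z\<in>minimal_elements L (basics_above L Y). groebner_basis lam Z (G Z)) \<longrightarrow>
              groebner_basis lam Y (\<Union>Z\<in>minimal_elements L (basics_above L Y). G Z)))"
  (is "?first \<and> ?second \<and> ?third")
proof (intro conjI)
  show ?first
  proof (intro allI impI, elim conjE)
    fix f :: "('n, int) mpoly" and S :: "nat set" and \<Y> :: "('n, rat) mpoly set set"
    assume deg: "total_degree f = CARD('n)" and f: "init lam f = Poly_Mapping.single all_vars 1"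
      and S: "infinite S" "\<forall>p\<in>S. prime p" and sub: "\<forall>Y\<in>\<Y>. subvariety_rat Y"
      and compat: "\<forall>Y\<in>\<Y>. \<forall>p\<in>S. compatibly_split (Tr_pow p f) (reduction p Y)"
    interpret split_subvarieties f S \<Y>
    proof (rule split_subvarieties.intro)
      show "frob_trace p f 1 = 1" if "p \<in> S" for p
        using frob_trace_one[OF _ f deg] S(2) that by blast
    qed (use S sub compat in blast)+
    have fw: "weight_le lam f (weight lam all_vars)" by (rule init_all_varsD(1)[OF f])
    have squarefree: "\<exists>G. groebner_basis lam Y G \<and> (\<forall>g\<in>G. squarefree_monomial (init lam g))"
      if "Y \<in> \<Y>" for Y
      using squarefree_groebner_basis[OF f S(1) _ ideal_member[OF that]] S(2) compat that by blast
    have stratified: "let L = subvariety_poset \<Y> in \<forall>Y\<in>\<Y>.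
             Y = intersection_ideal (basics_above L Y) \<and>
             Y = intersection_ideal (minimal_elements L (basics_above L Y)) \<and>
             (\<forall>G. (\<forall>Z\<in>minimal_elements L (basics_above L Y). groebner_basis lam Z (G Z)) \<longrightarrow>
                groebner_basis lam Y (\<Union>Z\<in>minimal_elements L (basics_above L Y). G Z))"
      if "finite \<Y> \<and> stratification_rat \<Y>"
      unfolding Let_def
    proof (intro ballI conjI allI impI)
      fix Y assume Y: "Y \<in> \<Y>"
      show "Y = intersection_ideal (basics_above (subvariety_poset \<Y>) Y)"
        by (rule intersection_of_basics) (use that Y in auto)
      show "Y = intersection_ideal
          (minimal_elements (subvariety_poset \<Y>) (basics_above (subvariety_poset \<Y>) Y))"
        by (rule intersection_of_minimal_basics) (use that Y in auto)
      fix G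
      assume "\<forall>Z\<in>minimal_elements (subvariety_poset \<Y>) (basics_above (subvariety_poset \<Y>) Y).
        groebner_basis lam Z (G Z)"
      then show "groebner_basis lam Y (\<Union>Z\<in>minimal_elements (subvariety_poset \<Y>)
          (basics_above (subvariety_poset \<Y>) Y). G Z)"
        by (intro groebner_basis_of_minimal_basics[OF fw]) (use that Y in auto)
    qed
    show "(\<forall>Y\<in>\<Y>. \<exists>G. groebner_basis lam Y G \<and> (\<forall>g\<in>G. squarefree_monomial (init lam g))) \<and>
        (finite \<Y> \<and> stratification_rat \<Y> \<longrightarrow>
          (let L = subvariety_poset \<Y> in \<forall>Y\<in>\<Y>.
             Y = intersection_ideal (basics_above L Y) \<and>
             Y = intersection_ideal (minimal_elements L (basics_above L Y)) \<and>
             (\<forall>G. (\<forall>Z\<in>minimal_elements L (basics_above L Y). groebner_basis lam Z (G Z)) \<longrightarrow>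
                groebner_basis lam Y (\<Union>Z\<in>minimal_elements L (basics_above L Y). G Z))))"
      using squarefree stratified by (intro conjI ballI impI)
  qed
  show ?second
  proof (intro allI impI, elim conjE)
    fix p :: nat and X :: "('x, 'r) ringed_space" and \<phi> and \<Y> :: "'x set set"
    assume *: "prime p" "scheme X" "scheme_splitting p X \<phi>" "finite \<Y>"
      "\<forall>Y\<in>\<Y>. compatibly_split_subvariety X \<phi> Y" "stratification X \<Y>"
    show "let L = closed_set_poset \<Y> in \<forall>Y\<in>\<Y>.
           is_scheme_intersection X Y (basics_above L Y) \<and>
           is_scheme_intersection X Y (minimal_elements L (basics_above L Y))"
      unfolding Let_def
    proof (intro ballI conjI)
      fix Y assume Y: "Y \<in> \<Y>"
      show "is_scheme_intersection X Y (basics_above (closed_set_poset \<Y>) Y)"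
        by (rule split_stratification_basics(1)[OF *(1-4) _ *(6) Y]) (use *(5) in blast)
      show "is_scheme_intersection X Y
          (minimal_elements (closed_set_poset \<Y>) (basics_above (closed_set_poset \<Y>) Y))"
        by (rule split_stratification_basics(2)[OF *(1-4) _ *(6) Y]) (use *(5) in blast)
    qed
  qed
  show ?third
  proof (intro allI impI, elim conjE)
    fix f :: "('n, int) mpoly" and S :: "nat set" and \<Y> :: "('n, rat) mpoly set set"
    assume S: "infinite S" "\<forall>p\<in>S. prime p"
      and split: "\<forall>p\<in>S. splitting p (poly_ring_mod p) (Tr_pow p f)"
        "\<forall>p\<in>S. splitting p (poly_ring_mod p) (Tr_pow p (init lam f))"
      and fin: "finite \<Y>" and sub: "\<forall>Y\<in>\<Y>. subvariety_rat Y"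
      and compat: "\<forall>Y\<in>\<Y>. \<forall>p\<in>S. compatibly_split (Tr_pow p f) (reduction p Y)"
      and strat: "stratification_rat \<Y>"
    interpret split_subvarieties f S \<Y>
    proof (rule split_subvarieties.intro)
      show "frob_trace p f 1 = 1" if "p \<in> S" for p
        using splitting_trace_one S(2) split(1) that by blast
    qed (use S sub compat in blast)+
    obtain p where p: "p \<in> S" using S(1) by fastforce
    then have "frob_trace p (init lam f) 1 = 1" using splitting_trace_one S(2) split(2) by blast
    then have fw: "weight_le lam f (weight lam all_vars)"
      using splitting_init_weight S(2) p by blast
    show "let L = subvariety_poset \<Y> in \<forall>Y\<in>\<Y>.
           \<forall>G. (\<forall>Z\<in>minimal_elements L (basics_above L Y). groebner_basis lam Z (G Z)) \<longrightarrow>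
              groebner_basis lam Y (\<Union>Z\<in>minimal_elements L (basics_above L Y). G Z)"
      unfolding Let_def
      by (intro ballI allI impI groebner_basis_of_minimal_basics[OF fw fin strat]) auto
  qed
qed

end
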